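(* Let $\alpha\in(0,1)$, $T>0$, let $\Omega\subset\mathbb R^d$ be a bounded Lipschitz domain, let $f\in L^\infty([0,T];L^2(\Omega))\cap BV([0,T];L^2(\Omega))$ be of bounded variation in time, and let $u^0\in H_0^1(\Omega)$. Let $N\ge1$ and consider the graded mesh $$t_j=\Big(\frac jN\Big)^rT,\qquad \tau_j=t_j-t_{j-1},$$ with grading parameter $1<r\le3.2016538$. Let $u^k$, $1\le k\le N$, be the solution of the L2 scheme $$L_k^\alpha u=\Delta u^k+f^k\ \text{ in }\Omega,\qquad u^k=0\ \text{ on }\partial\Omega,\qquad f^k=f(t_k,\cdot),$$ started from $u^0$. Then for all $1\le n\le N$ $$\|\nabla u^n\|_{L^2(\Omega)}\le\|\nabla u^0\|_{L^2(\Omega)}+2C_fC_\Omega,$$ where $C_f$ is a constant depending only on $f$ and $C_\Omega$ is the Sobolev embedding constant, depending only on $\Omega$ and $d$, in $\|v\|_{L^2(\Omega)}\le C_\Omega\|\nabla v\|_{L^2(\Omega)}$ for $v\in H_0^1(\Omega)$.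
   Context: The scheme discretizes the subdiffusion equation $\partial_t^\alpha u=\Delta u+f$ in $(0,T]\times\Omega$, $u=0$ on $(0,T]\times\partial\Omega$, $u(0,\cdot)=u^0$, with Caputo derivative $\partial_t^\alpha$. The scheme is understood weakly: $u^k\in H_0^1(\Omega)$ and $\langle L_k^\alpha u,v\rangle=-\langle\nabla u^k,\nabla v\rangle+\langle f^k,v\rangle$ for all $v\in H_0^1(\Omega)$, with $\langle\cdot,\cdot\rangle$ the $L^2(\Omega)$ inner product. The function $f$ is taken as defined at every $t\in[0,T]$, with $\|f(t)\|_{L^2(\Omega)}$ bounded uniformly in $t$ and with finite total variation $\sup\sum_i\|f(s_i)-f(s_{i-1})\|_{L^2(\Omega)}$ over finite increasing sequences $(s_i)$ in $[0,T]$. L2 operator: for $j\ge1$ let $H_2^j$ be the quadratic Lagrange polynomial in $t$ interpolating $u^{j-1},u^j,u^{j+1}$ at $t_{j-1},t_j,t_{j+1}$. Then $$L_1^\alpha u=\frac{u^1-u^0}{\Gamma(2-\alpha)\tau_1^\alpha},\qquad L_k^\alpha u=\frac1{\Gamma(1-\alpha)}\left(\sum_{j=1}^{k-1}\int_{t_{j-1}}^{t_j}\frac{\partial_sH_2^j(s)}{(t_k-s)^\alpha}ds+\int_{t_{k-1}}^{t_k}\frac{\partial_sH_2^{k-1}(s)}{(t_k-s)^\alpha}ds\right),\quad k\ge2.$$ *)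

theory Defs
  imports "HOL-Analysis.Analysis"
begin

text \<open>Near every boundary point, after a rigid motion, the set is the strict epigraph of a
  Lipschitz function: the unit vector \<open>\<nu>\<close> is the vertical direction, its orthogonal complement
  plays the role of the space of the remaining coordinates.\<close>

definition lipschitz_boundary :: "'a::euclidean_space set \<Rightarrow> bool" where
  "lipschitz_boundary \<Omega> \<longleftrightarrow>
    (\<forall>p\<in>frontier \<Omega>. \<exists>\<rho>>0. \<exists>\<nu>. norm \<nu> = 1 \<and>
      (\<exists>\<gamma> L. L-lipschitz_on {y. y \<bullet> \<nu> = 0} \<gamma> \<and>
        \<Omega> \<inter> ball p \<rho> = {x \<in> ball p \<rho>. x \<bullet> \<nu> > \<gamma> (x - (x \<bullet> \<nu>) *\<^sub>R \<nu>)}))"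

definition bounded_lipschitz_domain :: "'a::euclidean_space set \<Rightarrow> bool" where
  "bounded_lipschitz_domain \<Omega> \<longleftrightarrow>
    \<Omega> \<noteq> {} \<and> open \<Omega> \<and> connected \<Omega> \<and> bounded \<Omega> \<and> lipschitz_boundary \<Omega>"

text \<open>Elements of $L^2$ are represented by functions, not by classes modulo null sets.
  The codomain is the reals (where \<open>\<bullet>\<close> is multiplication) or, for gradients, the ambient space.\<close>

definition L2 :: "'a::euclidean_space set \<Rightarrow> ('a \<Rightarrow> 'b::euclidean_space) set" where
  "L2 \<Omega> = {v \<in> borel_measurable (lebesgue_on \<Omega>).
             integrable (lebesgue_on \<Omega>) (\<lambda>x. (norm (v x))\<^sup>2)}"

definition L2_inner ::
    "'a::euclidean_space set \<Rightarrow> ('a \<Rightarrow> 'b::euclidean_space) \<Rightarrow> ('a \<Rightarrow> 'b) \<Rightarrow> real" where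
  "L2_inner \<Omega> v w = (\<integral>x. v x \<bullet> w x \<partial>lebesgue_on \<Omega>)"

definition L2_norm :: "'a::euclidean_space set \<Rightarrow> ('a \<Rightarrow> 'b::euclidean_space) \<Rightarrow> real" where
  "L2_norm \<Omega> v = sqrt (L2_inner \<Omega> v v)"

abbreviation partial_deriv :: "'a::euclidean_space \<Rightarrow> ('a \<Rightarrow> real) \<Rightarrow> 'a \<Rightarrow> real" where
  "partial_deriv b \<phi> x \<equiv> frechet_derivative \<phi> (at x) b"

primrec C_diff :: "nat \<Rightarrow> ('a::euclidean_space \<Rightarrow> real) \<Rightarrow> bool" where
  "C_diff 0 \<phi> \<longleftrightarrow> continuous_on UNIV \<phi>"
| "C_diff (Suc m) \<phi> \<longleftrightarrow>
     (\<forall>x. \<phi> differentiable (at x)) \<and> (\<forall>b\<in>Basis. C_diff m (partial_deriv b \<phi>))"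

definition grad :: "('a::euclidean_space \<Rightarrow> real) \<Rightarrow> 'a \<Rightarrow> 'a" where
  "grad \<phi> x = (\<Sum>b\<in>Basis. partial_deriv b \<phi> x *\<^sub>R b)"

definition test_functions :: "'a::euclidean_space set \<Rightarrow> ('a \<Rightarrow> real) set" where
  "test_functions \<Omega> = {\<phi>. (\<forall>m. C_diff m \<phi>) \<and>
     compact (closure {x. \<phi> x \<noteq> 0}) \<and> closure {x. \<phi> x \<noteq> 0} \<subseteq> \<Omega>}"

definition has_weak_gradient ::
    "'a::euclidean_space set \<Rightarrow> ('a \<Rightarrow> real) \<Rightarrow> ('a \<Rightarrow> 'a) \<Rightarrow> bool" where
  "has_weak_gradient \<Omega> v g \<longleftrightarrow>
    (\<forall>\<phi>\<in>test_functions \<Omega>. \<forall>b\<in>Basis.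
      L2_inner \<Omega> v (partial_deriv b \<phi>) = - L2_inner \<Omega> (\<lambda>x. g x \<bullet> b) \<phi>)"

text \<open>\<open>H01 \<Omega> v g\<close> says that $v \in H_0^1(\Omega)$ and $\nabla v = g$, where $H_0^1(\Omega)$ is the
  closure of $C_c^\infty(\Omega)$ in the norm of $H^1(\Omega)$. As with \<open>has_derivative\<close>, the
  gradient is an argument of the relation; it is determined by \<open>v\<close> up to a null set.\<close>

definition H01 :: "'a::euclidean_space set \<Rightarrow> ('a \<Rightarrow> real) \<Rightarrow> ('a \<Rightarrow> 'a) \<Rightarrow> bool" where
  "H01 \<Omega> v g \<longleftrightarrow> v \<in> L2 \<Omega> \<and> g \<in> L2 \<Omega> \<and> has_weak_gradient \<Omega> v g \<and>
    (\<exists>\<phi>. (\<forall>m. \<phi> m \<in> test_functions \<Omega>) \<and>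
      (\<lambda>m. sqrt ((L2_norm \<Omega> (\<lambda>x. v x - \<phi> m x))\<^sup>2 +
                 (L2_norm \<Omega> (\<lambda>x. g x - grad (\<phi> m) x))\<^sup>2)) \<longlonglongrightarrow> 0)"

definition sobolev_constant :: "'a::euclidean_space set \<Rightarrow> real \<Rightarrow> bool" where
  "sobolev_constant \<Omega> C \<longleftrightarrow> 0 < C \<and> (\<forall>v g. H01 \<Omega> v g \<longrightarrow> L2_norm \<Omega> v \<le> C * L2_norm \<Omega> g)"

definition bounded_in_time :: "'a::euclidean_space set \<Rightarrow> real \<Rightarrow> (real \<Rightarrow> 'a \<Rightarrow> real) \<Rightarrow> bool" where
  "bounded_in_time \<Omega> T f \<longleftrightarrow> (\<exists>B. \<forall>t\<in>{0..T}. L2_norm \<Omega> (f t) \<le> B)"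

definition bounded_variation_in_time ::
    "'a::euclidean_space set \<Rightarrow> real \<Rightarrow> (real \<Rightarrow> 'a \<Rightarrow> real) \<Rightarrow> bool" where
  "bounded_variation_in_time \<Omega> T f \<longleftrightarrow>
    (\<exists>V. \<forall>(m::nat) s. strict_mono_on {0..m} s \<and> s ` {0..m} \<subseteq> {0..T} \<longrightarrow>
      (\<Sum>i=1..m. L2_norm \<Omega> (\<lambda>x. f (s i) x - f (s (i - 1)) x)) \<le> V)"

definition graded_mesh :: "real \<Rightarrow> nat \<Rightarrow> real \<Rightarrow> nat \<Rightarrow> real" where
  "graded_mesh T N r j = (real j / real N) powr r * T"

definition lagrange2 :: "(nat \<Rightarrow> real) \<Rightarrow> (nat \<Rightarrow> real) \<Rightarrow> nat \<Rightarrow> real \<Rightarrow> real" where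
  "lagrange2 t y j s =
     y (j - 1) * ((s - t j) * (s - t (j + 1))) / ((t (j - 1) - t j) * (t (j - 1) - t (j + 1))) +
     y j * ((s - t (j - 1)) * (s - t (j + 1))) / ((t j - t (j - 1)) * (t j - t (j + 1))) +
     y (j + 1) * ((s - t (j - 1)) * (s - t j)) / ((t (j + 1) - t (j - 1)) * (t (j + 1) - t j))"

text \<open>The operator for a real sequence \<open>y\<close>; for a sequence of functions on \<open>\<Omega>\<close> it is applied at
  each point. It is only used for \<open>k \<ge> 1\<close>.\<close>

definition L2_operator :: "real \<Rightarrow> (nat \<Rightarrow> real) \<Rightarrow> nat \<Rightarrow> (nat \<Rightarrow> real) \<Rightarrow> real" where
  "L2_operator \<alpha> t k y =
    (if k = 1 then (y 1 - y 0) / (Gamma (2 - \<alpha>) * (t 1 - t 0) powr \<alpha>)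
     else 1 / Gamma (1 - \<alpha>) *
       ((\<Sum>j=1..k-1. integral {t (j - 1)..t j}
            (\<lambda>s. deriv (lagrange2 t y j) s / (t k - s) powr \<alpha>)) +
        integral {t (k - 1)..t k}
            (\<lambda>s. deriv (lagrange2 t y (k - 1)) s / (t k - s) powr \<alpha>)))"

text \<open>\<open>Du k\<close> is the gradient of \<open>u k\<close>. The index \<open>k = 0\<close> is the initial value.\<close>

definition L2_scheme_solution ::
    "'a::euclidean_space set \<Rightarrow> real \<Rightarrow> (nat \<Rightarrow> real) \<Rightarrow> nat \<Rightarrow> (real \<Rightarrow> 'a \<Rightarrow> real) \<Rightarrow>
      (nat \<Rightarrow> 'a \<Rightarrow> real) \<Rightarrow> (nat \<Rightarrow> 'a \<Rightarrow> 'a) \<Rightarrow> bool" where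
  "L2_scheme_solution \<Omega> \<alpha> t N f u Du \<longleftrightarrow>
    (\<forall>k\<in>{1..N}. H01 \<Omega> (u k) (Du k) \<and>
      (\<forall>v g. H01 \<Omega> v g \<longrightarrow>
        L2_inner \<Omega> (\<lambda>x. L2_operator \<alpha> t k (\<lambda>j. u j x)) v =
          - L2_inner \<Omega> (Du k) g + L2_inner \<Omega> (f (t k)) v))"

end

theory Submission
  imports Defs
begin

text \<open>
  The estimate is an energy estimate: test the scheme at step \<open>k\<close> with \<open>u\<^sup>k - u\<^sup>k\<^sup>-\<^sup>1\<close> and sum. The
  gradient terms telescope, and summation by parts moves the differences onto \<open>f\<close>, which gives the
  constant \<open>C\<^sub>f = 2 sup \<parallel>f\<parallel> + Var f\<close>. Everything rests on the sign of
  \<open>\<Sum>\<^sub>k L\<^sub>k u \<cdot> (u\<^sup>k - u\<^sup>k\<^sup>-\<^sup>1)\<close>, which is nonnegative even at each point of the domain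
  (\<open>graded_mesh_L2_form_nonneg\<close>).

  Write \<open>\<delta>\<^sub>j\<close> for the increments, \<open>\<tau>\<^sub>j\<close> for the steps and \<open>\<rho>\<^sub>j = \<tau>\<^sub>j / \<tau>\<^sub>j\<^sub>-\<^sub>1\<close>. Then \<open>L\<^sub>k u\<close> is, up to
  the factor \<open>1 / \<Gamma>(1 - \<alpha>)\<close>, a linear form in \<open>\<delta>\<^sub>1, \<dots>, \<delta>\<^sub>k\<close> (\<open>L2_operator_eq\<close>). Away from the last
  cell its coefficients are functionals \<open>W\<^sub>j\<close> of the kernel \<open>(t\<^sub>k - s) powr (- \<alpha>)\<close>. When the steps do not
  shrink and \<open>g\<close> is increasing and convex, \<open>W\<^sub>j(g)\<close> lies between \<open>g(t\<^sub>j\<^sub>-\<^sub>1)\<close> and \<open>g(t\<^sub>j)\<close>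
  (\<open>increment_weight_bounds\<close>). Applied to kernels and to differences of kernels, this orders the
  coefficients along rows and columns, and arrays ordered in this way are positive
  (\<open>staircase_form_nonneg\<close>). What the argument does not cover is the negative subdiagonal entry that
  the parabola on the last cell produces. It is put into a tridiagonal form, together with the part of
  the diagonal that the staircase form does not use; the positivity of the tridiagonal form is a
  condition on \<open>\<alpha>\<close> and the step ratios (\<open>L2_form_nonneg\<close>).

  As \<open>\<alpha>\<close> tends to \<open>1\<close>, this condition becomes the positivity of the BDF2 form, which on the graded mesh
  fails for \<open>r\<close> only slightly larger than \<open>3.2016538\<close>. It is therefore verified by elimination with
  accurate bounds for the first ratios. For smaller \<open>\<alpha>\<close> the condition only gets easier
  (\<open>later_step_dominance\<close>, \<open>first_step_dominance\<close>).

  The Sobolev constant exists by the Poincare inequality, proved for test functions and extended to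
  their closure (\<open>sobolev_constant_exists\<close>).\<close>

section \<open>Positive quadratic forms and moments on an interval\<close>

text \<open>The mixed differences of such an array are nonnegative, which makes the form a nonnegative
combination of the squares \<open>(y p + \<dots> + y q)\<^sup>2\<close> over all blocks of consecutive indices: this is the
discrete form of the fact that a positive decreasing convex convolution kernel is positive definite. The energy
\<open>E n\<close> collects the blocks that end at \<open>n\<close>; the mixed condition says that passing from \<open>n\<close> to
\<open>n + 1\<close> loses energy, so the form dominates \<open>E n\<close>.\<close>

lemma staircase_form_nonneg:
  fixes S :: "nat \<Rightarrow> nat \<Rightarrow> real" and y :: "nat \<Rightarrow> real"
  assumes zero: "\<And>k. S k 0 = 0"
    and incr: "\<And>k p. p < k \<Longrightarrow> S k p \<le> S k (Suc p)"
    and mixed: "\<And>k p. p < k \<Longrightarrow> S (Suc k) (Suc p) - S (Suc k) p \<le> S k (Suc p) - S k p"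
  shows "0 \<le> (\<Sum>k=1..n. y k * (S k k * y k + 2 * (\<Sum>j=1..<k. S k j * y j)))"
proof -
  define Y where "Y p m = (\<Sum>i=Suc p..m. y i)" for p m
  define E where "E m = (\<Sum>p<m. (S m (Suc p) - S m p) * (Y p m)\<^sup>2)" for m
  have abel: "(\<Sum>p<m. (S k (Suc p) - S k p) * Y p m) = (\<Sum>j=1..m. S k j * y j)" for k m
  proof (induction m)
    case (Suc m)
    have "(\<Sum>p<Suc m. (S k (Suc p) - S k p) * Y p (Suc m)) =
        (\<Sum>p<Suc m. (S k (Suc p) - S k p) * Y p m + (S k (Suc p) - S k p) * y (Suc m))"
      by (intro sum.cong) (auto simp: Y_def algebra_simps)
    also have "\<dots> = (\<Sum>p<m. (S k (Suc p) - S k p) * Y p m)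
        + (\<Sum>p<Suc m. S k (Suc p) - S k p) * y (Suc m)"
      by (simp add: sum.distrib sum_distrib_right distrib_right) (simp add: Y_def)
    also have "\<dots> = (\<Sum>j=1..Suc m. S k j * y j)"
      using Suc by (simp only: sum_lessThan_telescope) (simp add: zero)
    finally show ?case .
  qed simp
  have E_le: "E m \<le> (\<Sum>k=1..m. y k * (S k k * y k + 2 * (\<Sum>j=1..<k. S k j * y j)))" for m
  proof (induction m)
    case (Suc m)
    have "E (Suc m) = (\<Sum>p<Suc m. (S (Suc m) (Suc p) - S (Suc m) p) * (Y p m)\<^sup>2
        + 2 * y (Suc m) * ((S (Suc m) (Suc p) - S (Suc m) p) * Y p m)
        + (S (Suc m) (Suc p) - S (Suc m) p) * (y (Suc m))\<^sup>2)"
      unfolding E_def by (intro sum.cong) (auto simp: Y_def algebra_simps power2_eq_square)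
    also have "\<dots> = (\<Sum>p<m. (S (Suc m) (Suc p) - S (Suc m) p) * (Y p m)\<^sup>2)
        + 2 * y (Suc m) * (\<Sum>p<m. (S (Suc m) (Suc p) - S (Suc m) p) * Y p m)
        + (\<Sum>p<Suc m. S (Suc m) (Suc p) - S (Suc m) p) * (y (Suc m))\<^sup>2"
      by (simp only: sum.distrib sum_distrib_left sum_distrib_right) (simp add: Y_def)
    also have "\<dots> = (\<Sum>p<m. (S (Suc m) (Suc p) - S (Suc m) p) * (Y p m)\<^sup>2)
        + 2 * y (Suc m) * (\<Sum>j=1..m. S (Suc m) j * y j) + S (Suc m) (Suc m) * (y (Suc m))\<^sup>2"
      by (simp only: abel sum_lessThan_telescope) (simp add: zero)
    also have "(\<Sum>p<m. (S (Suc m) (Suc p) - S (Suc m) p) * (Y p m)\<^sup>2) \<le> E m"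
      unfolding E_def by (intro sum_mono mult_right_mono) (auto intro: mixed)
    finally show ?case
      using Suc by (simp add: algebra_simps power2_eq_square atLeastLessThanSuc_atLeastAtMost)
  qed (simp add: E_def)
  have "0 \<le> E n"
    unfolding E_def by (intro sum_nonneg mult_nonneg_nonneg) (auto intro: incr)
  from this E_le show ?thesis by (rule order_trans)
qed

text \<open>Young's inequality with the multiplier \<open>\<theta> k\<close> splits each off-diagonal term between the two
diagonal entries next to it.\<close>

lemma tridiagonal_form_nonneg:
  fixes x e \<theta> y :: "nat \<Rightarrow> real"
  assumes e: "\<And>k. e k \<ge> 0" and \<theta>: "\<And>k. \<theta> k > 0" and e1: "e 1 = 0"
    and dom: "\<And>k. 1 \<le> k \<Longrightarrow> e k * \<theta> k + e (Suc k) / \<theta> (Suc k) \<le> x k"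
  shows "0 \<le> (\<Sum>k=1..n. x k * (y k)\<^sup>2 - 2 * e k * y k * y (k - 1))"
proof -
  have "e (Suc m) / \<theta> (Suc m) * (y m)\<^sup>2 \<le>
      (\<Sum>k=1..m. x k * (y k)\<^sup>2 - 2 * e k * y k * y (k - 1))" if "m \<ge> 1" for m
    using that
  proof (induction m rule: dec_induct)
    case base
    have "e 2 / \<theta> 2 * (y 1)\<^sup>2 \<le> x 1 * (y 1)\<^sup>2"
      using dom[of 1] e1 by (intro mult_right_mono) (auto simp: numeral_2_eq_2)
    then show ?case using e1 by (simp add: numeral_2_eq_2)
  next
    case (step m)
    have "2 * e (Suc m) * y (Suc m) * y m
        \<le> e (Suc m) * \<theta> (Suc m) * (y (Suc m))\<^sup>2 + e (Suc m) / \<theta> (Suc m) * (y m)\<^sup>2"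
    proof -
      have "0 \<le> e (Suc m) / \<theta> (Suc m) * (\<theta> (Suc m) * y (Suc m) - y m)\<^sup>2"
        using e[of "Suc m"] \<theta>[of "Suc m"] by simp
      also have "\<dots> = e (Suc m) * \<theta> (Suc m) * (y (Suc m))\<^sup>2 + e (Suc m) / \<theta> (Suc m) * (y m)\<^sup>2
          - 2 * e (Suc m) * y (Suc m) * y m"
        using \<theta>[of "Suc m"] by (simp add: field_simps power2_eq_square)
      finally show ?thesis by simp
    qed
    moreover have "(e (Suc m) * \<theta> (Suc m) + e (Suc (Suc m)) / \<theta> (Suc (Suc m))) * (y (Suc m))\<^sup>2
        \<le> x (Suc m) * (y (Suc m))\<^sup>2"
      by (intro mult_right_mono dom) auto
    ultimately show ?case using step.IH step.hyps by (simp add: algebra_simps)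
  qed
  note this[of n]
  moreover have "0 \<le> e (Suc n) / \<theta> (Suc n) * (y n)\<^sup>2"
    using e[of "Suc n"] \<theta>[of "Suc n"] by simp
  ultimately show ?thesis by (cases "n = 0") auto
qed

lemma has_integral_centred_identity:
  fixes a b :: real
  assumes "a \<le> b"
  shows "((\<lambda>s. s - (a + b) / 2) has_integral 0) {a..b}"
proof -
  have "((\<lambda>s. s - (a + b) / 2) has_integral
      ((b - (a + b) / 2)\<^sup>2 / 2 - (a - (a + b) / 2)\<^sup>2 / 2)) {a..b}"
    using assms by (intro fundamental_theorem_of_calculus)
      (auto intro!: derivative_eq_intros simp flip: has_real_derivative_iff_has_vector_derivative)
  moreover have "(b - (a + b) / 2)\<^sup>2 / 2 - (a - (a + b) / 2)\<^sup>2 / 2 = 0"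
    by (simp add: power2_eq_square field_simps)
  ultimately show ?thesis by simp
qed

lemma integral_centred_shift:
  fixes g :: "real \<Rightarrow> real"
  assumes "a \<le> b" and "continuous_on {a..b} g"
  shows "integral {a..b} (\<lambda>s. (s - (a + b) / 2) * g s) =
    integral {a..b} (\<lambda>s. (s - (a + b) / 2) * (g s - c))"
proof -
  have "(\<lambda>s. (s - (a + b) / 2) * g s) integrable_on {a..b}"
    using assms(2) by (intro integrable_continuous_real continuous_intros)
  then have "((\<lambda>s. (s - (a + b) / 2) * g s - (s - (a + b) / 2) * c) has_integral
      integral {a..b} (\<lambda>s. (s - (a + b) / 2) * g s) - 0 * c) {a..b}"
    by (intro has_integral_diff has_integral_mult_left has_integral_centred_identity assms(1))
      (simp add: integrable_integral)
  then show ?thesis by (simp add: right_diff_distrib integral_unique)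
qed

text \<open>Subtracting the value of \<open>g\<close> at the midpoint does not change the first moment and makes the
integrand a product of two factors of equal sign.\<close>

lemma centred_moment_nonneg:
  fixes g :: "real \<Rightarrow> real"
  assumes "a \<le> b" and cont: "continuous_on {a..b} g" and mono: "mono_on {a..b} g"
  shows "0 \<le> integral {a..b} (\<lambda>s. (s - (a + b) / 2) * g s)"
proof -
  let ?m = "(a + b) / 2"
  have "0 \<le> integral {a..b} (\<lambda>s. (s - ?m) * (g s - g ?m))"
  proof (rule integral_nonneg)
    show "(\<lambda>s. (s - ?m) * (g s - g ?m)) integrable_on {a..b}"
      using cont by (intro integrable_continuous_real continuous_intros)
    show "0 \<le> (s - ?m) * (g s - g ?m)" if s: "s \<in> {a..b}" for s
    proof -
      have "s \<ge> ?m \<Longrightarrow> g ?m \<le> g s" "s \<le> ?m \<Longrightarrow> g s \<le> g ?m"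
        using s by (auto intro!: mono_onD[OF mono])
      then show ?thesis by (cases "s \<ge> ?m") (auto intro: mult_nonpos_nonpos)
    qed
  qed
  then show ?thesis using integral_centred_shift[OF assms(1) cont, of "g ?m"] by simp
qed

text \<open>The combination on the right is the integral of \<open>g\<close> against a weight that is nonnegative, because
the tilt is at most half a cell, and that has mass \<open>b - a\<close>.\<close>

lemma left_value_le_tilted_mean:
  fixes g :: "real \<Rightarrow> real"
  assumes "a < b" and "0 \<le> c" and cont: "continuous_on {a..b} g" and mono: "mono_on {a..b} g"
  shows "(b - a) * g a \<le> integral {a..b} g
    - 2 / (b - a + c) * integral {a..b} (\<lambda>s. (s - (a + b) / 2) * g s)"
proof -
  let ?m = "(a + b) / 2"
  let ?h = "\<lambda>s. (g s - g a) - 2 / (b - a + c) * ((s - ?m) * (g s - g a))"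
  have "0 \<le> integral {a..b} ?h"
  proof (rule integral_nonneg)
    show "?h integrable_on {a..b}"
      using cont by (intro integrable_continuous_real continuous_intros)
    show "0 \<le> ?h s" if s: "s \<in> {a..b}" for s
    proof -
      have "2 * (s - ?m) \<le> b - a + c" using s assms(2) by (simp add: field_simps)
      then have "2 / (b - a + c) * (s - ?m) \<le> 1" using assms by (simp add: field_simps)
      moreover have "0 \<le> g s - g a" using mono_onD[OF mono, of a s] s by auto
      ultimately have "0 \<le> (1 - 2 / (b - a + c) * (s - ?m)) * (g s - g a)" by auto
      then show ?thesis by (simp only: left_diff_distrib mult_1_left mult.assoc)
    qed
  qed
  also have "integral {a..b} ?h = integral {a..b} (\<lambda>s. g s - g a)
      - 2 / (b - a + c) * integral {a..b} (\<lambda>s. (s - ?m) * (g s - g a))"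
    using cont assms(1,2) by (subst Henstock_Kurzweil_Integration.integral_diff)
      (auto intro!: integrable_continuous_real continuous_intros)
  also have "integral {a..b} (\<lambda>s. (s - ?m) * (g s - g a)) = integral {a..b} (\<lambda>s. (s - ?m) * g s)"
    using integral_centred_shift[of a b g "g a"] assms(1) cont by simp
  also have "integral {a..b} (\<lambda>s. g s - g a) = integral {a..b} g - (b - a) * g a"
    using cont assms(1) by (subst Henstock_Kurzweil_Integration.integral_diff)
      (auto intro!: integrable_continuous_real continuous_intros)
  finally show ?thesis by simp
qed

lemma mean_le_trapezoid:
  fixes g :: "real \<Rightarrow> real"
  assumes "a < b" and cont: "continuous_on {a..b} g" and conv: "convex_on {a..b} g"
  shows "integral {a..b} g \<le> (b - a) * ((g a + g b) / 2)"
proof -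
  let ?m = "(a + b) / 2"
  let ?c = "\<lambda>s. (g a + g b) / 2 + (s - ?m) * ((g b - g a) / (b - a))"
  have I: "(?c has_integral (b - a) * ((g a + g b) / 2) + 0 * ((g b - g a) / (b - a))) {a..b}"
    using assms(1) has_integral_const_real[of "(g a + g b) / 2" a b]
    by (intro has_integral_add has_integral_mult_left has_integral_centred_identity)
      (auto simp: field_simps)
  have "integral {a..b} g \<le> integral {a..b} ?c"
  proof (rule integral_le)
    show "g integrable_on {a..b}" using cont by (rule integrable_continuous_real)
    show "?c integrable_on {a..b}" using I by blast
    show "g s \<le> ?c s" if "s \<in> {a..b}" for s
    proof -
      have "g s \<le> (g b - g a) / (b - a) * (s - a) + g a"
        using convex_onD_Icc'[OF conv] that by simp
      also have "\<dots> = ?c s" using assms(1) by (simp add: field_simps)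
      finally show ?thesis .
    qed
  qed
  then show ?thesis using I by (simp add: integral_unique)
qed

text \<open>Convexity bounds the slope of \<open>g\<close> on \<open>{a..b}\<close> by its secant slope on the following interval. The
constant is not sharp; when steps do not shrink, it is small enough to be absorbed by the
trapezoidal rule on the following cell.\<close>

lemma centred_moment_le_next_increment:
  fixes g :: "real \<Rightarrow> real"
  assumes "a < b" "b < c" and cont: "continuous_on {a..b} g" and mono: "mono_on {a..c} g"
    and conv: "convex_on {a..c} g"
  shows "integral {a..b} (\<lambda>s. (s - (a + b) / 2) * g s) \<le>
    (b - a) ^ 3 / 2 * ((g c - g b) / (c - b))"
proof -
  let ?m = "(a + b) / 2" and ?L = "(g c - g b) / (c - b)"
  have L: "0 \<le> ?L" using mono_onD[OF mono, of b c] assms by auto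
  have "integral {a..b} (\<lambda>s. (s - ?m) * (g s - g b)) \<le>
      integral {a..b} (\<lambda>s. (b - a)\<^sup>2 / 2 * ?L)"
  proof (rule integral_le)
    show "(\<lambda>s. (s - ?m) * (g s - g b)) integrable_on {a..b}"
      using cont by (intro integrable_continuous_real continuous_intros)
    show "(\<lambda>s. (b - a)\<^sup>2 / 2 * ?L) integrable_on {a..b}" by (rule integrable_const_ivl)
    show "(s - ?m) * (g s - g b) \<le> (b - a)\<^sup>2 / 2 * ?L" if s: "s \<in> {a..b}" for s
    proof (cases "s \<ge> ?m")
      case True
      have "g s \<le> g b" using s assms by (intro mono_onD[OF mono]) auto
      then have "(s - ?m) * (g s - g b) \<le> 0" using True by (intro mult_nonneg_nonpos) auto
      also have "0 \<le> (b - a)\<^sup>2 / 2 * ?L" using L by (intro mult_nonneg_nonneg) auto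
      finally show ?thesis .
    next
      case False
      then have sb: "s < b" using s by (auto simp: field_simps)
      have "(g s - g b) / (s - b) \<le> (g b - g c) / (b - c)"
        using convex_on_slope_le[OF conv, of s c b] s sb assms by (auto simp: field_simps)
      also have "\<dots> = ?L" using assms by (simp add: field_simps)
      finally have "?L * (s - b) \<le> g s - g b"
        using sb by (simp only: neg_divide_le_eq diff_less_0_iff_less)
      then have "g b - g s \<le> ?L * (b - s)"
        by (metis minus_diff_eq mult_minus_right neg_le_iff_le)
      also have "\<dots> \<le> ?L * (b - a)" using s by (intro mult_left_mono L) auto
      finally have 1: "g b - g s \<le> ?L * (b - a)" .
      have 2: "g s \<le> g b" using s assms by (intro mono_onD[OF mono]) auto
      have 3: "?m - s \<le> (b - a) / 2" using s by (auto simp: field_simps)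
      have "(s - ?m) * (g s - g b) = (?m - s) * (g b - g s)"
        by (metis minus_diff_eq minus_mult_minus)
      also have "\<dots> \<le> ((b - a) / 2) * (?L * (b - a))"
        using 1 2 3 assms(1) by (intro mult_mono) simp_all
      also have "\<dots> = (b - a)\<^sup>2 / 2 * ?L" by (simp only: power2_eq_square) simp
      finally show ?thesis .
    qed
  qed
  then show ?thesis
    using integral_centred_shift[of a b g "g b"] assms(1) cont
    by (simp add: power2_eq_square power3_eq_cube field_simps)
qed

section \<open>Weights of the increments\<close>

text \<open>Throughout, \<open>t\<close> is a mesh, cell \<open>j\<close> is the interval from \<open>t (j - 1)\<close> to \<open>t j\<close>, and \<open>g\<close> stands for
the kernel \<open>(t\<^sub>k - s) powr (- \<alpha>)\<close> or for a difference of two such kernels.\<close>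

definition step :: "(nat \<Rightarrow> real) \<Rightarrow> nat \<Rightarrow> real" where
  "step t j = t j - t (j - 1)"

definition cell_mean :: "(nat \<Rightarrow> real) \<Rightarrow> (real \<Rightarrow> real) \<Rightarrow> nat \<Rightarrow> real" where
  "cell_mean t g j = integral {t (j - 1)..t j} g / step t j"

text \<open>The slope of the derivative of the interpolant on cell \<open>j\<close> is
\<open>2 (\<delta>\<^sub>j\<^sub>+\<^sub>1 / \<tau>\<^sub>j\<^sub>+\<^sub>1 - \<delta>\<^sub>j / \<tau>\<^sub>j) / (\<tau>\<^sub>j + \<tau>\<^sub>j\<^sub>+\<^sub>1)\<close>, with \<open>\<tau>\<close> the steps and \<open>\<delta>\<close> the increments of the data;
the normalisation makes the moment the coefficient of \<open>- \<delta>\<^sub>j\<close> in its contribution.\<close>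

definition cell_moment :: "(nat \<Rightarrow> real) \<Rightarrow> (real \<Rightarrow> real) \<Rightarrow> nat \<Rightarrow> real" where
  "cell_moment t g j = 2 / (step t j * (step t j + step t (Suc j))) *
     integral {t (j - 1)..t j} (\<lambda>s. (s - (t (j - 1) + t j) / 2) * g s)"

text \<open>The coefficient of the increment \<open>\<delta>\<^sub>j\<close> in the integral of the piecewise derivative of the
interpolant against \<open>g\<close>: cell \<open>j\<close> contributes a mean and a moment, the preceding cell sees \<open>\<delta>\<^sub>j\<close>
through the slope of its parabola.\<close>

definition increment_weight :: "(nat \<Rightarrow> real) \<Rightarrow> (real \<Rightarrow> real) \<Rightarrow> nat \<Rightarrow> real" where
  "increment_weight t g j = cell_mean t g j - cell_moment t g j +
     (if j \<le> 1 then 0 else cell_moment t g (j - 1) * step t (j - 1) / step t j)"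

definition widening_mesh :: "(nat \<Rightarrow> real) \<Rightarrow> bool" where
  "widening_mesh t \<longleftrightarrow> 0 < step t 1 \<and> (\<forall>j\<ge>1. step t j \<le> step t (Suc j))"

lemma step_pos:
  assumes "widening_mesh t" "j \<ge> 1"
  shows "0 < step t j"
  using assms(2)
proof (induction j rule: dec_induct)
  case (step j)
  then show ?case using assms(1) by (fastforce simp: widening_mesh_def)
qed (use assms in \<open>simp add: widening_mesh_def\<close>)

lemma step_mono: "widening_mesh t \<Longrightarrow> j \<ge> 1 \<Longrightarrow> step t j \<le> step t (Suc j)"
  by (auto simp: widening_mesh_def)

lemma widening_mesh_strict_mono: "widening_mesh t \<Longrightarrow> strict_mono t"
  using step_pos[of t "Suc j" for j] by (intro strict_mono_Suc_iff[THEN iffD2]) (auto simp: step_def)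

lemma increment_weight_diff:
  assumes t: "strict_mono t" and j: "j \<ge> 1"
    and f: "continuous_on {t 0..t j} f" and g: "continuous_on {t 0..t j} g"
  shows "increment_weight t (\<lambda>s. f s - g s) j = increment_weight t f j - increment_weight t g j"
proof -
  have sub: "{t (i - 1)..t i} \<subseteq> {t 0..t j}" if "i \<le> j" for i
    using that strict_mono_leD[OF t, of i j] strict_mono_leD[OF t, of 0 "i - 1"] by auto
  have mean: "cell_mean t (\<lambda>s. f s - g s) i = cell_mean t f i - cell_mean t g i" if "i \<le> j" for i
    using continuous_on_subset[OF f sub[OF that]] continuous_on_subset[OF g sub[OF that]]
    unfolding cell_mean_def diff_divide_distrib[symmetric]
    by (subst Henstock_Kurzweil_Integration.integral_diff) (auto intro!: integrable_continuous_real)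
  have moment: "cell_moment t (\<lambda>s. f s - g s) i = cell_moment t f i - cell_moment t g i"
    if "i \<le> j" for i
    using continuous_on_subset[OF f sub[OF that]] continuous_on_subset[OF g sub[OF that]]
    unfolding cell_moment_def right_diff_distrib
    by (subst Henstock_Kurzweil_Integration.integral_diff)
      (auto intro!: integrable_continuous_real continuous_intros simp: right_diff_distrib)
  show ?thesis
    unfolding increment_weight_def using j by (auto simp: mean moment algebra_simps diff_divide_distrib)
qed

lemma cell_moment_nonneg:
  assumes t: "widening_mesh t" and j: "j \<ge> 1"
    and "continuous_on {t (j - 1)..t j} g" "mono_on {t (j - 1)..t j} g"
  shows "0 \<le> cell_moment t g j"
proof -
  have "t (j - 1) \<le> t j"
    using step_pos[OF t j] by (simp add: step_def)
  then show ?thesis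
    unfolding cell_moment_def using step_pos[OF t j] step_pos[OF t, of "Suc j"] assms
    by (intro mult_nonneg_nonneg centred_moment_nonneg) auto
qed

text \<open>The heart of the argument: for a convex increasing \<open>g\<close> the weight of \<open>\<delta>\<^sub>j\<close> lies between the values of
\<open>g\<close> at the two ends of cell \<open>j\<close>, so consecutive weights are separated by a value of \<open>g\<close> and hence
ordered. The lower bound is the positivity of the tilted weight; for the upper bound the
trapezoidal rule leaves half of the increment of \<open>g\<close> over the cell, which pays for the moment of
the preceding cell.\<close>

lemma increment_weight_bounds:
  assumes t: "widening_mesh t" and j: "j \<ge> 1" and cont: "continuous_on {t 0..t j} g"
    and mono: "mono_on {t 0..t j} g" and conv: "convex_on {t 0..t j} g"
  shows "g (t (j - 1)) \<le> increment_weight t g j" and "increment_weight t g j \<le> g (t j)"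
proof -
  note inc = strict_mono_leD[OF widening_mesh_strict_mono[OF t]]
  have cell: "{t (j - 1)..t j} \<subseteq> {t 0..t j}" using inc[of 0 "j - 1"] by auto
  have pos: "0 < step t j" "0 < step t (Suc j)" using step_pos[OF t] j by auto
  have ab: "t (j - 1) < t j" using pos by (simp add: step_def)
  have moment: "0 \<le> cell_moment t g j"
    using t j continuous_on_subset[OF cont cell] mono_on_subset[OF mono cell]
    by (rule cell_moment_nonneg)
  define J where "J = integral {t (j - 1)..t j} (\<lambda>s. (s - (t (j - 1) + t j) / 2) * g s)"
  have "step t j * g (t (j - 1)) \<le>
      integral {t (j - 1)..t j} g - 2 / (step t j + step t (Suc j)) * J"
    using left_value_le_tilted_mean[OF ab _ continuous_on_subset[OF cont cell]
        mono_on_subset[OF mono cell], of "step t (Suc j)"] pos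
    by (simp add: step_def J_def)
  also have "\<dots> = step t j * (cell_mean t g j - cell_moment t g j)"
    unfolding cell_mean_def cell_moment_def J_def[symmetric] using pos by (simp add: right_diff_distrib)
  finally have low: "g (t (j - 1)) \<le> cell_mean t g j - cell_moment t g j"
    using pos by simp
  have "integral {t (j - 1)..t j} g \<le> step t j * ((g (t (j - 1)) + g (t j)) / 2)"
    using mean_le_trapezoid[OF ab continuous_on_subset[OF cont cell]]
      convex_on_subset[OF conv cell] by (simp add: step_def)
  then have mean: "cell_mean t g j \<le> (g (t (j - 1)) + g (t j)) / 2"
    unfolding cell_mean_def using pos by (simp add: field_simps)
  have gg: "g (t (j - 1)) \<le> g (t j)"
    using inc[of 0 j] inc[of 0 "j - 1"] ab by (intro mono_onD[OF mono]) auto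
  show "g (t (j - 1)) \<le> increment_weight t g j"
  proof (cases "j \<le> 1")
    case False
    have cell': "{t (j - 1 - 1)..t (j - 1)} \<subseteq> {t 0..t j}"
      using inc[of 0 "j - 1 - 1"] ab by auto
    have j1: "j - 1 \<ge> 1" using False by simp
    have "0 \<le> cell_moment t g (j - 1) * step t (j - 1) / step t j"
      using pos step_pos[OF t j1] cell_moment_nonneg[OF t j1 continuous_on_subset[OF cont cell']
          mono_on_subset[OF mono cell']]
      by (intro divide_nonneg_pos mult_nonneg_nonneg) auto
    then show ?thesis using low False by (simp add: increment_weight_def)
  qed (use low in \<open>simp add: increment_weight_def\<close>)
  show "increment_weight t g j \<le> g (t j)"
  proof (cases "j \<le> 1")
    case True
    then show ?thesis using mean moment gg by (simp add: increment_weight_def)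
  next
    case False
    define i where "i = j - 1"
    have ij: "j = Suc i" "i \<ge> 1" using False by (auto simp: i_def)
    have p: "0 < step t i" "step t i \<le> step t j"
      using step_pos[OF t ij(2)] step_mono[OF t ij(2)] ij by auto
    have sub: "{t (i - 1)..t j} \<subseteq> {t 0..t j}" using inc[of 0 "i - 1"] by auto
    have lt: "t (i - 1) < t i" using p by (simp add: step_def)
    have "continuous_on {t (i - 1)..t i} g"
      using continuous_on_subset[OF cont sub] by (rule continuous_on_subset) (use ab ij in auto)
    then have I: "integral {t (i - 1)..t i} (\<lambda>s. (s - (t (i - 1) + t i) / 2) * g s)
        \<le> step t i ^ 3 / 2 * ((g (t j) - g (t i)) / step t j)"
      using centred_moment_le_next_increment[OF lt _ _ mono_on_subset[OF mono sub]
          convex_on_subset[OF conv sub]] ab ij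
      by (simp add: step_def)
    have "cell_moment t g i * step t i / step t j \<le>
        2 / (step t i * (step t i + step t j)) *
        (step t i ^ 3 / 2 * ((g (t j) - g (t i)) / step t j)) * step t i / step t j"
      unfolding cell_moment_def ij(1)[symmetric]
      by (intro divide_right_mono mult_right_mono mult_left_mono I) (use p pos in simp_all)
    also have "\<dots> = (step t i ^ 3 / ((step t i + step t j) * step t j ^ 2)) * (g (t j) - g (t i))"
    proof -
      have rearrange: "2 / (a * P) * (a ^ 3 / 2 * (z / b)) * a / b = a ^ 3 / (P * b ^ 2) * z"
        if "a \<noteq> 0" "P \<noteq> 0" "b \<noteq> 0" for a P b z :: real
        using that by (simp add: divide_simps power2_eq_square power3_eq_cube)
      show ?thesis by (rule rearrange) (use p pos in auto)
    qed
    also have "\<dots> \<le> (1 / 2) * (g (t j) - g (t i))"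
    proof (rule mult_right_mono)
      \<comment> \<open>Here the assumption that steps do not shrink is used.\<close>
      have "2 * step t i ^ 3 = (step t i + step t i) * step t i ^ 2"
        by (simp add: power2_eq_square power3_eq_cube)
      also have "\<dots> \<le> (step t i + step t j) * step t j ^ 2"
        using p by (intro mult_mono power_mono) auto
      finally have "2 * step t i ^ 3 \<le> (step t i + step t j) * step t j ^ 2" .
      moreover have "0 < (step t i + step t j) * step t j ^ 2" using p by simp
      ultimately show "step t i ^ 3 / ((step t i + step t j) * step t j ^ 2) \<le> 1 / 2"
        by (simp only: pos_divide_le_eq)
      show "0 \<le> g (t j) - g (t i)" using gg ij by simp
    qed
    finally have "cell_moment t g i * step t i / step t j \<le> (g (t j) - g (t i)) / 2" by simp
    then show ?thesis using mean moment False ij by (simp add: increment_weight_def field_simps)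
  qed
qed

definition kernel :: "real \<Rightarrow> (nat \<Rightarrow> real) \<Rightarrow> nat \<Rightarrow> real \<Rightarrow> real" where
  "kernel \<alpha> t k s = (t k - s) powr (- \<alpha>)"

lemma kernel_admissible:
  assumes "0 < \<alpha>" and "b < t k"
  shows "continuous_on {a..b} (kernel \<alpha> t k)" "mono_on {a..b} (kernel \<alpha> t k)"
    "convex_on {a..b} (kernel \<alpha> t k)"
proof -
  show "continuous_on {a..b} (kernel \<alpha> t k)"
    unfolding kernel_def using assms by (intro continuous_intros) auto
  show "mono_on {a..b} (kernel \<alpha> t k)"
    unfolding kernel_def using assms by (intro mono_onI powr_mono2') auto
  show "convex_on {a..b} (kernel \<alpha> t k)"
  proof (rule f''_ge0_imp_convex)
    fix s assume s: "s \<in> {a..b}"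
    show "(kernel \<alpha> t k has_real_derivative \<alpha> * (t k - s) powr (- \<alpha> - 1)) (at s)"
      unfolding kernel_def using s assms by (auto intro!: derivative_eq_intros)
    show "((\<lambda>s. \<alpha> * (t k - s) powr (- \<alpha> - 1)) has_real_derivative
        \<alpha> * ((\<alpha> + 1) * (t k - s) powr (- \<alpha> - 2))) (at s)"
      using s assms by (auto intro!: derivative_eq_intros simp: algebra_simps)
    show "0 \<le> \<alpha> * ((\<alpha> + 1) * (t k - s) powr (- \<alpha> - 2))" using assms by simp
  qed simp
qed

text \<open>The kernel is completely monotone as a function of the distance to \<open>t k\<close>, so a difference of two
kernels inherits positivity of the first two derivatives.\<close>

lemma kernel_diff_admissible:
  assumes "0 < \<alpha>" and "b < t k" and "t k \<le> t (Suc k)"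
  shows "continuous_on {a..b} (\<lambda>s. kernel \<alpha> t k s - kernel \<alpha> t (Suc k) s)"
    "mono_on {a..b} (\<lambda>s. kernel \<alpha> t k s - kernel \<alpha> t (Suc k) s)"
    "convex_on {a..b} (\<lambda>s. kernel \<alpha> t k s - kernel \<alpha> t (Suc k) s)"
proof -
  let ?g = "\<lambda>s. kernel \<alpha> t k s - kernel \<alpha> t (Suc k) s"
  let ?g' = "\<lambda>s. \<alpha> * (t k - s) powr (- \<alpha> - 1) - \<alpha> * (t (Suc k) - s) powr (- \<alpha> - 1)"
  let ?g'' = "\<lambda>s. \<alpha> * ((\<alpha> + 1) * (t k - s) powr (- \<alpha> - 2))
    - \<alpha> * ((\<alpha> + 1) * (t (Suc k) - s) powr (- \<alpha> - 2))"
  show "continuous_on {a..b} ?g"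
    using kernel_admissible(1)[of \<alpha> b t k a] kernel_admissible(1)[of \<alpha> b t "Suc k" a] assms
    by (intro continuous_intros) auto
  have d1: "(?g has_real_derivative ?g' s) (at s)" if "s \<le> b" for s
    unfolding kernel_def using that assms by (auto intro!: derivative_eq_intros)
  have d2: "(?g' has_real_derivative ?g'' s) (at s)" if "s \<le> b" for s
    using that assms by (auto intro!: derivative_eq_intros simp: algebra_simps)
  show "mono_on {a..b} ?g"
  proof (rule mono_onI)
    fix r s assume rs: "r \<in> {a..b}" "s \<in> {a..b}" "r \<le> s"
    show "?g r \<le> ?g s"
    proof (rule DERIV_nonneg_imp_nondecreasing[OF rs(3)])
      fix x assume "r \<le> x" "x \<le> s"
      then have "0 \<le> ?g' x" using assms rs
        by (auto intro!: mult_left_mono powr_mono2')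
      then show "\<exists>y. (?g has_real_derivative y) (at x) \<and> 0 \<le> y"
        using d1[of x] \<open>x \<le> s\<close> rs by fastforce
    qed
  qed
  show "convex_on {a..b} ?g"
  proof (rule f''_ge0_imp_convex)
    fix s assume s: "s \<in> {a..b}"
    show "(?g has_real_derivative ?g' s) (at s)" using d1 s by auto
    show "(?g' has_real_derivative ?g'' s) (at s)" using d2 s by auto
    show "0 \<le> ?g'' s" using assms s by (auto intro!: mult_left_mono powr_mono2')
  qed simp
qed

section \<open>The operator as a linear form in the increments\<close>

definition incr :: "(nat \<Rightarrow> real) \<Rightarrow> nat \<Rightarrow> real" where
  "incr y j = y j - y (j - 1)"

text \<open>The derivative of the Lagrange parabola at \<open>x\<close>, measured from its left node, in Newton form.\<close>

lemma lagrange2_derivative_identity: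
  fixes a p q x y0 y1 y2 :: real
  assumes "p > 0" "q > 0"
  shows "y0 * ((x - p) + (x - (p + q))) / ((- p) * (- (p + q))) +
      y1 * (x + (x - (p + q))) / (p * (- q)) + y2 * (x + (x - p)) / ((p + q) * q) =
    (y1 - y0) / p + (x - p / 2) * (2 * ((y2 - y1) / q - (y1 - y0) / p) / (p + q))"
proof -
  have "p + q \<noteq> 0" "p \<noteq> 0" "q \<noteq> 0" using assms by auto
  then show ?thesis
    by (simp add: divide_simps) algebra
qed

lemma deriv_lagrange2:
  assumes p: "0 < step t j" and q: "0 < step t (Suc j)"
  shows "deriv (lagrange2 t y j) s = incr y j / step t j + (s - (t (j - 1) + t j) / 2) *
      (2 * (incr y (Suc j) / step t (Suc j) - incr y j / step t j) / (step t j + step t (Suc j)))"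
proof -
  define x where "x = s - t (j - 1)"
  have "deriv (lagrange2 t y j) s =
     y (j - 1) * ((s - t j) + (s - t (j + 1))) / ((t (j - 1) - t j) * (t (j - 1) - t (j + 1))) +
     y j * ((s - t (j - 1)) + (s - t (j + 1))) / ((t j - t (j - 1)) * (t j - t (j + 1))) +
     y (j + 1) * ((s - t (j - 1)) + (s - t j)) / ((t (j + 1) - t (j - 1)) * (t (j + 1) - t j))"
    unfolding lagrange2_def divide_inverse
    by (intro DERIV_imp_deriv) (auto intro!: derivative_eq_intros simp: algebra_simps)
  also have "\<dots> = y (j - 1) * ((x - step t j) + (x - (step t j + step t (Suc j)))) /
        ((- step t j) * (- (step t j + step t (Suc j)))) +
      y j * (x + (x - (step t j + step t (Suc j)))) / (step t j * (- step t (Suc j))) +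
      y (j + 1) * (x + (x - step t j)) / ((step t j + step t (Suc j)) * step t (Suc j))"
    by (simp add: x_def step_def)
  also have "\<dots> = (y j - y (j - 1)) / step t j + (x - step t j / 2) *
      (2 * ((y (j + 1) - y j) / step t (Suc j) - (y j - y (j - 1)) / step t j) /
        (step t j + step t (Suc j)))"
    using p q by (rule lagrange2_derivative_identity)
  also have "x - step t j / 2 = s - (t (j - 1) + t j) / 2"
    by (simp add: x_def step_def field_simps)
  finally show ?thesis by (simp add: incr_def)
qed

lemma deriv_lagrange2_right:
  assumes p: "0 < step t j" and q: "0 < step t (Suc j)"
  shows "deriv (lagrange2 t y j) s = incr y (Suc j) / step t (Suc j) + (s - (t j + t (Suc j)) / 2) *
      (2 * (incr y (Suc j) / step t (Suc j) - incr y j / step t j) / (step t j + step t (Suc j)))"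
proof -
  let ?d = "incr y (Suc j) / step t (Suc j) - incr y j / step t j"
  have m: "s - (t (j - 1) + t j) / 2 = (s - (t j + t (Suc j)) / 2) + (step t j + step t (Suc j)) / 2"
    by (simp add: step_def field_simps)
  have "z / 2 * (2 * d / z) = d" if "0 < z" for z d :: real using that by simp
  from this[of "step t j + step t (Suc j)" ?d]
  have "(step t j + step t (Suc j)) / 2 * (2 * ?d / (step t j + step t (Suc j))) = ?d"
    using p q by simp
  then show ?thesis
    unfolding deriv_lagrange2[OF assms] m by (simp only: distrib_right)
qed

text \<open>The kernel is singular at the right end, but its antiderivatives are continuous there, so the
fundamental theorem of calculus applies on the closed cell.\<close>

lemma last_cell_integrals:
  fixes a b \<alpha> :: real
  assumes "0 < \<alpha>" "\<alpha> < 1" "a < b"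
  shows "((\<lambda>s. (b - s) powr (- \<alpha>)) has_integral (b - a) powr (1 - \<alpha>) / (1 - \<alpha>)) {a..b}"
    and "((\<lambda>s. (s - (a + b) / 2) * (b - s) powr (- \<alpha>)) has_integral
      \<alpha> / (2 * (1 - \<alpha>) * (2 - \<alpha>)) * (b - a) powr (2 - \<alpha>)) {a..b}"
proof -
  have cont: "continuous_on {a..b} (\<lambda>s. (b - s) powr c)" if "0 < c" for c :: real
    using that by (intro continuous_on_powr' continuous_intros) auto
  define F where "F s = - ((b - s) powr (1 - \<alpha>) / (1 - \<alpha>))" for s
  define G where "G s = (b - s) powr (2 - \<alpha>) / (2 - \<alpha>)" for s
  have F: "(F has_real_derivative (b - s) powr (- \<alpha>)) (at s)" if "s \<in> {a<..<b}" for s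
    unfolding F_def using that assms by (auto intro!: derivative_eq_intros)
  have G: "(G has_real_derivative - ((b - s) powr (1 - \<alpha>))) (at s)" if "s \<in> {a<..<b}" for s
    unfolding G_def using that assms by (auto intro!: derivative_eq_intros)
  have contF: "continuous_on {a..b} F" and contG: "continuous_on {a..b} G"
    unfolding F_def G_def using assms by (auto intro!: continuous_intros cont)
  have iF: "((\<lambda>s. (b - s) powr (- \<alpha>)) has_integral F b - F a) {a..b}"
    using assms F contF by (intro fundamental_theorem_of_calculus_interior)
      (auto simp flip: has_real_derivative_iff_has_vector_derivative)
  have iG: "((\<lambda>s. - ((b - s) powr (1 - \<alpha>))) has_integral G b - G a) {a..b}"
    using assms G contG by (intro fundamental_theorem_of_calculus_interior)
      (auto simp flip: has_real_derivative_iff_has_vector_derivative)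
  show "((\<lambda>s. (b - s) powr (- \<alpha>)) has_integral (b - a) powr (1 - \<alpha>) / (1 - \<alpha>)) {a..b}"
    using iF assms by (simp add: F_def)
  have "((\<lambda>s. (b - a) / 2 * (b - s) powr (- \<alpha>) + - ((b - s) powr (1 - \<alpha>))) has_integral
      (b - a) / 2 * (F b - F a) + (G b - G a)) {a..b}"
    by (intro has_integral_add has_integral_mult_right iF iG)
  moreover have "(b - a) / 2 * (b - s) powr (- \<alpha>) + - ((b - s) powr (1 - \<alpha>)) =
      (s - (a + b) / 2) * (b - s) powr (- \<alpha>)" if "s \<in> {a..b}" for s
  proof (cases "s = b")
    case False
    then have "(b - s) powr (1 - \<alpha>) = (b - s) * (b - s) powr (- \<alpha>)"
      using that by (subst powr_mult_base) auto
    then show ?thesis by (simp add: field_simps)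
  qed simp
  moreover have "(b - a) / 2 * (F b - F a) + (G b - G a) =
      \<alpha> / (2 * (1 - \<alpha>) * (2 - \<alpha>)) * (b - a) powr (2 - \<alpha>)"
  proof -
    have "(b - a) powr (2 - \<alpha>) = (b - a) * (b - a) powr (1 - \<alpha>)"
      using assms by (subst powr_mult_base) auto
    then have "(b - a) / 2 * (F b - F a) + (G b - G a) =
        (1 / (2 * (1 - \<alpha>)) - 1 / (2 - \<alpha>)) * (b - a) powr (2 - \<alpha>)"
      using assms by (simp add: F_def G_def left_diff_distrib)
    also have "1 / (2 * (1 - \<alpha>)) - 1 / (2 - \<alpha>) = \<alpha> / (2 * (1 - \<alpha>) * (2 - \<alpha>))"
      using assms by (simp add: divide_simps)
    finally show ?thesis .
  qed
  ultimately show "((\<lambda>s. (s - (a + b) / 2) * (b - s) powr (- \<alpha>)) has_integral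
      \<alpha> / (2 * (1 - \<alpha>) * (2 - \<alpha>)) * (b - a) powr (2 - \<alpha>)) {a..b}"
    by (metis (no_types, lifting) has_integral_eq)
qed

text \<open>The parabola on the last cell is the one of the preceding cell. Its slope adds this amount to the
diagonal coefficient and subtracts a multiple of it from the subdiagonal one. As \<open>\<alpha>\<close> tends to \<open>1\<close> this is
the correction that turns the backward Euler scheme into BDF2.\<close>

definition last_cell_tilt :: "real \<Rightarrow> (nat \<Rightarrow> real) \<Rightarrow> nat \<Rightarrow> real" where
  "last_cell_tilt \<alpha> t k = \<alpha> / ((1 - \<alpha>) * (2 - \<alpha>)) * step t k powr (1 - \<alpha>) / (step t (k - 1) + step t k)"

lemma L2_operator_Suc0:
  assumes "0 < \<alpha>" "\<alpha> < 1" "0 < step t 1"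
  shows "L2_operator \<alpha> t 1 y = 1 / Gamma (1 - \<alpha>) * (step t 1 powr (- \<alpha>) / (1 - \<alpha>) * incr y 1)"
proof -
  have "1 - \<alpha> \<notin> \<int>\<^sub>\<le>\<^sub>0" using assms by (auto elim!: nonpos_Ints_cases)
  then have "Gamma (2 - \<alpha>) = (1 - \<alpha>) * Gamma (1 - \<alpha>)"
    using Gamma_plus1[of "1 - \<alpha>"] by (simp add: algebra_simps)
  then show ?thesis
    by (simp add: L2_operator_def incr_def step_def powr_minus_divide)
qed

text \<open>The operator as a linear form in the increments. The sum over cells \<open>j < k\<close> is regrouped by
increments, which produces the weights.\<close>

lemma L2_operator_eq:
  assumes t: "widening_mesh t" and \<alpha>: "0 < \<alpha>" "\<alpha> < 1" and k: "k \<ge> 2"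
  shows "L2_operator \<alpha> t k y = 1 / Gamma (1 - \<alpha>) *
    ((step t k powr (- \<alpha>) / (1 - \<alpha>) + last_cell_tilt \<alpha> t k
        + cell_moment t (kernel \<alpha> t k) (k - 1) * step t (k - 1) / step t k) * incr y k
      - last_cell_tilt \<alpha> t k * step t k / step t (k - 1) * incr y (k - 1)
      + (\<Sum>j=1..<k. increment_weight t (kernel \<alpha> t k) j * incr y j))"
proof -
  define A where "A = cell_mean t (kernel \<alpha> t k)"
  define B where "B = cell_moment t (kernel \<alpha> t k)"
  note mono = widening_mesh_strict_mono[OF t]
  have pos: "0 < step t j" if "j \<ge> 1" for j using step_pos[OF t that] .
  have cell: "integral {t (j - 1)..t j} (\<lambda>s. deriv (lagrange2 t y j) s / (t k - s) powr \<alpha>) =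
      (A j - B j) * incr y j + B j * step t j / step t (Suc j) * incr y (Suc j)"
    if j: "j \<in> {1..k - 1}" for j
  proof -
    let ?m = "(t (j - 1) + t j) / 2"
    let ?d = "incr y j / step t j"
    let ?e = "2 * (incr y (Suc j) / step t (Suc j) - incr y j / step t j) / (step t j + step t (Suc j))"
    have p: "0 < step t j" "0 < step t (Suc j)" using pos j by auto
    have "t j < t k" using j k by (intro strict_monoD[OF mono]) auto
    then have cont: "continuous_on {t (j - 1)..t j} (kernel \<alpha> t k)"
      using kernel_admissible(1)[OF \<alpha>(1)] by blast
    have "integral {t (j - 1)..t j} (\<lambda>s. deriv (lagrange2 t y j) s / (t k - s) powr \<alpha>) =
        integral {t (j - 1)..t j} (\<lambda>s. ?d * kernel \<alpha> t k s + ?e * ((s - ?m) * kernel \<alpha> t k s))"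
      unfolding deriv_lagrange2[OF p] kernel_def powr_minus_divide
      by (intro arg_cong[where f = "integral _"]) (auto simp: add_divide_distrib)
    also have "\<dots> = ?d * integral {t (j - 1)..t j} (kernel \<alpha> t k)
        + ?e * integral {t (j - 1)..t j} (\<lambda>s. (s - ?m) * kernel \<alpha> t k s)"
      using cont p by (subst Henstock_Kurzweil_Integration.integral_add)
        (auto intro!: integrable_continuous_real continuous_intros)
    also have "integral {t (j - 1)..t j} (kernel \<alpha> t k) = A j * step t j"
      using p by (simp add: A_def cell_mean_def)
    also have "integral {t (j - 1)..t j} (\<lambda>s. (s - ?m) * kernel \<alpha> t k s) =
        B j * (step t j * (step t j + step t (Suc j))) / 2"
      using p by (simp add: B_def cell_moment_def)
    also have "?d * (A j * step t j) + ?e * (B j * (step t j * (step t j + step t (Suc j))) / 2) =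
      ?d * (A j * step t j) + (incr y (Suc j) / step t (Suc j) - incr y j / step t j) * (B j * step t j)"
    proof -
      have rearrange: "2 * d / P * (b * (x * P) / 2) = d * (b * x)" if "P \<noteq> 0" for d P b x :: real
        using that by simp
      have "step t j + step t (Suc j) \<noteq> 0" using p by simp
      from rearrange[OF this] show ?thesis by (simp only:)
    qed
    also have "\<dots> = (A j - B j) * incr y j + B j * step t j / step t (Suc j) * incr y (Suc j)"
      using p by (simp add: field_simps)
    finally show ?thesis .
  qed
  have last: "integral {t (k - 1)..t k} (\<lambda>s. deriv (lagrange2 t y (k - 1)) s / (t k - s) powr \<alpha>) =
      (step t k powr (- \<alpha>) / (1 - \<alpha>) + last_cell_tilt \<alpha> t k) * incr y k
      - last_cell_tilt \<alpha> t k * step t k / step t (k - 1) * incr y (k - 1)"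
  proof -
    define P Q where "P = step t (k - 1)" and "Q = step t k"
    let ?m = "(t (k - 1) + t k) / 2"
    let ?d = "incr y k / Q"
    let ?e = "2 * (incr y k / Q - incr y (k - 1) / P) / (P + Q)"
    have Sk: "Suc (k - 1) = k" using k by simp
    have p: "0 < P" "0 < Q" using pos k by (auto simp: P_def Q_def)
    then have lt: "t (k - 1) < t k" by (simp add: Q_def step_def)
    have "integral {t (k - 1)..t k} (\<lambda>s. deriv (lagrange2 t y (k - 1)) s / (t k - s) powr \<alpha>) =
        integral {t (k - 1)..t k} (\<lambda>s. ?d * (t k - s) powr (- \<alpha>)
          + ?e * ((s - ?m) * (t k - s) powr (- \<alpha>)))"
      using deriv_lagrange2_right[of t "k - 1" y] p
      unfolding powr_minus_divide Sk P_def[symmetric] Q_def[symmetric]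
      by (intro arg_cong[where f = "integral _"]) (auto simp: add_divide_distrib)
    also have "\<dots> = ?d * (Q powr (1 - \<alpha>) / (1 - \<alpha>))
        + ?e * (\<alpha> / (2 * (1 - \<alpha>) * (2 - \<alpha>)) * Q powr (2 - \<alpha>))"
      using last_cell_integrals[OF \<alpha> lt] unfolding Q_def step_def
      by (intro integral_unique has_integral_add has_integral_mult_right)
    also have "?d * (Q powr (1 - \<alpha>) / (1 - \<alpha>)) = Q powr (- \<alpha>) / (1 - \<alpha>) * incr y k"
    proof -
      have "Q powr (1 - \<alpha>) = Q * Q powr (- \<alpha>)" using p by (subst powr_mult_base) auto
      then show ?thesis using p by (simp add: mult_ac)
    qed
    also have "?e * (\<alpha> / (2 * (1 - \<alpha>) * (2 - \<alpha>)) * Q powr (2 - \<alpha>)) =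
        last_cell_tilt \<alpha> t k * incr y k - last_cell_tilt \<alpha> t k * Q / P * incr y (k - 1)"
    proof -
      have "Q powr (2 - \<alpha>) = Q * Q powr (1 - \<alpha>)"
        using p by (subst powr_mult_base) auto
      moreover have "?e * (\<alpha> / (2 * (1 - \<alpha>) * (2 - \<alpha>)) * (Q * Q powr (1 - \<alpha>))) =
         \<alpha> / ((1 - \<alpha>) * (2 - \<alpha>)) * Q powr (1 - \<alpha>) / (P + Q) * (Q * (incr y k / Q - incr y (k - 1) / P))"
      proof -
        have "2 * D / S * (\<alpha> / (2 * u * v) * (Q * X)) = \<alpha> / (u * v) * X / S * (Q * D)"
          for D S u v X :: real by (simp add: mult_ac)
        then show ?thesis .
      qed
      moreover have "Q * (incr y k / Q - incr y (k - 1) / P) = incr y k - Q / P * incr y (k - 1)"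
        using p by (simp add: right_diff_distrib)
      ultimately show ?thesis
        by (simp add: last_cell_tilt_def P_def Q_def right_diff_distrib)
    qed
    finally show ?thesis by (simp add: P_def Q_def distrib_right)
  qed
  have shift: "(\<Sum>j=1..k - 1. B j * step t j / step t (Suc j) * incr y (Suc j)) =
      (\<Sum>j=1..<k. (if j \<le> 1 then 0 else B (j - 1) * step t (j - 1) / step t j) * incr y j)
      + B (k - 1) * step t (k - 1) / step t k * incr y k"
  proof -
    have "(\<Sum>j=1..k - 1. B j * step t j / step t (Suc j) * incr y (Suc j)) =
        (\<Sum>j=2..<Suc k. B (j - 1) * step t (j - 1) / step t j * incr y j)"
      using k by (intro sum.reindex_bij_witness[of _ "\<lambda>j. j - 1" Suc]) auto
    also have "\<dots> = (\<Sum>j=2..<k. B (j - 1) * step t (j - 1) / step t j * incr y j)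
        + B (k - 1) * step t (k - 1) / step t k * incr y k"
      using k by simp
    also have "(\<Sum>j=2..<k. B (j - 1) * step t (j - 1) / step t j * incr y j) =
        (\<Sum>j=1..<k. (if j \<le> 1 then 0 else B (j - 1) * step t (j - 1) / step t j) * incr y j)"
      by (rule sum.mono_neutral_cong_left) auto
    finally show ?thesis .
  qed
  have "(\<Sum>j=1..k-1. integral {t (j - 1)..t j}
      (\<lambda>s. deriv (lagrange2 t y j) s / (t k - s) powr \<alpha>)) =
    (\<Sum>j=1..<k. (A j - B j) * incr y j) +
    (\<Sum>j=1..k - 1. B j * step t j / step t (Suc j) * incr y (Suc j))"
    using k cell by (simp add: sum.distrib atLeastLessThanSuc_atLeastAtMost[symmetric])
  also have "\<dots> = (\<Sum>j=1..<k. increment_weight t (kernel \<alpha> t k) j * incr y j)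
      + B (k - 1) * step t (k - 1) / step t k * incr y k"
    unfolding shift add.assoc[symmetric] sum.distrib[symmetric] increment_weight_def A_def[symmetric] B_def[symmetric]
    by (simp only: distrib_right)
  finally show ?thesis
    using k last unfolding L2_operator_def B_def by (simp add: distrib_right)
qed

section \<open>Positivity under conditions on the step ratios\<close>

definition step_ratio :: "(nat \<Rightarrow> real) \<Rightarrow> nat \<Rightarrow> real" where
  "step_ratio t k = step t k / step t (k - 1)"

lemma last_cell_tilt_eq:
  assumes "0 < step t k" "0 < step t (k - 1)"
  shows "last_cell_tilt \<alpha> t k = step t k powr (- \<alpha>) / (1 - \<alpha>) *
      (\<alpha> / (2 - \<alpha>) * (step_ratio t k / (1 + step_ratio t k)))"
proof -
  have "step t k powr (1 - \<alpha>) = step t k * step t k powr (- \<alpha>)"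
    using assms by (subst powr_mult_base) auto
  moreover have "step_ratio t k / (1 + step_ratio t k) = step t k / (step t (k - 1) + step t k)"
    using assms by (simp add: step_ratio_def divide_simps)
  ultimately show ?thesis by (simp add: last_cell_tilt_def mult_ac)
qed

text \<open>The matrix of the operator, in terms of increments, is the sum of a staircase form, whose
off-diagonal entries are the weights of the kernels, and a tridiagonal form that carries the negative
subdiagonal entries from the last cell. The diagonal of the staircase form is chosen as small as
its mixed condition allows, which leaves \<open>x k\<close> for the tridiagonal form. After division by
\<open>step t k powr (- \<alpha>) / (1 - \<alpha>)\<close> the dominance conditions for the multipliers \<open>\<theta>\<close> involve
\<open>\<alpha>\<close> and the step ratios only. The terms with the factor \<open>1 - \<alpha>\<close> on the right bound the staircase
diagonal by kernel values at mesh points.\<close>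

lemma L2_form_nonneg:
  assumes t: "widening_mesh t" and \<alpha>: "0 < \<alpha>" "\<alpha> < 1"
    and \<theta>: "\<And>k. 0 < \<theta> k"
    and first: "\<alpha> / (2 - \<alpha>) * ((step_ratio t 2)\<^sup>2 * step_ratio t 2 powr (- \<alpha>) /
        (1 + step_ratio t 2) / \<theta> 2) \<le> 2 - (1 - \<alpha>) * step_ratio t 2 powr (- \<alpha>)"
    and later: "\<And>k \<rho> \<rho>'. k \<ge> 2 \<Longrightarrow> \<rho> = step_ratio t k \<Longrightarrow> \<rho>' = step_ratio t (Suc k) \<Longrightarrow>
        \<alpha> / (2 - \<alpha>) * (\<rho>\<^sup>2 / (1 + \<rho>) * \<theta> k + \<rho>'\<^sup>2 * \<rho>' powr (- \<alpha>) / (1 + \<rho>') / \<theta> (Suc k))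
        \<le> 2 + 2 * (\<alpha> / (2 - \<alpha>)) * (\<rho> / (1 + \<rho>))
          - (1 - \<alpha>) * (\<rho>' powr (- \<alpha>) + 1 - (1 + \<rho>') powr (- \<alpha>))"
  shows "0 \<le> (\<Sum>k=1..n. incr y k * L2_operator \<alpha> t k y)"
proof -
  note mono = widening_mesh_strict_mono[OF t]
  have pos: "0 < step t j" if "j \<ge> 1" for j using step_pos[OF t that] .
  define d where "d = incr y"
  define V where "V k p = (if p = 0 then 0 else increment_weight t (kernel \<alpha> t k) p)" for k p
  define S where "S k p = (if p = 0 then 0 else if p < k then V k p
    else V k (k - 1) - V (Suc k) (k - 1) + V (Suc k) k)" for k p
  define diag where "diag k = step t k powr (- \<alpha>) / (1 - \<alpha>) + (if k = 1 then 0 else last_cell_tilt \<alpha> t k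
    + cell_moment t (kernel \<alpha> t k) (k - 1) * step t (k - 1) / step t k)" for k
  define e where "e k = (if k \<le> 1 then 0 else last_cell_tilt \<alpha> t k * step_ratio t k)" for k
  define x where "x k = 2 * diag k - S k k" for k
  \<comment> \<open>Kernels, and differences of consecutive kernels, are convex and increasing to the left of
    their singularity, which lies to the right of the cells involved.\<close>
  have V_bounds: "kernel \<alpha> t k (t (p - 1)) \<le> V k p \<and> V k p \<le> kernel \<alpha> t k (t p)"
    if "1 \<le> p" "p < k" for k p
    using increment_weight_bounds[OF t that(1) kernel_admissible[of \<alpha> "t p" t k, OF \<alpha>(1) strict_monoD[OF mono that(2)]]] that
    by (simp add: V_def)
  have dV_bounds:
    "kernel \<alpha> t k (t (p - 1)) - kernel \<alpha> t (Suc k) (t (p - 1)) \<le> V k p - V (Suc k) p \<and>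
     V k p - V (Suc k) p \<le> kernel \<alpha> t k (t p) - kernel \<alpha> t (Suc k) (t p)"
    if "1 \<le> p" "p < k" for k p
  proof -
    have lt: "t p < t k" "t k \<le> t (Suc k)" "t p < t (Suc k)"
      using that by (auto intro: strict_monoD[OF mono] strict_mono_leD[OF mono])
    have "V k p - V (Suc k) p = increment_weight t (\<lambda>s. kernel \<alpha> t k s - kernel \<alpha> t (Suc k) s) p"
      using that kernel_admissible(1)[of \<alpha> "t p" t k] kernel_admissible(1)[of \<alpha> "t p" t "Suc k"] \<alpha> lt
      by (subst increment_weight_diff[OF mono]) (auto simp: V_def)
    then show ?thesis
      using increment_weight_bounds[OF t that(1) kernel_diff_admissible[of \<alpha> "t p" t k, OF \<alpha>(1) lt(1,2)]] by simp
  qed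
  have kernel_dec: "0 \<le> kernel \<alpha> t (Suc k) s \<and> kernel \<alpha> t (Suc k) s \<le> kernel \<alpha> t k s"
    if "s < t k" for k s
    unfolding kernel_def using that \<alpha> strict_mono_leD[OF mono, of k "Suc k"]
    by (auto intro!: powr_mono2')
  have V_incr: "V k p \<le> V k (Suc p)" if "Suc p < k" for k p
  proof (cases "p = 0")
    case True
    then show ?thesis
      using V_bounds[of 1 k] that by (auto simp: V_def kernel_def intro: order_trans[OF powr_ge_zero])
  next
    case False
    then show ?thesis using V_bounds[of "Suc p" k] V_bounds[of p k] that by auto
  qed
  have dV_incr: "V k p - V (Suc k) p \<le> V k (Suc p) - V (Suc k) (Suc p)" if "Suc p < k" for k p
  proof (cases "p = 0")
    case True
    have "t 0 < t k" using that by (intro strict_monoD[OF mono]) auto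
    then show ?thesis
      using dV_bounds[of 1 k] kernel_dec[of "t 0" k] that True by (auto simp: V_def)
  next
    case False
    then show ?thesis using dV_bounds[of "Suc p" k] dV_bounds[of p k] that by auto
  qed
  have stair: "0 \<le> (\<Sum>k=1..n. d k * (S k k * d k + 2 * (\<Sum>j=1..<k. S k j * d j)))"
  proof (rule staircase_form_nonneg)
    show "S k 0 = 0" for k by (simp add: S_def)
    show "S k p \<le> S k (Suc p)" if "p < k" for k p
    proof (cases "Suc p = k")
      case True
      have "V (Suc k) p \<le> V (Suc k) (Suc p)" using V_incr[of p "Suc k"] True by simp
      then show ?thesis using True by (auto simp: S_def V_def)
    next
      case False
      then show ?thesis using V_incr[of p k] that by (auto simp: S_def V_def)
    qed
    show "S (Suc k) (Suc p) - S (Suc k) p \<le> S k (Suc p) - S k p" if "p < k" for k p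
    proof (cases "Suc p = k")
      case True
      then show ?thesis by (auto simp: S_def V_def)
    next
      case False
      then show ?thesis using dV_incr[of p k] that by (auto simp: S_def V_def)
    qed
  qed
  have tri: "0 \<le> (\<Sum>k=1..n. x k * (d k)\<^sup>2 - 2 * e k * d k * d (k - 1))"
  proof (rule tridiagonal_form_nonneg[where \<theta> = \<theta>])
    show "0 \<le> e k" for k
    proof (cases "k \<le> 1")
      case False
      then have "0 < step t k" "0 < step t (k - 1)" using pos by auto
      then show ?thesis using \<alpha> by (simp add: e_def last_cell_tilt_def step_ratio_def)
    qed (simp add: e_def)
    show "0 < \<theta> k" for k by fact
    show "e 1 = 0" by (simp add: e_def)
    show "e k * \<theta> k + e (Suc k) / \<theta> (Suc k) \<le> x k" if k: "1 \<le> k" for k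
    proof -
      define \<kappa> where "\<kappa> = \<alpha> / (2 - \<alpha>)"
      define P where "P = step t k powr (- \<alpha>) / (1 - \<alpha>)"
      define \<rho>' where "\<rho>' = step_ratio t (Suc k)"
      have steps: "0 < step t k" "0 < step t (Suc k)" using pos k by auto
      have \<rho>': "0 < \<rho>'" using steps by (simp add: \<rho>'_def step_ratio_def)
      have step_eq: "step t (Suc k) = \<rho>' * step t k" using steps by (simp add: \<rho>'_def step_ratio_def)
      have P: "0 \<le> P" "step t k powr (- \<alpha>) = (1 - \<alpha>) * P" using \<alpha> by (auto simp: P_def)
      have next_e: "e (Suc k) = P * (\<kappa> * (\<rho>'\<^sup>2 * \<rho>' powr (- \<alpha>) / (1 + \<rho>')))"
      proof -
        have "e (Suc k) = step t (Suc k) powr (- \<alpha>) / (1 - \<alpha>) * (\<kappa> * (\<rho>' / (1 + \<rho>'))) * \<rho>'"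
          using k steps by (simp add: e_def last_cell_tilt_eq \<rho>'_def \<kappa>_def)
        also have "step t (Suc k) powr (- \<alpha>) = \<rho>' powr (- \<alpha>) * step t k powr (- \<alpha>)"
          unfolding step_eq using \<rho>' steps by (simp add: powr_mult)
        finally show ?thesis by (simp add: P_def power2_eq_square)
      qed
      have "V (Suc k) k \<le> kernel \<alpha> t (Suc k) (t k)" using V_bounds[of k "Suc k"] k by simp
      also have "\<dots> = step t (Suc k) powr (- \<alpha>)" by (simp add: kernel_def step_def)
      also have "\<dots> = (1 - \<alpha>) * P * \<rho>' powr (- \<alpha>)"
        unfolding step_eq P(2)[symmetric] using \<rho>' steps by (simp add: powr_mult)
      finally have V1: "V (Suc k) k \<le> (1 - \<alpha>) * P * \<rho>' powr (- \<alpha>)" .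
      show ?thesis
      proof (cases "k = 1")
        case True
        have "e (Suc k) / \<theta> (Suc k) =
            P * (\<kappa> * (\<rho>'\<^sup>2 * \<rho>' powr (- \<alpha>) / (1 + \<rho>') / \<theta> (Suc k)))"
          unfolding next_e by simp
        also have "\<dots> \<le> P * (2 - (1 - \<alpha>) * \<rho>' powr (- \<alpha>))"
          using first True P(1)
          by (intro mult_left_mono) (auto simp: \<rho>'_def \<kappa>_def numeral_2_eq_2)
        also have "\<dots> = 2 * P - (1 - \<alpha>) * P * \<rho>' powr (- \<alpha>)"
          by (simp add: algebra_simps)
        finally have "e (Suc k) / \<theta> (Suc k) \<le> 2 * P - (1 - \<alpha>) * P * \<rho>' powr (- \<alpha>)" .
        moreover have "x k = 2 * P - V (Suc k) k"
          using True by (simp add: x_def diag_def S_def V_def P_def)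
        moreover have "e k = 0" using True by (simp add: e_def)
        ultimately show ?thesis using V1 by simp
      next
        case False
        then have k2: "k \<ge> 2" using k by simp
        define \<rho> where "\<rho> = step_ratio t k"
        have p: "0 < step t (k - 1)" using pos k2 by auto
        have \<rho>: "0 < \<rho>" using steps p by (simp add: \<rho>_def step_ratio_def)
        have ck: "last_cell_tilt \<alpha> t k = P * (\<kappa> * (\<rho> / (1 + \<rho>)))"
          using last_cell_tilt_eq[OF steps(1) p] by (simp add: P_def \<kappa>_def \<rho>_def)
        then have ek: "e k = P * (\<kappa> * (\<rho>\<^sup>2 / (1 + \<rho>)))"
          using k2 by (simp add: e_def \<rho>_def power2_eq_square)
        have "t (k - 1) < t k" using k by (intro strict_monoD[OF mono]) auto
        then have "V k (k - 1) - V (Suc k) (k - 1) \<le>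
            kernel \<alpha> t k (t (k - 1)) - kernel \<alpha> t (Suc k) (t (k - 1))"
          using dV_bounds[of "k - 1" k] k2 by simp
        also have "\<dots> = step t k powr (- \<alpha>) - (step t k + step t (Suc k)) powr (- \<alpha>)"
          by (simp add: kernel_def step_def)
        also have "(step t k + step t (Suc k)) = (1 + \<rho>') * step t k"
          unfolding step_eq by (simp add: distrib_right)
        also have "step t k powr (- \<alpha>) - ((1 + \<rho>') * step t k) powr (- \<alpha>) =
            (1 - \<alpha>) * P * (1 - (1 + \<rho>') powr (- \<alpha>))"
          unfolding P(2)[symmetric] using \<rho>' steps by (simp add: powr_mult right_diff_distrib)
        finally have V2: "V k (k - 1) - V (Suc k) (k - 1) \<le>
          (1 - \<alpha>) * P * (1 - (1 + \<rho>') powr (- \<alpha>))" .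
        have "continuous_on {t (k - 1 - 1)..t (k - 1)} (kernel \<alpha> t k)"
            "mono_on {t (k - 1 - 1)..t (k - 1)} (kernel \<alpha> t k)"
          using kernel_admissible[of \<alpha> "t (k - 1)" t k, OF \<alpha>(1) \<open>t (k - 1) < t k\<close>] by blast+
        then have "0 \<le> cell_moment t (kernel \<alpha> t k) (k - 1)"
          using k2 by (intro cell_moment_nonneg[OF t]) auto
        then have "0 \<le> cell_moment t (kernel \<alpha> t k) (k - 1) * step t (k - 1) / step t k"
          using p steps by simp
        then have dk: "P + P * (\<kappa> * (\<rho> / (1 + \<rho>))) \<le> diag k"
          using k2 ck by (simp add: diag_def P_def)
        have "P * (\<kappa> * (\<rho>\<^sup>2 / (1 + \<rho>) * \<theta> k + \<rho>'\<^sup>2 * \<rho>' powr (- \<alpha>) / (1 + \<rho>') / \<theta> (Suc k)))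
          \<le> P * (2 + 2 * \<kappa> * (\<rho> / (1 + \<rho>))
            - (1 - \<alpha>) * (\<rho>' powr (- \<alpha>) + 1 - (1 + \<rho>') powr (- \<alpha>)))"
          unfolding \<kappa>_def using P(1) later[OF k2 \<rho>_def \<rho>'_def] by (rule mult_left_mono[rotated])
        also have "\<dots> = 2 * (P + P * (\<kappa> * (\<rho> / (1 + \<rho>)))) - (1 - \<alpha>) * P * \<rho>' powr (- \<alpha>)
            - (1 - \<alpha>) * P * (1 - (1 + \<rho>') powr (- \<alpha>))"
          by (simp add: algebra_simps)
        also have "P * (\<kappa> * (\<rho>\<^sup>2 / (1 + \<rho>) * \<theta> k + \<rho>'\<^sup>2 * \<rho>' powr (- \<alpha>) / (1 + \<rho>') / \<theta> (Suc k))) =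
            e k * \<theta> k + e (Suc k) / \<theta> (Suc k)"
          unfolding ek next_e by (simp add: distrib_left)
        finally show ?thesis
          using dk V1 V2 k2 by (simp add: x_def S_def)
      qed
    qed
  qed
  have G: "0 < Gamma (1 - \<alpha>)" using \<alpha> by (intro Gamma_real_pos) auto
  have summand: "2 * Gamma (1 - \<alpha>) * (d k * L2_operator \<alpha> t k y) =
      d k * (S k k * d k + 2 * (\<Sum>j=1..<k. S k j * d j)) + (x k * (d k)\<^sup>2 - 2 * e k * d k * d (k - 1))"
    if k: "k \<in> {1..n}" for k
  proof -
    have sums: "(\<Sum>j=1..<k. S k j * d j) = (\<Sum>j=1..<k. increment_weight t (kernel \<alpha> t k) j * d j)"
      by (intro sum.cong) (auto simp: S_def V_def)
    have op: "Gamma (1 - \<alpha>) * L2_operator \<alpha> t k y = diag k * d k - e k * d (k - 1)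
        + (\<Sum>j=1..<k. increment_weight t (kernel \<alpha> t k) j * d j)"
    proof (cases "k = 1")
      case True
      then show ?thesis
        using L2_operator_Suc0[OF \<alpha> pos[of 1], of y] G by (simp add: diag_def e_def d_def)
    next
      case False
      then have "k \<ge> 2" using k by simp
      then show ?thesis
        using L2_operator_eq[OF t \<alpha>, of k y] G by (simp add: diag_def e_def d_def step_ratio_def)
    qed
    have "2 * Gamma (1 - \<alpha>) * (d k * L2_operator \<alpha> t k y) =
        2 * d k * (Gamma (1 - \<alpha>) * L2_operator \<alpha> t k y)" by simp
    also have "\<dots> = 2 * d k * (diag k * d k - e k * d (k - 1) + (\<Sum>j=1..<k. S k j * d j))"
      by (simp only: op sums)
    finally show ?thesis
      by (simp add: x_def algebra_simps power2_eq_square)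
  qed
  have "2 * Gamma (1 - \<alpha>) * (\<Sum>k=1..n. d k * L2_operator \<alpha> t k y) =
      (\<Sum>k=1..n. d k * (S k k * d k + 2 * (\<Sum>j=1..<k. S k j * d j)))
      + (\<Sum>k=1..n. x k * (d k)\<^sup>2 - 2 * e k * d k * d (k - 1))"
    unfolding sum.distrib[symmetric] sum_distrib_left[of "2 * Gamma (1 - \<alpha>)"]
    by (intro sum.cong refl summand)
  then have "0 \<le> 2 * Gamma (1 - \<alpha>) * (\<Sum>k=1..n. d k * L2_operator \<alpha> t k y)"
    using stair tri by simp
  then show ?thesis using G by (simp add: d_def zero_le_mult_iff)
qed

section \<open>Dominance conditions for one step\<close>

text \<open>The diagonal Pade approximant bounds the exponential from above because the logarithm of the right
side is an odd series with nonnegative coefficients and leading term \<open>2 x\<close>.\<close>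

lemma exp_le_pade:
  fixes x :: real
  assumes "0 \<le> x" "x < 1"
  shows "exp (2 * x) \<le> (1 + x) / (1 - x)"
proof -
  let ?f = "\<lambda>u. ln (1 + u) - ln (1 - u) - 2 * u"
  have "?f 0 \<le> ?f x"
  proof (rule DERIV_nonneg_imp_nondecreasing[OF assms(1)])
    fix u :: real assume u: "0 \<le> u" "u \<le> x"
    then have u1: "u < 1" using assms by simp
    have "(?f has_real_derivative 1 / (1 + u) + 1 / (1 - u) - 2) (at u)"
      using u u1 by (auto intro!: derivative_eq_intros)
    moreover have "1 / (1 + u) + 1 / (1 - u) - 2 = 2 * u\<^sup>2 / ((1 + u) * (1 - u))"
      using u u1 by (simp add: divide_simps) (simp add: algebra_simps power2_eq_square)
    moreover have "0 \<le> 2 * u\<^sup>2 / ((1 + u) * (1 - u))" using u u1 by simp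
    ultimately show "\<exists>y. (?f has_real_derivative y) (at u) \<and> 0 \<le> y" by metis
  qed
  then have "2 * x \<le> ln ((1 + x) / (1 - x))" using assms by (simp add: ln_div)
  then have "exp (2 * x) \<le> exp (ln ((1 + x) / (1 - x)))" by simp
  then show ?thesis using assms by simp
qed

lemma powr_le_pade:
  fixes \<rho> \<beta> k :: real
  assumes "0 < \<rho>" "\<rho> \<le> exp (4 * k)" "0 \<le> \<beta>" "\<beta> \<le> 1" "0 \<le> k" "k < 1"
  shows "\<rho> powr \<beta> \<le> ((1 + k * \<beta>) / (1 - k * \<beta>))\<^sup>2"
proof -
  have kb: "0 \<le> k * \<beta>" "k * \<beta> < 1"
    using assms mult_left_le[of \<beta> k] by auto
  have "\<rho> powr \<beta> \<le> exp (4 * k) powr \<beta>" using assms by (intro powr_mono2) auto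
  also have "\<dots> = (exp (2 * (k * \<beta>)))\<^sup>2" by (simp add: powr_def flip: exp_double)
  also have "\<dots> \<le> ((1 + k * \<beta>) / (1 - k * \<beta>))\<^sup>2"
    using exp_le_pade[OF kb] by (intro power_mono) auto
  finally show ?thesis .
qed

text \<open>The condition on the first two steps. The multiplier is chosen so that equality holds at \<open>\<alpha> = 1\<close>,
where the first diagonal entry is used up completely; the factor \<open>1 + (1 - \<alpha>) / 2\<close> leaves room for the
growth of \<open>\<rho> powr (1 - \<alpha>)\<close>. That power is bounded by a rational function of \<open>\<beta> = 1 - \<alpha>\<close>, and what
remains is the positivity of a polynomial on \<open>{0..1}\<close>. The term \<open>\<rho> powr (- \<alpha>)\<close> on the right
decreases in \<open>\<rho>\<close> while the one on the left increases, so small and large \<open>\<rho>\<close> are treated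
separately.\<close>

lemma first_step_dominance:
  fixes \<alpha> \<rho> :: real
  assumes \<alpha>: "0 < \<alpha>" "\<alpha> < 1" and \<rho>: "1 \<le> \<rho>" "\<rho> \<le> 8.2003"
  shows "\<alpha> / (2 - \<alpha>) * (\<rho>\<^sup>2 * \<rho> powr (- \<alpha>) / (1 + \<rho>) /
      (\<rho> / (2 * (1 + \<rho>)) * (1 + 1 / 2 * (1 - \<alpha>)))) \<le> 2 - (1 - \<alpha>) * \<rho> powr (- \<alpha>)"
proof -
  define \<beta> where "\<beta> = 1 - \<alpha>"
  have \<beta>: "0 < \<beta>" "\<beta> < 1" using \<alpha> by (auto simp: \<beta>_def)
  have \<beta>_pow: "\<beta> ^ 2 \<le> 1" "\<beta> ^ 4 \<le> \<beta> ^ 3" "0 \<le> \<beta> ^ 3" "0 \<le> \<beta>\<^sup>2"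
    using \<beta> power_decreasing[of 3 4 \<beta>] power_le_one[of \<beta> 2] by auto
  define Y where "Y = \<rho> powr \<beta>"
  have Y: "0 < Y" using \<rho> by (simp add: Y_def)
  have neg: "\<rho> powr (- \<alpha>) = Y / \<rho>"
    using \<rho> powr_diff[of \<rho> \<beta> 1] by (simp add: Y_def \<beta>_def)
  define m where "m = (1 + \<beta>) * (1 + \<beta> / 2)"
  have m: "0 < m" using \<beta> by (simp add: m_def)
  have key: "Y * (2 * (1 - \<beta>)) + m * \<beta> * (Y / \<rho>) \<le> 2 * m"
  proof (cases "\<rho> \<le> 6")
    case True
    define z where "z = 1 - 0.45 * \<beta>"
    have z: "0 < z" using \<beta> by (simp add: z_def)
    \<comment> \<open>\<open>1.105\<close> is the quadratic Taylor polynomial of the exponential at \<open>0.1\<close>.\<close>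
    have "(6::real) \<le> 1.105 ^ 18" by (simp add: power_divide)
    also have "\<dots> \<le> exp 0.1 ^ 18"
      using exp_lower_Taylor_quadratic[of "0.1"] by (intro power_mono) (auto simp: power2_eq_square)
    also have "\<dots> = exp (4 * 0.45)" by (simp flip: exp_of_nat_mult)
    finally have "Y \<le> ((1 + 0.45 * \<beta>) / z)\<^sup>2"
      using True \<rho> \<beta> unfolding Y_def z_def by (intro powr_le_pade) auto
    then have Yz: "Y * z\<^sup>2 \<le> (1 + 0.45 * \<beta>)\<^sup>2"
      using z by (simp add: power_divide pos_le_divide_eq)
    have "\<rho> powr (- \<alpha>) \<le> 1" using powr_mono[of "- \<alpha>" 0 \<rho>] \<rho> \<alpha> by simp
    then have "m * \<beta> * (Y / \<rho>) \<le> m * \<beta>"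
      using m \<beta> neg by (intro mult_left_le) auto
    moreover have "Y * (2 * (1 - \<beta>)) \<le> m * (2 - \<beta>)"
    proof -
      have "m * (2 - \<beta>) * z\<^sup>2 - (1 + 0.45 * \<beta>)\<^sup>2 * (2 * (1 - \<beta>)) =
        \<beta> * (2/5 - 1/2 * \<beta> + 19/25 * \<beta>\<^sup>2 + 279/800 * \<beta> ^ 3 - 81/800 * \<beta> ^ 4)"
        unfolding m_def z_def by (simp add: field_simps power2_eq_square power3_eq_cube power4_eq_xxxx)
      moreover have "0 \<le> 2/5 - 1/2 * \<beta> + 19/25 * \<beta>\<^sup>2"
      proof -
        have "2/5 - 1/2 * \<beta> + 19/25 * \<beta>\<^sup>2 = 19/25 * (\<beta> - 25/76)\<^sup>2 + (2/5 - 19/25 * (25/76)\<^sup>2)"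
          by (simp add: power2_eq_square field_simps)
        moreover have "0 \<le> 19/25 * (\<beta> - 25/76)\<^sup>2 + (2/5 - 19/25 * (25/76 :: real)\<^sup>2)"
          by (intro add_nonneg_nonneg) (simp_all add: power2_eq_square)
        ultimately show ?thesis by (simp only:)
      qed
      then have "0 \<le> 2/5 - 1/2 * \<beta> + 19/25 * \<beta>\<^sup>2 + 279/800 * \<beta> ^ 3 - 81/800 * \<beta> ^ 4"
        using \<beta>_pow by linarith
      then have "0 \<le> \<beta> * (2/5 - 1/2 * \<beta> + 19/25 * \<beta>\<^sup>2 + 279/800 * \<beta> ^ 3 - 81/800 * \<beta> ^ 4)"
        using \<beta> by (intro mult_nonneg_nonneg) auto
      ultimately have "(1 + 0.45 * \<beta>)\<^sup>2 * (2 * (1 - \<beta>)) \<le> m * (2 - \<beta>) * z\<^sup>2" by simp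
      moreover have "Y * z\<^sup>2 * (2 * (1 - \<beta>)) \<le> (1 + 0.45 * \<beta>)\<^sup>2 * (2 * (1 - \<beta>))"
        using Yz \<beta> by (intro mult_right_mono) auto
      ultimately have "(Y * (2 * (1 - \<beta>))) * z\<^sup>2 \<le> (m * (2 - \<beta>)) * z\<^sup>2" by (simp add: mult_ac)
      then show ?thesis using z by (simp add: mult_le_cancel_right)
    qed
    ultimately show ?thesis by (simp add: algebra_simps)
  next
    case False
    define z where "z = 1 - 0.53 * \<beta>"
    have z: "0 < z" using \<beta> by (simp add: z_def)
    have "(8.2003::real) \<le> 1.111618 ^ 20" by (simp add: power_divide)
    also have "\<dots> \<le> exp 0.106 ^ 20"
      using exp_lower_Taylor_quadratic[of "0.106"] by (intro power_mono) (auto simp: power2_eq_square)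
    also have "\<dots> = exp (4 * 0.53)" by (simp flip: exp_of_nat_mult)
    finally have "Y \<le> ((1 + 0.53 * \<beta>) / z)\<^sup>2"
      using \<rho> \<beta> unfolding Y_def z_def by (intro powr_le_pade) auto
    then have Yz: "Y * z\<^sup>2 \<le> (1 + 0.53 * \<beta>)\<^sup>2"
      using z by (simp add: power_divide pos_le_divide_eq)
    have "Y * (2 * (1 - \<beta>)) + m * \<beta> * (Y / \<rho>) \<le> Y * (2 * (1 - \<beta>)) + m * \<beta> * (Y / 6)"
      using False Y m \<beta> by (intro add_left_mono mult_left_mono divide_left_mono) auto
    also have "\<dots> = Y * (2 * (1 - \<beta>) + m * \<beta> / 6)" by (simp add: algebra_simps)
    also have "\<dots> \<le> 2 * m"
    proof -
      let ?c = "2 * (1 - \<beta>) + m * \<beta> / 6"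
      have "2 * m * z\<^sup>2 - (1 + 0.53 * \<beta>)\<^sup>2 * ?c =
        \<beta> * (89/150 - 73/150 * \<beta> - 1013/20000 * \<beta>\<^sup>2 + 73405/600000 * \<beta> ^ 3 - 2809/120000 * \<beta> ^ 4)"
        unfolding m_def z_def by (simp add: field_simps power2_eq_square power3_eq_cube power4_eq_xxxx)
      moreover have "0 \<le> 89/150 - 73/150 * \<beta> - 1013/20000 * \<beta>\<^sup>2 + 73405/600000 * \<beta> ^ 3 - 2809/120000 * \<beta> ^ 4"
        using \<beta> \<beta>_pow by linarith
      then have "0 \<le> \<beta> * (89/150 - 73/150 * \<beta> - 1013/20000 * \<beta>\<^sup>2 + 73405/600000 * \<beta> ^ 3 - 2809/120000 * \<beta> ^ 4)"
        using \<beta> by (intro mult_nonneg_nonneg) auto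
      ultimately have "(1 + 0.53 * \<beta>)\<^sup>2 * ?c \<le> 2 * m * z\<^sup>2" by simp
      moreover have "Y * z\<^sup>2 * ?c \<le> (1 + 0.53 * \<beta>)\<^sup>2 * ?c"
        using Yz \<beta> m by (intro mult_right_mono) auto
      ultimately have "(Y * ?c) * z\<^sup>2 \<le> (2 * m) * z\<^sup>2" by (simp add: mult_ac)
      then show ?thesis using z by (simp add: mult_le_cancel_right)
    qed
    finally show ?thesis .
  qed
  have "\<rho>\<^sup>2 * \<rho> powr (- \<alpha>) / (1 + \<rho>) / (\<rho> / (2 * (1 + \<rho>)) * (1 + 1 / 2 * (1 - \<alpha>)))
      = 2 * Y / (1 + \<beta> / 2)"
  proof -
    have cancel: "\<rho>\<^sup>2 * (Y / \<rho>) / P / (\<rho> / (2 * P) * Q) = 2 * Y / Q" if "P \<noteq> 0" for P Q :: real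
      using that \<rho> by (simp add: power2_eq_square)
    have "1 + \<beta> / 2 = 1 + 1 / 2 * (1 - \<alpha>)" by (simp add: \<beta>_def)
    then show ?thesis unfolding neg using \<rho> by (simp only:) (rule cancel, simp)
  qed
  moreover have "\<alpha> / (2 - \<alpha>) = (1 - \<beta>) / (1 + \<beta>)" by (simp add: \<beta>_def)
  moreover have "(1 - \<beta>) / (1 + \<beta>) * (2 * Y / (1 + \<beta> / 2)) = Y * (2 * (1 - \<beta>)) / m"
    by (simp add: m_def)
  moreover have "Y * (2 * (1 - \<beta>)) / m \<le> 2 - \<beta> * (Y / \<rho>)"
  proof -
    have "(2 - b * z) * m = 2 * m - m * b * z" for b z :: real
      by (simp add: algebra_simps)
    then have "Y * (2 * (1 - \<beta>)) \<le> (2 - \<beta> * (Y / \<rho>)) * m"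
      using key by (simp only: le_diff_eq)
    then show ?thesis by (simp only: pos_divide_le_eq[OF m])
  qed
  ultimately show ?thesis by (simp only: neg \<beta>_def[symmetric])
qed

text \<open>The dominance condition for all \<open>\<alpha>\<close> follows from the one for BDF2, which is the limit \<open>\<alpha> \<rightarrow> 1\<close>
(hypothesis \<open>bdf\<close>, with multipliers \<open>A\<close> and \<open>A'\<close>). With \<open>\<beta> = 1 - \<alpha>\<close>, the right side, divided by
\<open>\<alpha> / (2 - \<alpha>) = (1 - \<beta>) / (1 + \<beta>)\<close>, grows at least by \<open>5 / 2 * \<beta>\<close>. The multipliers are allowed to
grow linearly in \<open>\<beta>\<close>, which compensates the growth of \<open>\<rho>' powr \<beta>\<close> up to \<open>m\<close>, and \<open>slope\<close>
says that all growth on the left is covered.\<close>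

lemma later_step_dominance:
  fixes \<alpha> \<rho> \<rho>' A A' c c' F m :: real
  assumes \<alpha>: "0 < \<alpha>" "\<alpha> < 1" and \<rho>: "1 \<le> \<rho>" "1 \<le> \<rho>'"
    and pos: "0 < A'" "0 \<le> c" "0 \<le> c'" "0 \<le> F" "0 \<le> m"
    and bdf: "\<rho>\<^sup>2 / (1 + \<rho>) * A + F \<le> 2 + 2 * (\<rho> / (1 + \<rho>))"
    and next_ratio: "\<rho>' / (1 + \<rho>') \<le> F * A'"
    and m: "\<rho>' - 1 - c' \<le> m"
    and slope: "c * (\<rho>\<^sup>2 / (1 + \<rho>) * A) + F * m \<le> 5 / 2"
  shows "\<alpha> / (2 - \<alpha>) * (\<rho>\<^sup>2 / (1 + \<rho>) * (A * (1 + c * (1 - \<alpha>))) +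
        \<rho>'\<^sup>2 * \<rho>' powr (- \<alpha>) / (1 + \<rho>') / (A' * (1 + c' * (1 - \<alpha>))))
      \<le> 2 + 2 * (\<alpha> / (2 - \<alpha>)) * (\<rho> / (1 + \<rho>))
        - (1 - \<alpha>) * (\<rho>' powr (- \<alpha>) + 1 - (1 + \<rho>') powr (- \<alpha>))"
proof -
  define \<beta> where "\<beta> = 1 - \<alpha>"
  have \<beta>: "0 < \<beta>" "\<beta> < 1" using \<alpha> by (auto simp: \<beta>_def)
  define E where "E = \<rho>\<^sup>2 / (1 + \<rho>) * A"
  define f where "f = \<rho> / (1 + \<rho>)"
  define \<kappa> where "\<kappa> = \<alpha> / (2 - \<alpha>)"
  have \<kappa>: "0 < \<kappa>" "\<kappa> = (1 - \<beta>) / (1 + \<beta>)" using \<alpha> by (auto simp: \<kappa>_def \<beta>_def)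
  have decay: "\<rho>' powr (- \<alpha>) - (1 + \<rho>') powr (- \<alpha>) \<le> 1 / 2"
  proof -
    have "(2 * \<rho>') powr (- \<alpha>) \<le> (1 + \<rho>') powr (- \<alpha>)"
      using \<rho> \<alpha> by (intro powr_mono2') auto
    moreover have "(2 * \<rho>') powr (- \<alpha>) = 2 powr (- \<alpha>) * \<rho>' powr (- \<alpha>)"
      using \<rho> by (simp add: powr_mult)
    moreover have "1 / 2 \<le> 2 powr (- \<alpha>)"
      using powr_mono[of "- 1" "- \<alpha>" "2::real"] \<alpha> by (simp add: powr_minus_divide)
    moreover have p: "\<rho>' powr (- \<alpha>) \<le> 1" "0 \<le> \<rho>' powr (- \<alpha>)"
      using powr_mono[of "- \<alpha>" 0 \<rho>'] \<rho> \<alpha> by auto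
    moreover have "1 / 2 * \<rho>' powr (- \<alpha>) \<le> 2 powr (- \<alpha>) * \<rho>' powr (- \<alpha>)"
      using calculation by (intro mult_right_mono) auto
    ultimately show ?thesis by linarith
  qed
  have bern: "\<rho>' * \<rho>' powr (- \<alpha>) \<le> 1 + \<beta> * (\<rho>' - 1)"
  proof -
    have "\<rho>' * \<rho>' powr (- \<alpha>) = \<rho>' powr \<beta> * 1 powr \<alpha>"
      using \<rho> by (subst powr_mult_base) (auto simp: \<beta>_def)
    also have "\<dots> \<le> \<beta> * \<rho>' + \<alpha> * 1"
      using \<rho> \<alpha> by (intro Youngs_inequality_0) (auto simp: \<beta>_def)
    finally show ?thesis by (simp add: \<beta>_def algebra_simps)
  qed
  have "\<rho>'\<^sup>2 * \<rho>' powr (- \<alpha>) / (1 + \<rho>') = \<rho>' / (1 + \<rho>') * (\<rho>' * \<rho>' powr (- \<alpha>))"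
    by (simp add: power2_eq_square)
  also have "\<dots> \<le> (F * A') * (1 + \<beta> * (\<rho>' - 1))"
    using next_ratio bern \<rho> pos by (intro mult_mono) auto
  also have "\<dots> \<le> (F * A') * ((1 + c' * \<beta>) * (1 + \<beta> * m))"
  proof (rule mult_left_mono)
    have "\<beta> * (\<rho>' - 1) \<le> \<beta> * (c' + m)" using m \<beta> by (intro mult_left_mono) auto
    also have "\<dots> \<le> \<beta> * (c' + m) + c' * \<beta> * (\<beta> * m)" using pos \<beta> by simp
    finally show "1 + \<beta> * (\<rho>' - 1) \<le> (1 + c' * \<beta>) * (1 + \<beta> * m)" by (simp add: algebra_simps)
  qed (use pos in simp)
  finally have next_term: "\<rho>'\<^sup>2 * \<rho>' powr (- \<alpha>) / (1 + \<rho>') / (A' * (1 + c' * \<beta>)) \<le> F * (1 + \<beta> * m)"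
    using pos \<beta> by (subst pos_divide_le_eq) (auto simp: mult_ac add_pos_nonneg)
  have "\<kappa> * (E * (1 + c * \<beta>) + \<rho>'\<^sup>2 * \<rho>' powr (- \<alpha>) / (1 + \<rho>') / (A' * (1 + c' * \<beta>)))
      \<le> \<kappa> * (E * (1 + c * \<beta>) + F * (1 + \<beta> * m))"
    using \<kappa>(1) next_term by (intro mult_left_mono) auto
  also have "E * (1 + c * \<beta>) + F * (1 + \<beta> * m) = (E + F) + (c * E + F * m) * \<beta>"
    by (simp add: algebra_simps)
  also have "\<kappa> * \<dots> \<le> \<kappa> * ((2 + 2 * f) + 5 / 2 * \<beta>)"
  proof (rule mult_left_mono)
    have "E + F \<le> 2 + 2 * f" "c * E + F * m \<le> 5 / 2"
      using bdf slope by (simp_all only: E_def f_def)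
    then show "E + F + (c * E + F * m) * \<beta> \<le> 2 + 2 * f + 5 / 2 * \<beta>"
      using \<beta> by (intro add_mono[of "E + F"] mult_right_mono) auto
  qed (use \<kappa>(1) in simp)
  also have "\<dots> = \<kappa> * (2 + 5 / 2 * \<beta>) + 2 * \<kappa> * f" by (simp add: algebra_simps)
  also have "\<kappa> * (2 + 5 / 2 * \<beta>) \<le> 2 - 3 / 2 * \<beta>"
  proof -
    have "0 \<le> \<beta>\<^sup>2" by simp
    then have "(1 - \<beta>) * (2 + 5 / 2 * \<beta>) \<le> (2 - 3 / 2 * \<beta>) * (1 + \<beta>)"
      by (simp add: field_simps power2_eq_square)
    then show ?thesis using \<beta> unfolding \<kappa>(2) by (simp add: pos_divide_le_eq)
  qed
  also have "2 - 3 / 2 * \<beta> \<le> 2 - \<beta> * (\<rho>' powr (- \<alpha>) + 1 - (1 + \<rho>') powr (- \<alpha>))"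
    using mult_left_mono[OF decay, of \<beta>] \<beta> by (simp add: algebra_simps)
  finally show ?thesis
    by (simp add: E_def f_def \<kappa>_def \<beta>_def mult.assoc)
qed

section \<open>Graded meshes\<close>

lemma power_le_imp_powr_divide:
  fixes x c :: real
  assumes "0 < x" "0 < c" "0 < b"
  shows "c ^ b \<le> x ^ a \<Longrightarrow> c \<le> x powr (real a / real b)"
    and "x ^ a \<le> c ^ b \<Longrightarrow> x powr (real a / real b) \<le> c"
proof -
  have c: "(c ^ b) powr (1 / real b) = c"
    using assms by (simp add: powr_powr flip: powr_realpow)
  have x: "(x ^ a) powr (1 / real b) = x powr (real a / real b)"
    using assms by (simp add: powr_powr flip: powr_realpow)
  show "c \<le> x powr (real a / real b)" if "c ^ b \<le> x ^ a"
    using powr_mono2[of "1 / real b" "c ^ b" "x ^ a"] that assms c x by simp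
  show "x powr (real a / real b) \<le> c" if "x ^ a \<le> c ^ b"
    using powr_mono2[of "1 / real b" "x ^ a" "c ^ b"] that assms c x by simp
qed

text \<open>Since \<open>119 = 7 * 17\<close>, rounding after the seventh power keeps the numerals short.\<close>

lemma powr_381_119_bounds:
  fixes x c d :: real
  assumes "0 < x" "0 < c" "0 < d"
  shows "c ^ 7 \<le> d \<Longrightarrow> d ^ 17 \<le> x ^ 381 \<Longrightarrow> c \<le> x powr (real 381 / real 119)"
    and "d \<le> c ^ 7 \<Longrightarrow> x ^ 381 \<le> d ^ 17 \<Longrightarrow> x powr (real 381 / real 119) \<le> c"
proof -
  have c: "c ^ 119 = (c ^ 7) ^ 17" by (simp flip: power_mult)
  show "c \<le> x powr (real 381 / real 119)" if "c ^ 7 \<le> d" "d ^ 17 \<le> x ^ 381"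
  proof (rule power_le_imp_powr_divide(1))
    have "(c ^ 7) ^ 17 \<le> d ^ 17" using that assms by (intro power_mono) auto
    then show "c ^ 119 \<le> x ^ 381" unfolding c using that(2) by (rule order_trans)
  qed (use assms in auto)
  show "x powr (real 381 / real 119) \<le> c" if "d \<le> c ^ 7" "x ^ 381 \<le> d ^ 17"
  proof (rule power_le_imp_powr_divide(2))
    have "d ^ 17 \<le> (c ^ 7) ^ 17" using that assms by (intro power_mono) auto
    then show "x ^ 381 \<le> c ^ 119" unfolding c using that(2) by (rule order_trans[rotated])
  qed (use assms in auto)
qed

text \<open>In the variable \<open>y = x powr r\<close>, the function \<open>x powr s\<close> is the convex function \<open>y powr (s / r)\<close>,
whose secant slopes increase.\<close>

lemma powr_increment_ratio_mono:
  fixes a b c r s :: real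
  assumes "0 \<le> a" "a < b" "b < c" "0 < r" "r \<le> s"
  shows "(c powr r - b powr r) / (b powr r - a powr r) \<le> (c powr s - b powr s) / (b powr s - a powr s)"
proof -
  define p where "p = s / r"
  have p: "1 \<le> p" using assms by (simp add: p_def)
  have pw: "x powr s = (x powr r) powr p" if "0 \<le> x" for x
    using assms by (simp add: p_def powr_powr)
  define A B C where "A = a powr r" and "B = b powr r" and "C = c powr r"
  have ABC: "0 \<le> A" "A < B" "B < C"
    using assms by (auto simp: A_def B_def C_def intro: powr_less_mono2)
  have BCp: "A powr p < B powr p" "B powr p < C powr p"
    using ABC p by (auto intro: powr_less_mono2)
  have slope: "(B powr p - A powr p) / (B - A) \<le> (C powr p - B powr p) / (C - B)"
  proof (cases "A = 0")
    case True
    have "C * B powr p \<le> B * C powr p"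
    proof -
      have "B powr p = B * B powr (p - 1)" "C powr p = C * C powr (p - 1)"
        using ABC by (simp_all add: powr_mult_base)
      moreover have "B powr (p - 1) \<le> C powr (p - 1)" using ABC p by (intro powr_mono2) auto
      ultimately show ?thesis using ABC by (simp add: mult_left_mono)
    qed
    then show ?thesis using True ABC p by (simp add: divide_simps) (simp add: algebra_simps)
  next
    case False
    then have conv: "convex_on {A..C} (\<lambda>x. x powr p)"
      using ABC by (intro convex_on_subset[OF powr_convex[OF p]]) auto
    have "(A powr p - B powr p) / (A - B) \<le> (C powr p - B powr p) / (C - B)"
      using convex_on_slope_le[OF conv, of A C B] ABC by (auto simp: field_simps)
    then show ?thesis using ABC by (simp add: divide_simps) (simp add: algebra_simps)
  qed
  have "(C - B) / (B - A) = (C - B) / (B - A) * ((B powr p - A powr p) / (B - A)) /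
      ((B powr p - A powr p) / (B - A))"
    using ABC BCp by simp
  also have "\<dots> \<le> (C - B) / (B - A) * ((C powr p - B powr p) / (C - B)) /
      ((B powr p - A powr p) / (B - A))"
    using ABC BCp slope by (intro divide_right_mono mult_left_mono) auto
  also have "\<dots> = (C powr p - B powr p) / (B powr p - A powr p)"
    using ABC BCp by simp
  finally show ?thesis
    using assms by (simp add: pw A_def B_def C_def)
qed

lemma powr_increment_bounds:
  fixes a b r :: real
  assumes "0 < a" "a < b" "1 \<le> r"
  shows "(b - a) * (r * a powr (r - 1)) \<le> b powr r - a powr r"
    and "b powr r - a powr r \<le> (b - a) * (r * b powr (r - 1))"
proof -
  have "((\<lambda>x. x powr r) has_real_derivative r * x powr (r - 1)) (at x)" if "a \<le> x" for x
    using that assms by (auto intro!: derivative_eq_intros)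
  then obtain z where z: "a < z" "z < b" "b powr r - a powr r = (b - a) * (r * z powr (r - 1))"
    using MVT2[of a b "\<lambda>x. x powr r" "\<lambda>x. r * x powr (r - 1)"] assms
    by blast
  have "a powr (r - 1) \<le> z powr (r - 1)" "z powr (r - 1) \<le> b powr (r - 1)"
    using z assms by (auto intro: powr_mono2)
  then show "(b - a) * (r * a powr (r - 1)) \<le> b powr r - a powr r"
    "b powr r - a powr r \<le> (b - a) * (r * b powr (r - 1))"
    unfolding z(3) using assms by (auto intro!: mult_left_mono)
qed

lemma graded_mesh_step:
  assumes "j \<ge> 1"
  shows "step (graded_mesh T N r) j = (real j powr r - real (j - 1) powr r) * (T / real N powr r)"
  by (simp add: step_def graded_mesh_def powr_divide left_diff_distrib diff_divide_distrib)

lemma graded_mesh_ratio: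
  assumes "0 < T" "1 \<le> N" "2 \<le> k"
  shows "step_ratio (graded_mesh T N r) k =
    (real k powr r - real (k - 1) powr r) / (real (k - 1) powr r - real (k - 2) powr r)"
  using assms graded_mesh_step[of k T N r] graded_mesh_step[of "k - 1" T N r]
  by (simp add: step_ratio_def numeral_2_eq_2)

text \<open>The uniform mesh is the case of grading parameter \<open>1\<close>.\<close>

lemma graded_mesh_ratio_ge_1:
  assumes "0 < T" "1 \<le> N" "2 \<le> k" "1 \<le> r"
  shows "1 \<le> step_ratio (graded_mesh T N r) k"
  using powr_increment_ratio_mono[of "real (k - 2)" "real (k - 1)" "real k" 1 r] assms
  by (simp add: graded_mesh_ratio of_nat_diff)

lemma graded_mesh_widening:
  assumes "0 < T" "1 \<le> N" "1 \<le> r"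
  shows "widening_mesh (graded_mesh T N r)"
proof -
  let ?t = "graded_mesh T N r"
  have pos: "0 < step ?t j" if "j \<ge> 1" for j
    unfolding graded_mesh_step[OF that] using assms that
    by (intro mult_pos_pos) (auto intro!: powr_less_mono2)
  have "step ?t j \<le> step ?t (Suc j)" if "j \<ge> 1" for j
    using graded_mesh_ratio_ge_1[of T N "Suc j" r] assms that pos[OF that]
    by (simp add: step_ratio_def pos_le_divide_eq)
  then show ?thesis using pos by (auto simp: widening_mesh_def)
qed

text \<open>The ratios increase with \<open>r\<close>, so it suffices to bound them at one exponent above the admissible
range. The limit scheme BDF2 loses positivity on long graded meshes at about \<open>r = 3.20183\<close>, so there
is little room: \<open>381 / 119 = 3.20168\<dots>\<close> is a fraction with small denominator between the two values. From
the sixth step on a bound by the mean value theorem suffices.\<close>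

lemma graded_mesh_ratio_upper:
  assumes "0 < T" "1 \<le> N" "1 \<le> r" "r \<le> 381 / 119"
  shows "step_ratio (graded_mesh T N r) 2 \<le> 8.2003"
    and "step_ratio (graded_mesh T N r) 3 \<le> 2.9874"
    and "step_ratio (graded_mesh T N r) 4 \<le> 2.0799"
    and "step_ratio (graded_mesh T N r) 5 \<le> 1.7335"
    and "6 \<le> k \<Longrightarrow> step_ratio (graded_mesh T N r) k \<le> 2.5"
proof -
  define s where "s = real 381 / real 119"
  have rs: "r \<le> s" "0 < s" using assms by (auto simp: s_def)
  have le: "step_ratio (graded_mesh T N r) k \<le>
      (real k powr s - real (k - 1) powr s) / (real (k - 1) powr s - real (k - 2) powr s)"
    if "2 \<le> k" for k
    using powr_increment_ratio_mono[of "real (k - 2)" "real (k - 1)" "real k" r s] assms rs that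
    by (simp add: graded_mesh_ratio of_nat_diff)
  have p2: "9.2002 \<le> 2 powr s" "2 powr s \<le> 9.2003"
  proof -
    show "9.2002 \<le> 2 powr s"
      unfolding s_def by (rule powr_381_119_bounds(1)[where d = 5579400]) (simp_all add: power_divide)
    show "2 powr s \<le> 9.2003"
      unfolding s_def by (rule powr_381_119_bounds(2)[where d = 5579739]) (simp_all add: power_divide)
  qed
  have p3: "33.6968 \<le> 3 powr s" "3 powr s \<le> 33.6970"
  proof -
    show "33.6968 \<le> 3 powr s"
      unfolding s_def by (rule powr_381_119_bounds(1)[where d = 49332000000]) (simp_all add: power_divide)
    show "3 powr s \<le> 33.6970"
      unfolding s_def by (rule powr_381_119_bounds(2)[where d = 49333000000]) (simp_all add: power_divide)
  qed
  have p5: "5 powr s \<le> 172.94"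
    unfolding s_def by (rule powr_381_119_bounds(2)[where d = 4626600000000000]) (simp_all add: power_divide)
  have "4 powr s = (2 powr s)\<^sup>2" using powr_mult[of 2 2 s] by (simp add: power2_eq_square)
  moreover have "(9.2002)\<^sup>2 \<le> (2 powr s)\<^sup>2" "(2 powr s)\<^sup>2 \<le> (9.2003)\<^sup>2"
    using p2 by (auto intro!: power_mono)
  ultimately have p4: "84.643 \<le> 4 powr s" "4 powr s \<le> 84.6456"
    by (auto simp: power2_eq_square)
  show "step_ratio (graded_mesh T N r) 2 \<le> 8.2003" using le[of 2] p2 by simp
  show "step_ratio (graded_mesh T N r) 3 \<le> 2.9874"
    using p2 p3 by (intro order_trans[OF le[of 3]]) (auto simp: pos_divide_le_eq)
  show "step_ratio (graded_mesh T N r) 4 \<le> 2.0799"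
    using p2 p3 p4 by (intro order_trans[OF le[of 4]]) (auto simp: pos_divide_le_eq)
  show "step_ratio (graded_mesh T N r) 5 \<le> 1.7335"
    using p3 p4 p5 by (intro order_trans[OF le[of 5]]) (auto simp: pos_divide_le_eq)
  show "step_ratio (graded_mesh T N r) k \<le> 2.5" if k: "6 \<le> k"
  proof -
    define x where "x = real k"
    have x: "6 \<le> x" "real (k - 1) = x - 1" "real (k - 2) = x - 2" using k by (auto simp: x_def)
    have low: "r * (x - 2) powr (r - 1) \<le> (x - 1) powr r - (x - 2) powr r"
      using powr_increment_bounds(1)[of "x - 2" "x - 1" r] x assms by simp
    have up: "x powr r - (x - 1) powr r \<le> r * x powr (r - 1)"
      using powr_increment_bounds(2)[of "x - 1" x r] x assms by simp
    have pos: "0 < r * (x - 2) powr (r - 1)" using x assms by simp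
    have "step_ratio (graded_mesh T N r) k =
        (x powr r - (x - 1) powr r) / ((x - 1) powr r - (x - 2) powr r)"
      using graded_mesh_ratio[of T N k r] assms k x by (simp add: x_def)
    also have "\<dots> \<le> (r * x powr (r - 1)) / (r * (x - 2) powr (r - 1))"
      using low up pos x assms by (intro frac_le) auto
    also have "\<dots> = (x / (x - 2)) powr (r - 1)" using x assms by (simp add: powr_divide)
    also have "\<dots> \<le> (3 / 2) powr (r - 1)"
      using x assms by (intro powr_mono2) (auto simp: field_simps)
    also have "\<dots> \<le> (3 / 2) powr (real 9 / real 4)" using assms by (intro powr_mono) auto
    also have "\<dots> \<le> 2.5" by (rule power_le_imp_powr_divide(2)) (auto simp: power_divide)
    finally show ?thesis .
  qed
qed

text \<open>Multiplied by \<open>1 + \<rho>\<close>, the BDF2 condition with a constant multiplier \<open>A\<close> reads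
\<open>(A * \<rho> + F - 4) * \<rho> \<le> 2 - F\<close>, and the left side is largest at the largest ratio.\<close>

lemma constant_multiplier_dominance:
  fixes \<alpha> \<rho> \<rho>' A A' F R R' m :: real
  assumes \<alpha>: "0 < \<alpha>" "\<alpha> < 1" and \<rho>: "1 \<le> \<rho>" "\<rho> \<le> R" "1 \<le> \<rho>'" "\<rho>' \<le> R'"
    and pos: "0 < A" "0 < A'" "0 \<le> F" "0 \<le> m" "0 \<le> A * R + F - 4"
    and bdf: "(A * R + F - 4) * R \<le> 2 - F"
    and next_ratio: "R' / (1 + R') \<le> F * A'"
    and m: "R' - 17 / 10 \<le> m"
    and slope: "7 / 10 * (2 + 2 * (R / (1 + R)) - F) + F * m \<le> 5 / 2"
  shows "\<alpha> / (2 - \<alpha>) * (\<rho>\<^sup>2 / (1 + \<rho>) * (A * (1 + 7 / 10 * (1 - \<alpha>))) +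
        \<rho>'\<^sup>2 * \<rho>' powr (- \<alpha>) / (1 + \<rho>') / (A' * (1 + 7 / 10 * (1 - \<alpha>))))
      \<le> 2 + 2 * (\<alpha> / (2 - \<alpha>)) * (\<rho> / (1 + \<rho>))
        - (1 - \<alpha>) * (\<rho>' powr (- \<alpha>) + 1 - (1 + \<rho>') powr (- \<alpha>))"
proof (rule later_step_dominance[where F = F and m = m])
  have frac_mono: "x / (1 + x) \<le> y / (1 + y)" if "1 \<le> x" "x \<le> y" for x y :: real
    using that by (simp add: divide_simps) (simp add: algebra_simps)
  have "(A * \<rho> + F - 4) * \<rho> \<le> (A * R + F - 4) * R"
  proof -
    have "(A * \<rho> + F - 4) * \<rho> \<le> (A * R + F - 4) * \<rho>"
      using \<rho> pos by (intro mult_right_mono) auto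
    also have "\<dots> \<le> (A * R + F - 4) * R" using \<rho> pos by (intro mult_left_mono) auto
    finally show ?thesis .
  qed
  then have "\<rho>\<^sup>2 * A + F * (1 + \<rho>) \<le> 2 * (1 + \<rho>) + 2 * \<rho>"
    using bdf by (simp add: algebra_simps power2_eq_square)
  then have "(\<rho>\<^sup>2 * A + F * (1 + \<rho>)) / (1 + \<rho>) \<le> (2 * (1 + \<rho>) + 2 * \<rho>) / (1 + \<rho>)"
    using \<rho> by (intro divide_right_mono) auto
  moreover have "(\<rho>\<^sup>2 * A + F * (1 + \<rho>)) / (1 + \<rho>) = \<rho>\<^sup>2 / (1 + \<rho>) * A + F"
    using \<rho> by (simp add: add_divide_distrib)
  moreover have "(2 * (1 + \<rho>) + 2 * \<rho>) / (1 + \<rho>) = 2 + 2 * (\<rho> / (1 + \<rho>))"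
    using \<rho> by (simp add: field_simps)
  ultimately show E: "\<rho>\<^sup>2 / (1 + \<rho>) * A + F \<le> 2 + 2 * (\<rho> / (1 + \<rho>))" by simp
  show "\<rho>' / (1 + \<rho>') \<le> F * A'" using frac_mono[of \<rho>' R'] \<rho> next_ratio by simp
  have "\<rho>\<^sup>2 / (1 + \<rho>) * A \<le> 2 + 2 * (R / (1 + R)) - F"
    using E frac_mono[of \<rho> R] \<rho> by linarith
  then have "7 / 10 * (\<rho>\<^sup>2 / (1 + \<rho>) * A) \<le> 7 / 10 * (2 + 2 * (R / (1 + R)) - F)"
    by (rule mult_left_mono) simp
  then show "7 / 10 * (\<rho>\<^sup>2 / (1 + \<rho>) * A) + F * m \<le> 5 / 2" using slope by linarith
qed (use assms in auto)

text \<open>For \<open>\<alpha> = 1\<close> the multipliers \<open>A\<close> come from Gaussian elimination of the tridiagonal BDF2 form at the largest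
ratios, started with the exact pivot \<open>2\<close>: the following pivots, rounded down, are \<open>F = 0.5253\<close>,
\<open>0.306\<close>, \<open>0.2507\<close>, and the next one exceeds \<open>0.4762\<close>; each multiplier is at least
\<open>\<rho> / ((1 + \<rho>) * F)\<close> with \<open>\<rho>\<close> the ratio bound of its own step and \<open>F\<close> the pivot of the preceding one. From step \<open>6\<close> on the ratios are
small enough for the constant multiplier \<open>1.5\<close>.\<close>

lemma graded_mesh_L2_form_nonneg:
  assumes "0 < T" "1 \<le> N" and r: "1 \<le> r" "r \<le> 3.2016538" and \<alpha>: "0 < \<alpha>" "\<alpha> < 1"
  shows "0 \<le> (\<Sum>k=1..n. incr y k * L2_operator \<alpha> (graded_mesh T N r) k y)"
proof -
  define t where "t = graded_mesh T N r"
  define \<rho> where "\<rho> = step_ratio t"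
  have r0: "r \<le> 381 / 119" using r by simp
  have low: "1 \<le> \<rho> k" if "2 \<le> k" for k
    using graded_mesh_ratio_ge_1[of T N k r] assms that by (simp add: \<rho>_def t_def)
  have up: "\<rho> 2 \<le> 8.2003" "\<rho> 3 \<le> 2.9874" "\<rho> 4 \<le> 2.0799" "\<rho> 5 \<le> 1.7335"
      "6 \<le> k \<Longrightarrow> \<rho> k \<le> 2.5" for k
    using graded_mesh_ratio_upper[OF assms(1,2) r(1) r0] by (simp_all add: \<rho>_def t_def)
  define A :: "nat \<Rightarrow> real"
    where "A k = (if k = 3 then 1.4263 else if k = 4 then 2.207 else if k = 5 then 2.53 else 1.5)" for k
  \<comment> \<open>The growth rates \<open>1 / 2\<close> and \<open>7 / 10\<close> in \<open>1 - \<alpha>\<close> are a compromise: a larger rate for one step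
    weakens the condition on the preceding step and strengthens its own.\<close>
  define \<theta> where "\<theta> k = (if k = 2 then \<rho> 2 / (2 * (1 + \<rho> 2)) * (1 + 1 / 2 * (1 - \<alpha>))
    else A k * (1 + 7 / 10 * (1 - \<alpha>)))" for k
  show ?thesis
    unfolding t_def[symmetric]
  proof (rule L2_form_nonneg[where \<theta> = \<theta>])
    show "widening_mesh t" unfolding t_def by (rule graded_mesh_widening) (use assms in auto)
    show "0 < \<theta> k" for k
    proof -
      have "0 < A k" by (simp add: A_def)
      moreover have "0 < 1 + 7 / 10 * (1 - \<alpha>)" "0 < 1 + 1 / 2 * (1 - \<alpha>)" using \<alpha>
        by (auto intro!: add_pos_nonneg mult_nonneg_nonneg simp del: right_diff_distrib_numeral)
      ultimately show ?thesis
        unfolding \<theta>_def using low[of 2] by (auto intro!: mult_pos_pos divide_pos_pos)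
    qed
    show "\<alpha> / (2 - \<alpha>) * ((step_ratio t 2)\<^sup>2 * step_ratio t 2 powr (- \<alpha>) /
        (1 + step_ratio t 2) / \<theta> 2) \<le> 2 - (1 - \<alpha>) * step_ratio t 2 powr (- \<alpha>)"
      using first_step_dominance[OF \<alpha> low[of 2] up(1)] unfolding \<theta>_def \<rho>_def by simp
    fix k x x' assume k: "k \<ge> 2" and "x = step_ratio t k" "x' = step_ratio t (Suc k)"
    then have x: "x = \<rho> k" "x' = \<rho> (Suc k)" by (auto simp: \<rho>_def)
    have x1: "1 \<le> x" "1 \<le> x'" using low k x by auto
    consider "k = 2" | "k = 3" | "k = 4" | "k = 5" | "k \<ge> 6" using k by linarith
    then show "\<alpha> / (2 - \<alpha>) * (x\<^sup>2 / (1 + x) * \<theta> k + x'\<^sup>2 * x' powr (- \<alpha>) / (1 + x') / \<theta> (Suc k))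
        \<le> 2 + 2 * (\<alpha> / (2 - \<alpha>)) * (x / (1 + x))
          - (1 - \<alpha>) * (x' powr (- \<alpha>) + 1 - (1 + x') powr (- \<alpha>))"
    proof cases
      case 1
      have xb: "x \<le> 8.2003" "x' \<le> 2.9874" using up(1,2) x 1 by (auto simp: numeral_3_eq_3 numeral_2_eq_2)
      have \<theta>: "\<theta> k = x / (2 * (1 + x)) * (1 + 1 / 2 * (1 - \<alpha>))"
        "\<theta> (Suc k) = 1.4263 * (1 + 7 / 10 * (1 - \<alpha>))"
        using 1 x by (auto simp: \<theta>_def A_def)
      have "x ^ 3 \<le> 69494/10000 * x\<^sup>2 + 98988/10000 * x + 29494/10000"
      proof -
        have "x ^ 3 \<le> 8.2003 * x\<^sup>2"
          using mult_right_mono[OF xb(1), of "x\<^sup>2"] by (simp add: power2_eq_square power3_eq_cube)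
        moreover have "1.2509 * x\<^sup>2 \<le> 1.2509 * 8.2003 * x"
          using mult_right_mono[OF xb(1), of x] x1 by (simp add: power2_eq_square)
        ultimately show ?thesis using xb by simp
      qed
      then have poly: "x ^ 3 + 5253/10000 * (2 * (1 + x)\<^sup>2) \<le> (2 + 2 * (x / (1 + x))) * (2 * (1 + x)\<^sup>2)"
      proof -
        have "x / (1 + x) * (1 + x)\<^sup>2 = x * (1 + x)" using x1 by (simp add: power2_eq_square)
        then have "(2 + 2 * (x / (1 + x))) * (2 * (1 + x)\<^sup>2) = 4 * (1 + x)\<^sup>2 + 4 * (x * (1 + x))"
          by (simp only: distrib_right mult.assoc mult.left_commute[of _ 2]) simp
        moreover have "(1 + x)\<^sup>2 = 1 + 2 * x + x\<^sup>2" "x * (1 + x) = x + x\<^sup>2"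
          by (simp_all add: power2_eq_square algebra_simps)
        ultimately show ?thesis
          using \<open>x ^ 3 \<le> _\<close> by linarith
      qed
      have E: "x\<^sup>2 / (1 + x) * (x / (2 * (1 + x))) + 5253/10000 \<le> 2 + 2 * (x / (1 + x))"
      proof -
        have "x\<^sup>2 / (1 + x) * (x / (2 * (1 + x))) + 5253/10000 =
            (x ^ 3 + 5253/10000 * (2 * (1 + x)\<^sup>2)) / (2 * (1 + x)\<^sup>2)"
          using x1 by (simp add: add_divide_distrib power2_eq_square power3_eq_cube)
        also have "\<dots> \<le> 2 + 2 * (x / (1 + x))"
          using poly x1 by (subst pos_divide_le_eq) auto
        finally show ?thesis .
      qed
      have f: "x / (1 + x) \<le> 1" using x1 by simp
      show ?thesis
        unfolding \<theta>
      proof (rule later_step_dominance[where F = "5253/10000" and m = "12874/10000"])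
        show "x\<^sup>2 / (1 + x) * (x / (2 * (1 + x))) + 5253/10000 \<le> 2 + 2 * (x / (1 + x))" by (rule E)
        show "1 / 2 * (x\<^sup>2 / (1 + x) * (x / (2 * (1 + x)))) + 5253/10000 * (12874/10000) \<le> 5 / 2"
          using E f by linarith
        show "x' / (1 + x') \<le> 5253/10000 * 1.4263" using x1 xb by (simp add: pos_divide_le_eq)
      qed (use \<alpha> x1 xb in auto)
    next
      case 2
      have xb: "x \<le> 2.9874" "x' \<le> 2.0799" using up x 2 by (auto simp: eval_nat_numeral)
      have \<theta>: "\<theta> k = 1.4263 * (1 + 7 / 10 * (1 - \<alpha>))" "\<theta> (Suc k) = 2.207 * (1 + 7 / 10 * (1 - \<alpha>))"
        using 2 by (auto simp: \<theta>_def A_def)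
      show ?thesis
        unfolding \<theta>
        by (rule constant_multiplier_dominance[where R = "2.9874" and R' = "2.0799" and F = "0.306" and m = "0.3799"])
          (use \<alpha> x1 xb in simp_all)
    next
      case 3
      have xb: "x \<le> 2.0799" "x' \<le> 1.7335" using up x 3 by (auto simp: eval_nat_numeral)
      have \<theta>: "\<theta> k = 2.207 * (1 + 7 / 10 * (1 - \<alpha>))" "\<theta> (Suc k) = 2.53 * (1 + 7 / 10 * (1 - \<alpha>))"
        using 3 by (auto simp: \<theta>_def A_def)
      show ?thesis
        unfolding \<theta>
        by (rule constant_multiplier_dominance[where R = "2.0799" and R' = "1.7335" and F = "0.2507" and m = "0.0335"])
          (use \<alpha> x1 xb in simp_all)
    next
      case 4
      have xb: "x \<le> 1.7335" "x' \<le> 2.5" using up x 4 by (auto simp: eval_nat_numeral)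
      have \<theta>: "\<theta> k = 2.53 * (1 + 7 / 10 * (1 - \<alpha>))" "\<theta> (Suc k) = 1.5 * (1 + 7 / 10 * (1 - \<alpha>))"
        using 4 by (auto simp: \<theta>_def A_def)
      show ?thesis
        unfolding \<theta>
        by (rule constant_multiplier_dominance[where R = "1.7335" and R' = "2.5" and F = "0.4762" and m = "0.8"])
          (use \<alpha> x1 xb in simp_all)
    next
      case 5
      have xb: "x \<le> 2.5" "x' \<le> 2.5" using up(5)[of k] up(5)[of "Suc k"] x 5 by auto
      have \<theta>: "\<theta> k = 1.5 * (1 + 7 / 10 * (1 - \<alpha>))" "\<theta> (Suc k) = 1.5 * (1 + 7 / 10 * (1 - \<alpha>))"
        using 5 by (auto simp: \<theta>_def A_def)
      show ?thesis
        unfolding \<theta>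
        by (rule constant_multiplier_dominance[where R = "2.5" and R' = "2.5" and F = "0.4762" and m = "0.8"])
          (use \<alpha> x1 xb in simp_all)
    qed
  qed (use \<alpha> in auto)
qed

section \<open>Square integrable functions and the Poincare inequality\<close>

lemma L2_inner_integrable:
  assumes "v \<in> L2 \<Omega>" "w \<in> L2 \<Omega>"
  shows "integrable (lebesgue_on \<Omega>) (\<lambda>x. v x \<bullet> w x)"
proof (rule Bochner_Integration.integrable_bound)
  show "integrable (lebesgue_on \<Omega>) (\<lambda>x. (norm (v x))\<^sup>2 + (norm (w x))\<^sup>2)"
    using assms by (auto simp: L2_def)
  show "(\<lambda>x. v x \<bullet> w x) \<in> borel_measurable (lebesgue_on \<Omega>)"
    using assms by (intro borel_measurable_inner) (auto simp: L2_def)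
  show "AE x in lebesgue_on \<Omega>. norm (v x \<bullet> w x) \<le> norm ((norm (v x))\<^sup>2 + (norm (w x))\<^sup>2)"
  proof (rule AE_I2)
    fix x
    have "2 * (norm (v x) * norm (w x)) \<le> (norm (v x))\<^sup>2 + (norm (w x))\<^sup>2"
      using sum_squares_bound[of "norm (v x)" "norm (w x)"] by simp
    moreover have "\<bar>v x \<bullet> w x\<bar> \<le> norm (v x) * norm (w x)" by (rule Cauchy_Schwarz_ineq2)
    moreover have "0 \<le> norm (v x) * norm (w x)" by simp
    ultimately show "norm (v x \<bullet> w x) \<le> norm ((norm (v x))\<^sup>2 + (norm (w x))\<^sup>2)"
      unfolding real_norm_def by linarith
  qed
qed

lemma L2_lincomb:
  assumes "v \<in> L2 \<Omega>" "w \<in> L2 \<Omega>"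
  shows "(\<lambda>x. a *\<^sub>R v x + b *\<^sub>R w x) \<in> L2 \<Omega>"
proof -
  have eq: "(norm (a *\<^sub>R v x + b *\<^sub>R w x))\<^sup>2 =
      a\<^sup>2 * (v x \<bullet> v x) + 2 * a * b * (v x \<bullet> w x) + b\<^sup>2 * (w x \<bullet> w x)" for x
    unfolding power2_norm_eq_inner
    by (simp add: inner_add_left inner_add_right inner_commute power2_eq_square algebra_simps)
  have "integrable (lebesgue_on \<Omega>) (\<lambda>x. (norm (a *\<^sub>R v x + b *\<^sub>R w x))\<^sup>2)"
    unfolding eq using L2_inner_integrable assms by (intro Bochner_Integration.integrable_add) auto
  then show ?thesis using assms by (auto simp: L2_def)
qed

lemma L2_diff: "v \<in> L2 \<Omega> \<Longrightarrow> w \<in> L2 \<Omega> \<Longrightarrow> (\<lambda>x. v x - w x) \<in> L2 \<Omega>"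
  using L2_lincomb[of v \<Omega> w 1 "-1"] by simp

lemma L2_add: "v \<in> L2 \<Omega> \<Longrightarrow> w \<in> L2 \<Omega> \<Longrightarrow> (\<lambda>x. v x + w x) \<in> L2 \<Omega>"
  using L2_lincomb[of v \<Omega> w 1 1] by simp

lemma L2_scale: "v \<in> L2 \<Omega> \<Longrightarrow> (\<lambda>x. a *\<^sub>R v x) \<in> L2 \<Omega>"
  using L2_lincomb[of v \<Omega> v a 0] by simp

lemma L2_zero: "(\<lambda>x. 0) \<in> L2 \<Omega>"
  by (simp add: L2_def)

lemma L2_sum: "(\<And>i. i \<in> I \<Longrightarrow> v i \<in> L2 \<Omega>) \<Longrightarrow> (\<lambda>x. \<Sum>i\<in>I. v i x) \<in> L2 \<Omega>"
  by (induction I rule: infinite_finite_induct) (auto intro: L2_add L2_zero)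

lemma L2_component:
  assumes "g \<in> L2 \<Omega>"
  shows "(\<lambda>x. g x \<bullet> b) \<in> L2 \<Omega>"
proof -
  have "integrable (lebesgue_on \<Omega>) (\<lambda>x. (norm (g x \<bullet> b))\<^sup>2)"
  proof (rule Bochner_Integration.integrable_bound)
    show "integrable (lebesgue_on \<Omega>) (\<lambda>x. (norm (g x))\<^sup>2 * (norm b)\<^sup>2)"
      using assms by (auto simp: L2_def)
    show "(\<lambda>x. (norm (g x \<bullet> b))\<^sup>2) \<in> borel_measurable (lebesgue_on \<Omega>)"
      using assms by (auto simp: L2_def intro!: borel_measurable_inner borel_measurable_power)
    show "AE x in lebesgue_on \<Omega>. norm ((norm (g x \<bullet> b))\<^sup>2) \<le> norm ((norm (g x))\<^sup>2 * (norm b)\<^sup>2)"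
      using power_mono[OF Cauchy_Schwarz_ineq2, of "g x" b 2 for x]
      by (auto simp: power_mult_distrib)
  qed
  then show ?thesis
    using assms by (auto simp: L2_def intro!: borel_measurable_inner)
qed

lemma L2_inner_commute: "L2_inner \<Omega> v w = L2_inner \<Omega> w v"
  by (simp add: L2_inner_def inner_commute)

lemma L2_inner_diff_right:
  assumes "u \<in> L2 \<Omega>" "v \<in> L2 \<Omega>" "w \<in> L2 \<Omega>"
  shows "L2_inner \<Omega> u (\<lambda>x. v x - w x) = L2_inner \<Omega> u v - L2_inner \<Omega> u w"
  unfolding L2_inner_def inner_diff_right
  using assms by (intro Bochner_Integration.integral_diff L2_inner_integrable)

lemma L2_inner_diff_left:
  assumes "u \<in> L2 \<Omega>" "v \<in> L2 \<Omega>" "w \<in> L2 \<Omega>"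
  shows "L2_inner \<Omega> (\<lambda>x. v x - w x) u = L2_inner \<Omega> v u - L2_inner \<Omega> w u"
  using L2_inner_diff_right[OF assms] by (simp add: L2_inner_commute)

lemma L2_inner_self_nonneg: "0 \<le> L2_inner \<Omega> v v"
  by (simp add: L2_inner_def)

lemma L2_norm_nonneg [simp]: "0 \<le> L2_norm \<Omega> v"
  by (simp add: L2_norm_def L2_inner_self_nonneg)

lemma L2_norm_squared: "(L2_norm \<Omega> v)\<^sup>2 = L2_inner \<Omega> v v"
  by (simp add: L2_norm_def L2_inner_self_nonneg)

lemma L2_norm_diff_squared:
  assumes "v \<in> L2 \<Omega>" "w \<in> L2 \<Omega>"
  shows "(L2_norm \<Omega> (\<lambda>x. v x - w x))\<^sup>2 =
    (L2_norm \<Omega> v)\<^sup>2 - 2 * L2_inner \<Omega> v w + (L2_norm \<Omega> w)\<^sup>2"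
  using assms L2_inner_commute[of \<Omega> w v]
  by (simp add: L2_norm_squared L2_inner_diff_left L2_inner_diff_right L2_diff)

lemma L2_Cauchy_Schwarz:
  assumes v: "v \<in> L2 \<Omega>" and w: "w \<in> L2 \<Omega>"
  shows "\<bar>L2_inner \<Omega> v w\<bar> \<le> L2_norm \<Omega> v * L2_norm \<Omega> w"
proof -
  define p q B where "p = (L2_norm \<Omega> v)\<^sup>2" and "q = (L2_norm \<Omega> w)\<^sup>2" and "B = L2_inner \<Omega> v w"
  have pq: "0 \<le> p" "0 \<le> q" by (auto simp: p_def q_def)
  have quad: "0 \<le> p - 2 * s * B + s\<^sup>2 * q" for s
  proof -
    have "0 \<le> (L2_norm \<Omega> (\<lambda>x. v x - s *\<^sub>R w x))\<^sup>2" by simp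
    also have "\<dots> = p - 2 * s * B + s\<^sup>2 * q"
      by (subst L2_norm_diff_squared[OF v L2_scale[OF w]])
        (simp add: p_def q_def B_def L2_norm_squared L2_inner_def power2_eq_square[of s])
    finally show ?thesis .
  qed
  have "B\<^sup>2 \<le> p * q"
  proof (cases "q = 0")
    case True
    have "B = 0"
    proof (rule ccontr)
      assume "B \<noteq> 0"
      then show False using quad[of "(p + 1) / (2 * B)"] True by simp
    qed
    then show ?thesis using pq by simp
  next
    case False
    then have "0 \<le> p - B\<^sup>2 / q" using quad[of "B / q"] by (simp add: power2_eq_square field_simps)
    then show ?thesis using False pq by (simp add: field_simps)
  qed
  then have "\<bar>B\<bar> \<le> sqrt (p * q)" by (simp add: real_le_rsqrt)
  then show ?thesis by (simp add: p_def q_def B_def real_sqrt_mult)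
qed

lemma L2_norm_diff_triangle:
  assumes v: "v \<in> L2 \<Omega>" and w: "w \<in> L2 \<Omega>"
  shows "L2_norm \<Omega> (\<lambda>x. v x - w x) \<le> L2_norm \<Omega> v + L2_norm \<Omega> w"
proof (rule power2_le_imp_le)
  show "(L2_norm \<Omega> (\<lambda>x. v x - w x))\<^sup>2 \<le> (L2_norm \<Omega> v + L2_norm \<Omega> w)\<^sup>2"
    using L2_Cauchy_Schwarz[OF v w] unfolding L2_norm_diff_squared[OF v w]
    by (simp add: power2_sum abs_le_iff)
qed simp

lemma L2_norm_minus_commute: "L2_norm \<Omega> (\<lambda>x. v x - w x) = L2_norm \<Omega> (\<lambda>x. w x - v x)"
proof -
  have "(v x - w x) \<bullet> (v x - w x) = (w x - v x) \<bullet> (w x - v x)" for x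
    by (metis inner_minus_left inner_minus_right minus_diff_eq minus_minus)
  then show ?thesis by (simp add: L2_norm_def L2_inner_def)
qed

lemma L2_norm_triangle_sub:
  assumes "v \<in> L2 \<Omega>" "w \<in> L2 \<Omega>"
  shows "L2_norm \<Omega> v \<le> L2_norm \<Omega> (\<lambda>x. v x - w x) + L2_norm \<Omega> w"
proof -
  have "L2_norm \<Omega> v = L2_norm \<Omega> (\<lambda>x. (w x - v x) - w x)"
    by (simp add: L2_norm_def L2_inner_def)
  also have "\<dots> \<le> L2_norm \<Omega> (\<lambda>x. w x - v x) + L2_norm \<Omega> w"
    using assms by (intro L2_norm_diff_triangle L2_diff)
  finally show ?thesis by (simp only: L2_norm_minus_commute[of \<Omega> w v])
qed

lemma L2_norm_mono:
  fixes f :: "'a::euclidean_space \<Rightarrow> 'b::euclidean_space" and g :: "'a \<Rightarrow> 'c::euclidean_space"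
  assumes f: "f \<in> L2 \<Omega>" and g: "g \<in> L2 \<Omega>" and "0 \<le> c"
    and le: "\<And>x. x \<in> \<Omega> \<Longrightarrow> norm (f x) \<le> c * norm (g x)"
  shows "L2_norm \<Omega> f \<le> c * L2_norm \<Omega> g"
proof (rule power2_le_imp_le)
  have "L2_inner \<Omega> f f \<le> (\<integral>x. c\<^sup>2 * (g x \<bullet> g x) \<partial>lebesgue_on \<Omega>)"
    unfolding L2_inner_def
  proof (rule integral_mono_AE')
    show "integrable (lebesgue_on \<Omega>) (\<lambda>x. c\<^sup>2 * (g x \<bullet> g x))"
      using L2_inner_integrable[OF g g] by simp
    show "AE x in lebesgue_on \<Omega>. f x \<bullet> f x \<le> c\<^sup>2 * (g x \<bullet> g x)"
      using power_mono[OF le, of _ 2]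
      by (intro AE_I2) (auto simp: power_mult_distrib power2_norm_eq_inner)
  qed auto
  then show "(L2_norm \<Omega> f)\<^sup>2 \<le> (c * L2_norm \<Omega> g)\<^sup>2"
    by (simp add: L2_norm_squared power_mult_distrib L2_inner_def)
qed (use assms in simp)

lemma continuous_imp_L2:
  fixes h :: "'a::euclidean_space \<Rightarrow> 'b::euclidean_space"
  assumes "open \<Omega>" "bounded \<Omega>" "continuous_on UNIV h"
  shows "h \<in> L2 \<Omega>"
proof -
  have meas: "h \<in> borel_measurable (lebesgue_on \<Omega>)"
    using borel_measurable_continuous_onI[OF assms(3)]
    by (intro measurable_restrict_space1 measurable_completion) simp
  have "compact (h ` closure \<Omega>)"
    using assms by (intro compact_continuous_image) (auto intro: continuous_on_subset)
  then obtain B where B: "\<And>x. x \<in> closure \<Omega> \<Longrightarrow> norm (h x) \<le> B"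
    using compact_imp_bounded bounded_iff by (metis imageI)
  interpret finite_measure "lebesgue_on \<Omega>"
    using assms by (intro finite_measure_lebesgue_on lmeasurable_open)
  have "integrable (lebesgue_on \<Omega>) (\<lambda>x. (norm (h x))\<^sup>2)"
  proof (rule integrable_const_bound)
    show "AE x in lebesgue_on \<Omega>. norm ((norm (h x))\<^sup>2) \<le> B\<^sup>2"
      using B closure_subset[of \<Omega>] by (intro AE_I2) (auto intro!: power_mono)
    show "(\<lambda>x. (norm (h x))\<^sup>2) \<in> borel_measurable (lebesgue_on \<Omega>)"
      using meas by measurable
  qed
  then show ?thesis using meas by (simp add: L2_def)
qed

text \<open>Difference quotients of a compactly supported function integrate to zero by translation invariance,
and they converge boundedly to the directional derivative.\<close>

lemma integral_directional_derivative_eq_0: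
  fixes \<psi> D :: "'a::euclidean_space \<Rightarrow> real"
  assumes deriv: "\<And>x. (\<psi> has_derivative \<psi>' x) (at x)" and D: "\<And>x. D x = \<psi>' x b"
    and cont: "continuous_on UNIV D" and K: "bounded K"
    and outside: "\<And>x. x \<notin> K \<Longrightarrow> \<psi> x = 0 \<and> D x = 0"
  shows "(\<integral>x. D x \<partial>lborel) = 0"
proof -
  have line: "((\<lambda>s. \<psi> (x + s *\<^sub>R b)) has_real_derivative D (x + s *\<^sub>R b)) (at s)" for x s
  proof -
    have "((\<lambda>s. \<psi> (x + s *\<^sub>R b)) has_derivative (\<lambda>h. \<psi>' (x + s *\<^sub>R b) (h *\<^sub>R b))) (at s)"
      by (rule has_derivative_compose[OF _ deriv]) (auto intro!: derivative_eq_intros)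
    moreover have "\<psi>' (x + s *\<^sub>R b) (h *\<^sub>R b) = D (x + s *\<^sub>R b) * h" for h
      using linear_scale[OF has_derivative_linear[OF deriv]] D by simp
    ultimately show ?thesis by (simp add: has_field_derivative_def)
  qed
  obtain R where R: "\<And>x. x \<in> K \<Longrightarrow> norm x \<le> R" using K bounded_iff by blast
  define Q where "Q = cball (0::'a) (R + norm b)"
  have "compact (D ` cball 0 R)"
    by (intro compact_continuous_image continuous_on_subset[OF cont]) auto
  then obtain M where M: "\<And>x. x \<in> cball 0 R \<Longrightarrow> \<bar>D x\<bar> \<le> M"
    using compact_imp_bounded bounded_iff by (metis imageI real_norm_def)
  have D_le: "\<bar>D x\<bar> \<le> \<bar>M\<bar>" for x
    using M[of x] outside[of x] R[of x] by (cases "x \<in> K") (auto simp: dist_norm)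
  define h where "h n = 1 / real (Suc n)" for n
  have h: "0 < h n" "h n \<le> 1" for n by (auto simp: h_def)
  define q where "q n x = (\<psi> (x + h n *\<^sub>R b) - \<psi> x) / h n" for n x
  have cont_\<psi>: "continuous_on UNIV \<psi>"
    using deriv has_derivative_continuous by (fastforce simp: continuous_on_eq_continuous_within)
  have int_\<psi>: "integrable lborel \<psi>"
  proof -
    have "\<psi> = (\<lambda>x. indicator (cball 0 R) x *\<^sub>R \<psi> x)"
    proof
      show "\<psi> x = indicator (cball 0 R) x *\<^sub>R \<psi> x" for x
        using outside[of x] R[of x] by (cases "x \<in> K") auto
    qed
    moreover have "integrable lborel (\<lambda>x. indicator (cball 0 R) x *\<^sub>R \<psi> x)"
      by (intro borel_integrable_compact continuous_on_subset[OF cont_\<psi>]) auto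
    ultimately show ?thesis by simp
  qed
  have meas_\<psi>: "\<psi> \<in> borel_measurable borel" by (rule borel_measurable_continuous_onI[OF cont_\<psi>])
  have shift: "(\<integral>x. \<psi> (x + c) \<partial>lborel) = (\<integral>x. \<psi> x \<partial>lborel)"
      "integrable lborel (\<lambda>x. \<psi> (x + c))" for c
  proof -
    have "(\<integral>x. \<psi> x \<partial>lborel) = (\<integral>x. \<psi> x \<partial>distr lborel borel ((+) c))"
      by (simp add: lborel_distr_plus)
    also have "\<dots> = (\<integral>x. \<psi> (c + x) \<partial>lborel)"
      using meas_\<psi> by (intro integral_distr) auto
    finally show "(\<integral>x. \<psi> (x + c) \<partial>lborel) = (\<integral>x. \<psi> x \<partial>lborel)" by (simp add: add.commute)
    have "integrable (distr lborel borel ((+) c)) \<psi>" using int_\<psi> by (simp add: lborel_distr_plus)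
    then have "integrable lborel (\<lambda>x. \<psi> (c + x))"
      using meas_\<psi> by (subst (asm) integrable_distr_eq) auto
    then show "integrable lborel (\<lambda>x. \<psi> (x + c))" by (simp add: add.commute)
  qed
  have q0: "(\<integral>x. q n x \<partial>lborel) = 0" for n
    unfolding q_def using shift int_\<psi> by simp
  have "(\<lambda>n. \<integral>x. q n x \<partial>lborel) \<longlonglongrightarrow> (\<integral>x. D x \<partial>lborel)"
  proof (rule integral_dominated_convergence[where w = "\<lambda>x. \<bar>M\<bar> * indicator Q x"])
    show "D \<in> borel_measurable lborel" using borel_measurable_continuous_onI[OF cont] by simp
    show "q n \<in> borel_measurable lborel" for n
      unfolding q_def using shift int_\<psi> by (intro borel_measurable_integrable) auto
    show "integrable lborel (\<lambda>x. \<bar>M\<bar> * indicator Q x)"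
      unfolding Q_def using emeasure_lborel_cball_finite[of "0::'a" "R + norm b"]
      by (intro integrable_mult_right integrable_real_indicator) auto
    show "AE x in lborel. (\<lambda>n. q n x) \<longlonglongrightarrow> D x"
    proof (rule AE_I2)
      fix x
      have "((\<lambda>s. (\<psi> (x + s *\<^sub>R b) - \<psi> x) / s) \<longlongrightarrow> D x) (at 0)"
        using line[of x 0] by (simp add: has_field_derivative_iff)
      moreover have "filterlim h (at 0) sequentially"
      proof -
        have "h = (\<lambda>n. inverse (real (Suc n)))" by (simp add: fun_eq_iff h_def inverse_eq_divide)
        moreover have "\<forall>\<^sub>F n in sequentially. h n \<in> UNIV \<and> h n \<noteq> 0"
          using h(1) by (intro always_eventually) (auto simp: less_le)
        ultimately show ?thesis
          unfolding filterlim_at using LIMSEQ_inverse_real_of_nat by simp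
      qed
      ultimately show "(\<lambda>n. q n x) \<longlonglongrightarrow> D x"
        unfolding q_def by (rule filterlim_compose)
    qed
    show "AE x in lborel. norm (q n x) \<le> \<bar>M\<bar> * indicator Q x" for n
    proof (rule AE_I2)
      fix x
      show "norm (q n x) \<le> \<bar>M\<bar> * indicator Q x"
      proof (cases "x \<in> Q")
        case True
        have "\<exists>s>0. s < h n \<and>
            \<psi> (x + h n *\<^sub>R b) - \<psi> (x + 0 *\<^sub>R b) = (h n - 0) * D (x + s *\<^sub>R b)"
          by (rule MVT2[OF h(1)]) (rule line)
        then obtain s where "\<psi> (x + h n *\<^sub>R b) - \<psi> (x + 0 *\<^sub>R b) = (h n - 0) * D (x + s *\<^sub>R b)"
          by (elim exE conjE)
        then have "q n x = D (x + s *\<^sub>R b)" using h(1)[of n] by (simp add: q_def)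
        then show ?thesis using D_le True by simp
      next
        case False
        then have n: "R + norm b < norm x" by (simp add: Q_def)
        have "norm (h n *\<^sub>R b) \<le> norm b"
          using h[of n] by (simp add: mult_left_le_one_le)
        then have "R < norm (x + h n *\<^sub>R b)"
          using n norm_triangle_ineq2[of x "- (h n *\<^sub>R b)"] by simp
        moreover have "R < norm x" using n norm_ge_zero[of b] by linarith
        ultimately have "x \<notin> K" "x + h n *\<^sub>R b \<notin> K" using R by (meson not_le)+
        then show ?thesis using outside False by (simp add: q_def)
      qed
    qed
  qed
  then show ?thesis by (simp add: q0 LIMSEQ_const_iff)
qed

lemma integral_lebesgue_on_eq_lborel:
  fixes h :: "'a::euclidean_space \<Rightarrow> real"
  assumes "open \<Omega>" "h \<in> borel_measurable borel" "\<And>x. x \<notin> \<Omega> \<Longrightarrow> h x = 0"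
  shows "(\<integral>x. h x \<partial>lebesgue_on \<Omega>) = (\<integral>x. h x \<partial>lborel)"
proof -
  have "(\<integral>x. h x \<partial>lebesgue_on \<Omega>) = (\<integral>x. indicator \<Omega> x *\<^sub>R h x \<partial>lebesgue)"
    using assms(1) by (intro integral_restrict_space) auto
  also have "\<dots> = (\<integral>x. h x \<partial>lebesgue)"
    using assms(3) by (intro Bochner_Integration.integral_cong) (auto simp: indicator_def)
  also have "\<dots> = (\<integral>x. h x \<partial>lborel)"
    using assms(2) by (intro integral_completion) simp
  finally show ?thesis .
qed

lemma test_function_derivative:
  assumes "\<phi> \<in> test_functions \<Omega>"
  shows "(\<phi> has_derivative frechet_derivative \<phi> (at x)) (at x)"
proof -
  have "C_diff (Suc 0) \<phi>" using assms unfolding test_functions_def by blast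
  then show ?thesis by (simp add: frechet_derivative_works[symmetric])
qed

lemma test_function_continuous:
  assumes "\<phi> \<in> test_functions \<Omega>"
  shows "continuous_on UNIV \<phi>" "b \<in> Basis \<Longrightarrow> continuous_on UNIV (partial_deriv b \<phi>)"
proof -
  have "C_diff 0 \<phi>" "C_diff (Suc 0) \<phi>" using assms unfolding test_functions_def by blast+
  then show "continuous_on UNIV \<phi>" "b \<in> Basis \<Longrightarrow> continuous_on UNIV (partial_deriv b \<phi>)" by auto
qed

lemma C_diff_diff:
  assumes "C_diff m \<phi>" "C_diff m \<psi>"
  shows "C_diff m (\<lambda>x. \<phi> x - \<psi> x)"
  using assms
proof (induction m arbitrary: \<phi> \<psi>)
  case 0
  then show ?case by (auto intro: continuous_on_diff)
next
  case (Suc m)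
  then have d: "(\<phi> has_derivative frechet_derivative \<phi> (at x)) (at x)"
    "(\<psi> has_derivative frechet_derivative \<psi> (at x)) (at x)" for x
    by (simp_all add: frechet_derivative_works[symmetric])
  have "partial_deriv b (\<lambda>x. \<phi> x - \<psi> x) = (\<lambda>x. partial_deriv b \<phi> x - partial_deriv b \<psi> x)" for b
    using frechet_derivative_at[OF has_derivative_diff[OF d]] by (metis (no_types, lifting))
  then show ?case using Suc by (auto intro: differentiable_diff)
qed

lemma partial_deriv_diff:
  assumes "\<phi> \<in> test_functions \<Omega>" "\<psi> \<in> test_functions \<Omega>"
  shows "partial_deriv b (\<lambda>x. \<phi> x - \<psi> x) x = partial_deriv b \<phi> x - partial_deriv b \<psi> x"
  using test_function_derivative[OF assms(1), of x] test_function_derivative[OF assms(2), of x]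
  by (rule fun_cong[OF frechet_derivative_at[OF has_derivative_diff], symmetric])

lemma grad_diff:
  assumes "\<phi> \<in> test_functions \<Omega>" "\<psi> \<in> test_functions \<Omega>"
  shows "grad (\<lambda>x. \<phi> x - \<psi> x) x = grad \<phi> x - grad \<psi> x"
  unfolding grad_def partial_deriv_diff[OF assms] by (simp add: scaleR_diff_left sum_subtractf)

lemma test_functions_diff:
  assumes "\<phi> \<in> test_functions \<Omega>" "\<psi> \<in> test_functions \<Omega>"
  shows "(\<lambda>x. \<phi> x - \<psi> x) \<in> test_functions \<Omega>"
proof -
  have sub: "closure {x. \<phi> x - \<psi> x \<noteq> 0} \<subseteq> closure {x. \<phi> x \<noteq> 0} \<union> closure {x. \<psi> x \<noteq> 0}"
    unfolding closure_Un[symmetric] by (intro closure_mono) auto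
  have "bounded (closure {x. \<phi> x \<noteq> 0} \<union> closure {x. \<psi> x \<noteq> 0})"
    using assms by (auto simp: test_functions_def intro: compact_imp_bounded)
  from bounded_subset[OF this sub] have "compact (closure {x. \<phi> x - \<psi> x \<noteq> 0})"
    by (simp only: compact_eq_bounded_closed closed_closure simp_thms)
  then show ?thesis
    using sub assms by (auto simp: test_functions_def intro: C_diff_diff)
qed

lemma grad_inner_Basis: "b \<in> Basis \<Longrightarrow> grad \<phi> x \<bullet> b = partial_deriv b \<phi> x"
  unfolding grad_def by (simp add: inner_sum_left inner_Basis if_distrib cong: if_cong)

lemma test_function_L2:
  assumes "open \<Omega>" "bounded \<Omega>" "\<phi> \<in> test_functions \<Omega>"
  shows "\<phi> \<in> L2 \<Omega>" "b \<in> Basis \<Longrightarrow> partial_deriv b \<phi> \<in> L2 \<Omega>" "grad \<phi> \<in> L2 \<Omega>"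
proof -
  note c = test_function_continuous[OF assms(3)]
  show "\<phi> \<in> L2 \<Omega>" "b \<in> Basis \<Longrightarrow> partial_deriv b \<phi> \<in> L2 \<Omega>"
    using c assms by (auto intro: continuous_imp_L2)
  have "continuous_on UNIV (grad \<phi>)"
    unfolding grad_def using c(2) by (intro continuous_intros) auto
  then show "grad \<phi> \<in> L2 \<Omega>" using assms by (intro continuous_imp_L2)
qed

text \<open>Integrating the derivative of \<open>x\<^sub>b * \<phi>\<^sup>2\<close> in a coordinate direction \<open>b\<close> expresses \<open>\<integral> \<phi>\<^sup>2\<close> by
\<open>- 2 \<integral> x\<^sub>b \<phi> \<partial>\<^sub>b \<phi>\<close>, and the coordinate is bounded on the domain.\<close>

lemma Poincare_test_function:
  fixes \<Omega> :: "'a::euclidean_space set"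
  assumes \<Omega>: "open \<Omega>" "bounded \<Omega>" and R: "0 \<le> R" "\<And>x. x \<in> \<Omega> \<Longrightarrow> norm x \<le> R"
    and \<phi>: "\<phi> \<in> test_functions \<Omega>"
  shows "L2_norm \<Omega> \<phi> \<le> 2 * R * L2_norm \<Omega> (grad \<phi>)"
proof -
  obtain b :: 'a where b: "b \<in> Basis" using nonempty_Basis by blast
  let ?d = "partial_deriv b \<phi>"
  define K where "K = closure {x. \<phi> x \<noteq> 0}"
  have K: "compact K" "K \<subseteq> \<Omega>" using \<phi> by (auto simp: K_def test_functions_def)
  have out: "\<phi> x = 0" if "x \<notin> K" for x
    using that closure_subset[of "{x. \<phi> x \<noteq> 0}"] by (auto simp: K_def)
  have cont: "continuous_on UNIV \<phi>" "continuous_on UNIV ?d"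
    using test_function_continuous[OF \<phi>] b by auto
  let ?x\<phi> = "\<lambda>x. (x \<bullet> b) * \<phi> x"
  let ?D = "\<lambda>x. \<phi> x * \<phi> x + 2 * (?x\<phi> x * ?d x)"
  have L2s: "\<phi> \<in> L2 \<Omega>" "?d \<in> L2 \<Omega>" "grad \<phi> \<in> L2 \<Omega>" "?x\<phi> \<in> L2 \<Omega>"
    using test_function_L2[OF \<Omega> \<phi>] b cont \<Omega> by (auto intro!: continuous_imp_L2 continuous_intros)
  have contD: "continuous_on UNIV ?D" using cont by (intro continuous_intros)
  have "(\<integral>x. ?D x \<partial>lborel) = 0"
  proof (rule integral_directional_derivative_eq_0[where K = K and b = b])
    show "((\<lambda>x. (x \<bullet> b) * (\<phi> x * \<phi> x)) has_derivative
        (\<lambda>h. (x \<bullet> b) * (\<phi> x * frechet_derivative \<phi> (at x) h + frechet_derivative \<phi> (at x) h * \<phi> x)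
          + (h \<bullet> b) * (\<phi> x * \<phi> x))) (at x)" for x
      using test_function_derivative[OF \<phi>, of x] by (auto intro!: derivative_eq_intros)
    show "?D x = (x \<bullet> b) * (\<phi> x * ?d x + ?d x * \<phi> x) + (b \<bullet> b) * (\<phi> x * \<phi> x)" for x
      using b by (simp add: algebra_simps)
    show "bounded K" using K by (simp add: compact_imp_bounded)
  qed (use out contD in auto)
  moreover have "(\<integral>x. ?D x \<partial>lebesgue_on \<Omega>) = (\<integral>x. ?D x \<partial>lborel)"
  proof (intro integral_lebesgue_on_eq_lborel borel_measurable_continuous_onI contD \<Omega>)
    fix x assume "x \<notin> \<Omega>"
    then have "\<phi> x = 0" using out K(2) by blast
    then show "?D x = 0" by simp
  qed
  moreover have "(\<integral>x. ?D x \<partial>lebesgue_on \<Omega>) = L2_inner \<Omega> \<phi> \<phi> + 2 * L2_inner \<Omega> ?x\<phi> ?d"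
    using L2_inner_integrable[OF L2s(1,1)] L2_inner_integrable[OF L2s(4,2)]
    by (simp add: L2_inner_def)
  ultimately have "(L2_norm \<Omega> \<phi>)\<^sup>2 \<le> 2 * \<bar>L2_inner \<Omega> ?x\<phi> ?d\<bar>"
    by (simp add: L2_norm_squared)
  also have "\<dots> \<le> 2 * (L2_norm \<Omega> ?x\<phi> * L2_norm \<Omega> ?d)"
    using L2_Cauchy_Schwarz[OF L2s(4,2)] by simp
  also have "\<dots> \<le> 2 * ((R * L2_norm \<Omega> \<phi>) * (1 * L2_norm \<Omega> (grad \<phi>)))"
  proof -
    have "L2_norm \<Omega> ?x\<phi> \<le> R * L2_norm \<Omega> \<phi>"
    proof (rule L2_norm_mono[OF L2s(4,1) R(1)])
      fix x assume "x \<in> \<Omega>"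
      then have "\<bar>x \<bullet> b\<bar> \<le> R" using Basis_le_norm[OF b, of x] R(2)[of x] by linarith
      then show "norm (?x\<phi> x) \<le> R * norm (\<phi> x)" by (simp add: abs_mult mult_right_mono)
    qed
    moreover have "L2_norm \<Omega> ?d \<le> 1 * L2_norm \<Omega> (grad \<phi>)"
      using Basis_le_norm[OF b] by (intro L2_norm_mono L2s) (simp_all add: grad_inner_Basis[OF b, symmetric])
    ultimately show ?thesis using R by (intro mult_left_mono mult_mono) auto
  qed
  finally have "L2_norm \<Omega> \<phi> * L2_norm \<Omega> \<phi> \<le> (2 * R * L2_norm \<Omega> (grad \<phi>)) * L2_norm \<Omega> \<phi>"
    by (simp add: power2_eq_square mult_ac)
  then show ?thesis
    using R L2_norm_nonneg[of \<Omega> \<phi>] L2_norm_nonneg[of \<Omega> "grad \<phi>"]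
    by (cases "L2_norm \<Omega> \<phi> = 0") (auto simp: mult_le_cancel_right)
qed

lemma H01_approximation:
  assumes "H01 \<Omega> v g"
  obtains \<phi> where "\<And>m. \<phi> m \<in> test_functions \<Omega>"
    "(\<lambda>m. L2_norm \<Omega> (\<lambda>x. v x - \<phi> m x)) \<longlonglongrightarrow> 0" "(\<lambda>m. L2_norm \<Omega> (\<lambda>x. g x - grad (\<phi> m) x)) \<longlonglongrightarrow> 0"
proof -
  obtain \<phi> where \<phi>: "\<And>m. \<phi> m \<in> test_functions \<Omega>"
    and lim: "(\<lambda>m. sqrt ((L2_norm \<Omega> (\<lambda>x. v x - \<phi> m x))\<^sup>2 +
                 (L2_norm \<Omega> (\<lambda>x. g x - grad (\<phi> m) x))\<^sup>2)) \<longlonglongrightarrow> 0"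
    using assms unfolding H01_def by blast
  show thesis
  proof (rule that[OF \<phi>])
    show "(\<lambda>m. L2_norm \<Omega> (\<lambda>x. v x - \<phi> m x)) \<longlonglongrightarrow> 0"
      by (rule tendsto_sandwich[OF _ _ tendsto_const lim]) (auto intro: real_sqrt_sum_squares_ge1)
    show "(\<lambda>m. L2_norm \<Omega> (\<lambda>x. g x - grad (\<phi> m) x)) \<longlonglongrightarrow> 0"
      by (rule tendsto_sandwich[OF _ _ tendsto_const lim]) (auto intro: real_sqrt_sum_squares_ge2)
  qed
qed

lemma sobolev_constant_exists:
  fixes \<Omega> :: "'a::euclidean_space set"
  assumes \<Omega>: "open \<Omega>" "bounded \<Omega>"
  shows "\<exists>C. sobolev_constant \<Omega> C"
proof -
  obtain R where R: "0 < R" "\<And>x. x \<in> \<Omega> \<Longrightarrow> norm x \<le> R" using \<Omega>(2) bounded_pos by blast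
  have "L2_norm \<Omega> v \<le> 2 * R * L2_norm \<Omega> g" if H: "H01 \<Omega> v g" for v g
  proof -
    obtain \<phi> where \<phi>: "\<And>m. \<phi> m \<in> test_functions \<Omega>"
      and lim: "(\<lambda>m. L2_norm \<Omega> (\<lambda>x. v x - \<phi> m x)) \<longlonglongrightarrow> 0"
        "(\<lambda>m. L2_norm \<Omega> (\<lambda>x. g x - grad (\<phi> m) x)) \<longlonglongrightarrow> 0"
      using H01_approximation[OF H] by blast
    have vg: "v \<in> L2 \<Omega>" "g \<in> L2 \<Omega>" using H by (auto simp: H01_def)
    have "L2_norm \<Omega> v \<le> L2_norm \<Omega> (\<lambda>x. v x - \<phi> m x) +
        2 * R * (L2_norm \<Omega> (\<lambda>x. g x - grad (\<phi> m) x) + L2_norm \<Omega> g)" for m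
    proof -
      note L2s = test_function_L2[OF \<Omega> \<phi>]
      have "L2_norm \<Omega> v \<le> L2_norm \<Omega> (\<lambda>x. v x - \<phi> m x) + L2_norm \<Omega> (\<phi> m)"
        by (rule L2_norm_triangle_sub[OF vg(1) L2s(1)])
      also have "L2_norm \<Omega> (\<phi> m) \<le> 2 * R * L2_norm \<Omega> (grad (\<phi> m))"
        using R by (intro Poincare_test_function \<Omega> \<phi>) auto
      also have "L2_norm \<Omega> (grad (\<phi> m)) \<le> L2_norm \<Omega> (\<lambda>x. g x - grad (\<phi> m) x) + L2_norm \<Omega> g"
        using L2_norm_triangle_sub[OF L2s(3) vg(2), of m] by (simp add: L2_norm_minus_commute)
      finally show ?thesis using R by simp
    qed
    moreover have "(\<lambda>m. L2_norm \<Omega> (\<lambda>x. v x - \<phi> m x) +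
        2 * R * (L2_norm \<Omega> (\<lambda>x. g x - grad (\<phi> m) x) + L2_norm \<Omega> g)) \<longlonglongrightarrow>
        0 + 2 * R * (0 + L2_norm \<Omega> g)"
      by (intro tendsto_intros lim)
    ultimately show ?thesis
      using LIMSEQ_le_const[of _ _ "L2_norm \<Omega> v"] by fastforce
  qed
  then show ?thesis using R by (intro exI[of _ "2 * R"]) (auto simp: sobolev_constant_def)
qed

lemma H01_diff:
  fixes \<Omega> :: "'a::euclidean_space set"
  assumes \<Omega>: "open \<Omega>" "bounded \<Omega>" and v: "H01 \<Omega> v g" and w: "H01 \<Omega> w h"
  shows "H01 \<Omega> (\<lambda>x. v x - w x) (\<lambda>x. g x - h x)"
proof -
  have L2s: "v \<in> L2 \<Omega>" "g \<in> L2 \<Omega>" "w \<in> L2 \<Omega>" "h \<in> L2 \<Omega>"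
    using v w by (auto simp: H01_def)
  have weak: "has_weak_gradient \<Omega> (\<lambda>x. v x - w x) (\<lambda>x. g x - h x)"
    unfolding has_weak_gradient_def
  proof (intro ballI)
    fix \<phi> and b :: 'a assume \<phi>: "\<phi> \<in> test_functions \<Omega>" and b: "b \<in> Basis"
    note T = test_function_L2[OF \<Omega> \<phi>]
    have "L2_inner \<Omega> v (partial_deriv b \<phi>) = - L2_inner \<Omega> (\<lambda>x. g x \<bullet> b) \<phi>"
      "L2_inner \<Omega> w (partial_deriv b \<phi>) = - L2_inner \<Omega> (\<lambda>x. h x \<bullet> b) \<phi>"
      using v w \<phi> b by (auto simp: H01_def has_weak_gradient_def)
    then show "L2_inner \<Omega> (\<lambda>x. v x - w x) (partial_deriv b \<phi>) =
        - L2_inner \<Omega> (\<lambda>x. (g x - h x) \<bullet> b) \<phi>"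
      using L2s T b by (simp add: L2_inner_diff_left inner_diff_left L2_component)
  qed
  obtain \<phi> where \<phi>: "\<And>m. \<phi> m \<in> test_functions \<Omega>"
      and lim\<phi>: "(\<lambda>m. L2_norm \<Omega> (\<lambda>x. v x - \<phi> m x)) \<longlonglongrightarrow> 0"
        "(\<lambda>m. L2_norm \<Omega> (\<lambda>x. g x - grad (\<phi> m) x)) \<longlonglongrightarrow> 0"
      using H01_approximation[OF v] by blast
  obtain \<psi> where \<psi>: "\<And>m. \<psi> m \<in> test_functions \<Omega>"
      and lim\<psi>: "(\<lambda>m. L2_norm \<Omega> (\<lambda>x. w x - \<psi> m x)) \<longlonglongrightarrow> 0"
        "(\<lambda>m. L2_norm \<Omega> (\<lambda>x. h x - grad (\<psi> m) x)) \<longlonglongrightarrow> 0"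
      using H01_approximation[OF w] by blast
  define \<xi> where "\<xi> m x = \<phi> m x - \<psi> m x" for m x
  have grad_\<xi>: "grad (\<xi> m) x = grad (\<phi> m) x - grad (\<psi> m) x" for m x
    unfolding \<xi>_def by (rule grad_diff[OF \<phi> \<psi>])
  note T\<phi> = test_function_L2[OF \<Omega> \<phi>] and T\<psi> = test_function_L2[OF \<Omega> \<psi>]
  have lim_v: "(\<lambda>m. L2_norm \<Omega> (\<lambda>x. (v x - w x) - \<xi> m x)) \<longlonglongrightarrow> 0"
  proof (rule tendsto_sandwich[OF _ _ tendsto_const])
    show "\<forall>\<^sub>F m in sequentially. L2_norm \<Omega> (\<lambda>x. (v x - w x) - \<xi> m x)
        \<le> L2_norm \<Omega> (\<lambda>x. v x - \<phi> m x) + L2_norm \<Omega> (\<lambda>x. w x - \<psi> m x)"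
      using L2_norm_diff_triangle[OF L2_diff[OF L2s(1) T\<phi>(1)] L2_diff[OF L2s(3) T\<psi>(1)]]
      by (simp add: \<xi>_def algebra_simps)
    show "(\<lambda>m. L2_norm \<Omega> (\<lambda>x. v x - \<phi> m x) + L2_norm \<Omega> (\<lambda>x. w x - \<psi> m x)) \<longlonglongrightarrow> 0"
      using tendsto_add[OF lim\<phi>(1) lim\<psi>(1)] by simp
  qed simp
  have lim_g: "(\<lambda>m. L2_norm \<Omega> (\<lambda>x. (g x - h x) - grad (\<xi> m) x)) \<longlonglongrightarrow> 0"
  proof (rule tendsto_sandwich[OF _ _ tendsto_const])
    show "\<forall>\<^sub>F m in sequentially. L2_norm \<Omega> (\<lambda>x. (g x - h x) - grad (\<xi> m) x)
        \<le> L2_norm \<Omega> (\<lambda>x. g x - grad (\<phi> m) x) + L2_norm \<Omega> (\<lambda>x. h x - grad (\<psi> m) x)"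
      using L2_norm_diff_triangle[OF L2_diff[OF L2s(2) T\<phi>(3)] L2_diff[OF L2s(4) T\<psi>(3)]]
      by (simp add: grad_\<xi> algebra_simps)
    show "(\<lambda>m. L2_norm \<Omega> (\<lambda>x. g x - grad (\<phi> m) x) + L2_norm \<Omega> (\<lambda>x. h x - grad (\<psi> m) x)) \<longlonglongrightarrow> 0"
      using tendsto_add[OF lim\<phi>(2) lim\<psi>(2)] by simp
  qed simp
  have "(\<lambda>m. sqrt ((L2_norm \<Omega> (\<lambda>x. (v x - w x) - \<xi> m x))\<^sup>2 +
      (L2_norm \<Omega> (\<lambda>x. (g x - h x) - grad (\<xi> m) x))\<^sup>2)) \<longlonglongrightarrow> sqrt (0\<^sup>2 + 0\<^sup>2)"
    by (intro tendsto_intros lim_v lim_g)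
  moreover have "\<xi> m \<in> test_functions \<Omega>" for m
    unfolding \<xi>_def by (rule test_functions_diff[OF \<phi> \<psi>])
  ultimately show ?thesis
    unfolding H01_def using L2s weak by (auto intro!: L2_diff exI[of _ \<xi>])
qed

section \<open>The energy estimate\<close>

text \<open>Applied at each point of the domain, the operator is a finite linear combination of the functions
\<open>u j\<close>, with coefficients that do not depend on the point.\<close>

lemma L2_operator_in_L2:
  fixes u :: "nat \<Rightarrow> 'a::euclidean_space \<Rightarrow> real"
  assumes t: "widening_mesh t" and \<alpha>: "0 < \<alpha>" "\<alpha> < 1" and k: "1 \<le> k"
    and u: "\<And>j. j \<le> k \<Longrightarrow> u j \<in> L2 \<Omega>"
  shows "(\<lambda>x. L2_operator \<alpha> t k (\<lambda>j. u j x)) \<in> L2 \<Omega>"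
proof -
  have scale: "(\<lambda>x. c * v x) \<in> L2 \<Omega>" if "v \<in> L2 \<Omega>" for c and v :: "'a \<Rightarrow> real"
    using L2_scale[OF that, of c] by simp
  have incr: "(\<lambda>x. c * incr (\<lambda>j. u j x) j) \<in> L2 \<Omega>" if "j \<le> k" for c j
    unfolding incr_def using that by (intro scale L2_diff u) auto
  show ?thesis
  proof (cases "k = 1")
    case True
    show ?thesis
      unfolding True L2_operator_Suc0[OF \<alpha> step_pos[OF t order_refl]]
      by (intro scale incr k)
  next
    case False
    then have "k \<ge> 2" using k by simp
    then show ?thesis
      unfolding L2_operator_eq[OF t \<alpha> \<open>k \<ge> 2\<close>]
      by (intro scale L2_add L2_diff L2_sum incr) auto
  qed
qed

lemma summation_by_parts_L2:
  assumes f: "\<And>k. k \<in> {1..n} \<Longrightarrow> F k \<in> L2 \<Omega>" and u: "\<And>k. k \<le> n \<Longrightarrow> u k \<in> L2 \<Omega>" and n: "1 \<le> n"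
  shows "(\<Sum>k=1..n. L2_inner \<Omega> (F k) (\<lambda>x. u k x - u (k - 1) x)) =
    L2_inner \<Omega> (F n) (u n) - L2_inner \<Omega> (F 1) (u 0)
    - (\<Sum>k=1..n - 1. L2_inner \<Omega> (\<lambda>x. F (Suc k) x - F k x) (u k))"
  using n f u
proof (induction n rule: dec_induct)
  case base
  then show ?case by (simp add: L2_inner_diff_right)
next
  case (step m)
  have IH: "(\<Sum>k=1..m. L2_inner \<Omega> (F k) (\<lambda>x. u k x - u (k - 1) x)) =
    L2_inner \<Omega> (F m) (u m) - L2_inner \<Omega> (F 1) (u 0)
    - (\<Sum>k=1..m - 1. L2_inner \<Omega> (\<lambda>x. F (Suc k) x - F k x) (u k))"
    using step.prems by (intro step.IH) auto
  have L2s: "F (Suc m) \<in> L2 \<Omega>" "F m \<in> L2 \<Omega>" "u (Suc m) \<in> L2 \<Omega>" "u m \<in> L2 \<Omega>"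
    using step.prems step.hyps by auto
  have last: "(\<Sum>k=1..m. L2_inner \<Omega> (\<lambda>x. F (Suc k) x - F k x) (u k)) =
      (\<Sum>k=1..m - 1. L2_inner \<Omega> (\<lambda>x. F (Suc k) x - F k x) (u k)) +
      L2_inner \<Omega> (\<lambda>x. F (Suc m) x - F m x) (u m)"
    using step.hyps sum.cl_ivl_Suc[of _ 1 "m - 1"] by (cases m) auto
  show ?case
    using L2s IH last by (simp add: L2_inner_diff_right L2_inner_diff_left)
qed

lemma graded_mesh_in_interval:
  assumes "0 < T" "1 \<le> N" "0 \<le> r" "k \<le> N"
  shows "graded_mesh T N r k \<in> {0..T}"
proof -
  have "(real k / real N) powr r \<le> 1 powr r"
    using assms by (intro powr_mono2) auto
  then show ?thesis using assms by (simp add: graded_mesh_def mult_left_le_one_le)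
qed

theorem theorem4p4:
  fixes \<Omega> :: "(real ^ 'd) set" and T :: real and f :: "real \<Rightarrow> real ^ 'd \<Rightarrow> real"
  assumes "bounded_lipschitz_domain \<Omega>" and "T > 0"
    and "\<And>t. t \<in> {0..T} \<Longrightarrow> f t \<in> L2 \<Omega>"
    and "bounded_in_time \<Omega> T f" and "bounded_variation_in_time \<Omega> T f"
  shows "(\<exists>C\<^sub>\<Omega>. sobolev_constant \<Omega> C\<^sub>\<Omega>) \<and>
    (\<exists>C\<^sub>f\<ge>0. \<forall>C\<^sub>\<Omega> \<alpha> r (N::nat) u\<^sub>0 Du\<^sub>0 u Du.
      sobolev_constant \<Omega> C\<^sub>\<Omega> \<longrightarrow> \<alpha> \<in> {0<..<1} \<longrightarrow> 1 < r \<longrightarrow> r \<le> 3.2016538 \<longrightarrow> N \<ge> 1 \<longrightarrow>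
      H01 \<Omega> u\<^sub>0 Du\<^sub>0 \<longrightarrow> u 0 = u\<^sub>0 \<longrightarrow>
      L2_scheme_solution \<Omega> \<alpha> (graded_mesh T N r) N f u Du \<longrightarrow>
      (\<forall>n\<in>{1..N}. L2_norm \<Omega> (Du n) \<le> L2_norm \<Omega> Du\<^sub>0 + 2 * C\<^sub>f * C\<^sub>\<Omega>))"
proof
  have \<Omega>: "open \<Omega>" "bounded \<Omega>" using assms(1) by (auto simp: bounded_lipschitz_domain_def)
  then show "\<exists>C\<^sub>\<Omega>. sobolev_constant \<Omega> C\<^sub>\<Omega>" by (rule sobolev_constant_exists)
  obtain B where B: "\<And>t. t \<in> {0..T} \<Longrightarrow> L2_norm \<Omega> (f t) \<le> B"
    using assms(4) unfolding bounded_in_time_def by blast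
  obtain V where V: "\<And>(m::nat) s. strict_mono_on {0..m} s \<Longrightarrow> s ` {0..m} \<subseteq> {0..T} \<Longrightarrow>
      (\<Sum>i=1..m. L2_norm \<Omega> (\<lambda>x. f (s i) x - f (s (i - 1)) x)) \<le> V"
    using assms(5) unfolding bounded_variation_in_time_def by blast
  have "0 \<le> B" using assms(2) by (intro order_trans[OF L2_norm_nonneg B[of 0]]) simp
  moreover have "0 \<le> V"
  proof -
    have "strict_mono_on {0..0::nat} (\<lambda>_. 0::real)" by (auto simp: strict_mono_on_def)
    from V[OF this] show ?thesis using assms(2) by simp
  qed
  ultimately have BV: "0 \<le> B" "0 \<le> V" "0 \<le> 2 * B + V" by auto
  have "L2_norm \<Omega> (Du n) \<le> L2_norm \<Omega> Du\<^sub>0 + 2 * (2 * B + V) * C"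
    if C: "sobolev_constant \<Omega> C" and \<alpha>: "\<alpha> \<in> {0<..<1}" and r: "1 < r" "r \<le> 3.2016538"
      and N: "N \<ge> 1" and H0: "H01 \<Omega> u\<^sub>0 Du\<^sub>0" and u0: "u 0 = u\<^sub>0"
      and sol: "L2_scheme_solution \<Omega> \<alpha> (graded_mesh T N r) N f u Du" and n: "n \<in> {1..N}"
    for C \<alpha> r u\<^sub>0 Du\<^sub>0 u Du and N n :: nat
  proof -
    define t where "t = graded_mesh T N r"
    define G where "G k = (if k = 0 then Du\<^sub>0 else Du k)" for k
    define d where "d k = (\<lambda>x. u k x - u (k - 1) x)" for k
    have "G 0 = Du\<^sub>0" by (simp add: G_def)
    have \<alpha>': "0 < \<alpha>" "\<alpha> < 1" using \<alpha> by auto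
    have mesh: "widening_mesh t"
      unfolding t_def using assms(2) N r by (intro graded_mesh_widening) auto
    note mono = widening_mesh_strict_mono[OF mesh]
    have H: "H01 \<Omega> (u k) (G k)" if "k \<le> N" for k
      using that sol H0 u0 by (cases "k = 0") (auto simp: G_def L2_scheme_solution_def)
    have u_L2: "u k \<in> L2 \<Omega>" and G_L2: "G k \<in> L2 \<Omega>" if "k \<le> N" for k
      using H[OF that] by (auto simp: H01_def)
    have tk: "t k \<in> {0..T}" if "k \<le> N" for k
      unfolding t_def using assms(2) N r that by (intro graded_mesh_in_interval) auto
    have f_L2: "f (t k) \<in> L2 \<Omega>" if "k \<le> N" for k using assms(3) tk[OF that] .
    have d_L2: "d k \<in> L2 \<Omega>" if "k \<le> N" for k
      unfolding d_def using that by (intro L2_diff u_L2) auto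
    define L where "L k = (\<lambda>x. L2_operator \<alpha> t k (\<lambda>j. u j x))" for k
    have L_L2: "L k \<in> L2 \<Omega>" if "k \<in> {1..N}" for k
      unfolding L_def using that by (intro L2_operator_in_L2 mesh \<alpha>' u_L2) auto
    have u_le: "L2_norm \<Omega> (u k) \<le> C * L2_norm \<Omega> (G k)" if "k \<le> N" for k
      using C H[OF that] by (auto simp: sobolev_constant_def)
    have C0: "0 < C" using C by (auto simp: sobolev_constant_def)
    \<comment> \<open>The scheme is tested with \<open>d k\<close>. The sum of the products on the left is nonnegative at every
      point of the domain, and the gradient terms telescope.\<close>
    have energy: "(L2_norm \<Omega> (G m))\<^sup>2 \<le> (L2_norm \<Omega> Du\<^sub>0)\<^sup>2
        + 2 * (\<Sum>k=1..m. L2_inner \<Omega> (f (t k)) (d k))" if m: "m \<le> N" for m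
    proof -
      have "0 \<le> (\<integral>x. (\<Sum>k=1..m. L k x \<bullet> d k x) \<partial>lebesgue_on \<Omega>)"
      proof (rule Bochner_Integration.integral_nonneg)
        fix x
        have "0 \<le> (\<Sum>k=1..m. incr (\<lambda>j. u j x) k * L2_operator \<alpha> t k (\<lambda>j. u j x))"
          unfolding t_def using assms(2) N r \<alpha>' by (intro graded_mesh_L2_form_nonneg) auto
        then show "0 \<le> (\<Sum>k=1..m. L k x \<bullet> d k x)"
          by (simp add: L_def d_def incr_def mult.commute)
      qed
      also have "\<dots> = (\<Sum>k=1..m. L2_inner \<Omega> (L k) (d k))"
        unfolding L2_inner_def using m
        by (intro Bochner_Integration.integral_sum L2_inner_integrable L_L2 d_L2) auto
      also have "\<dots> \<le> (\<Sum>k=1..m. ((L2_norm \<Omega> (G (k - 1)))\<^sup>2 - (L2_norm \<Omega> (G k))\<^sup>2) / 2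
          + L2_inner \<Omega> (f (t k)) (d k))"
      proof (rule sum_mono)
        fix k assume "k \<in> {1..m}"
        then have k: "k \<in> {1..N}" "k \<le> N" "k - 1 \<le> N" using m by auto
        have "L2_inner \<Omega> (L k) (d k) =
            - L2_inner \<Omega> (Du k) (\<lambda>x. G k x - G (k - 1) x) + L2_inner \<Omega> (f (t k)) (d k)"
          using sol k H01_diff[OF \<Omega> H[OF k(2)] H[OF k(3)]]
          unfolding L2_scheme_solution_def L_def t_def d_def by blast
        moreover have "Du k = G k" using k by (simp add: G_def)
        moreover have "L2_inner \<Omega> (G k) (\<lambda>x. G k x - G (k - 1) x) =
            (L2_norm \<Omega> (G k))\<^sup>2 - L2_inner \<Omega> (G k) (G (k - 1))"
          using k by (simp add: L2_inner_diff_right G_L2 L2_norm_squared)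
        moreover have "0 \<le> (L2_norm \<Omega> (G k))\<^sup>2 - 2 * L2_inner \<Omega> (G k) (G (k - 1))
            + (L2_norm \<Omega> (G (k - 1)))\<^sup>2"
          using L2_norm_diff_squared[OF G_L2[OF k(2)] G_L2[OF k(3)], symmetric] by simp
        ultimately show "L2_inner \<Omega> (L k) (d k) \<le>
            ((L2_norm \<Omega> (G (k - 1)))\<^sup>2 - (L2_norm \<Omega> (G k))\<^sup>2) / 2 + L2_inner \<Omega> (f (t k)) (d k)"
          by (simp add: field_simps)
      qed
      also have "\<dots> = (\<Sum>k=1..m. (L2_norm \<Omega> (G (k - 1)))\<^sup>2 - (L2_norm \<Omega> (G k))\<^sup>2) / 2
          + (\<Sum>k=1..m. L2_inner \<Omega> (f (t k)) (d k))"
        by (simp add: sum.distrib sum_divide_distrib)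
      also have "(\<Sum>k=1..m. (L2_norm \<Omega> (G (k - 1)))\<^sup>2 - (L2_norm \<Omega> (G k))\<^sup>2) =
          (L2_norm \<Omega> (G 0))\<^sup>2 - (L2_norm \<Omega> (G m))\<^sup>2"
        by (induction m) auto
      finally show ?thesis using \<open>G 0 = Du\<^sub>0\<close> by (simp add: field_simps)
    qed
    \<comment> \<open>All indices are compared with the one that has the largest gradient norm, because the source
      term involves all intermediate values.\<close>
    obtain p where p: "p \<le> N" "\<And>k. k \<le> N \<Longrightarrow> L2_norm \<Omega> (G k) \<le> L2_norm \<Omega> (G p)"
    proof -
      have "Max ((\<lambda>k. L2_norm \<Omega> (G k)) ` {..N}) \<in> (\<lambda>k. L2_norm \<Omega> (G k)) ` {..N}"
        by (rule Max_in) auto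
      then obtain p where p: "Max ((\<lambda>k. L2_norm \<Omega> (G k)) ` {..N}) = L2_norm \<Omega> (G p)" "p \<in> {..N}"
        by (rule imageE)
      show thesis
      proof (rule that[of p])
        show "p \<le> N" using p by simp
        show "L2_norm \<Omega> (G k) \<le> L2_norm \<Omega> (G p)" if "k \<le> N" for k
          unfolding p(1)[symmetric] using that by (intro Max_ge) auto
      qed
    qed
    define M where "M = L2_norm \<Omega> (G p)"
    have M0: "0 \<le> M" by (simp add: M_def)
    have u_M: "L2_norm \<Omega> (u k) \<le> C * M" if "k \<le> N" for k
      unfolding M_def using C0
      by (intro order_trans[OF u_le[OF that] mult_left_mono[OF p(2)[OF that]]]) simp
    have source: "(\<Sum>k=1..p. L2_inner \<Omega> (f (t k)) (d k)) \<le> (2 * B + V) * (C * M)" if p1: "1 \<le> p"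
    proof -
      have bound: "\<bar>L2_inner \<Omega> g (u k)\<bar> \<le> c * (C * M)"
        if "g \<in> L2 \<Omega>" "L2_norm \<Omega> g \<le> c" "k \<le> N" for g c k
        using L2_Cauchy_Schwarz[OF that(1) u_L2[OF that(3)]]
          mult_mono[OF that(2) u_M[OF that(3)]] L2_norm_nonneg[of \<Omega> g] that(2) by simp
      have "(\<Sum>k=1..p. L2_inner \<Omega> (f (t k)) (d k)) =
          L2_inner \<Omega> (f (t p)) (u p) - L2_inner \<Omega> (f (t 1)) (u 0)
          - (\<Sum>k=1..p - 1. L2_inner \<Omega> (\<lambda>x. f (t (Suc k)) x - f (t k) x) (u k))"
        unfolding d_def using p p1 by (intro summation_by_parts_L2 f_L2 u_L2) auto
      moreover have "\<bar>L2_inner \<Omega> (f (t p)) (u p)\<bar> \<le> B * (C * M)"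
        using p by (intro bound f_L2 B tk)
      moreover have "\<bar>L2_inner \<Omega> (f (t 1)) (u 0)\<bar> \<le> B * (C * M)"
        using N by (intro bound f_L2 B tk) auto
      moreover have "- (\<Sum>k=1..p - 1. L2_inner \<Omega> (\<lambda>x. f (t (Suc k)) x - f (t k) x) (u k)) \<le> V * (C * M)"
      proof -
        have "- (\<Sum>k=1..p - 1. L2_inner \<Omega> (\<lambda>x. f (t (Suc k)) x - f (t k) x) (u k)) \<le>
            (\<Sum>k=1..p - 1. L2_norm \<Omega> (\<lambda>x. f (t (Suc k)) x - f (t k) x) * (C * M))"
          unfolding sum_negf[symmetric]
        proof (rule sum_mono)
          fix k assume k: "k \<in> {1..p - 1}"
          have "\<bar>L2_inner \<Omega> (\<lambda>x. f (t (Suc k)) x - f (t k) x) (u k)\<bar> \<le>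
              L2_norm \<Omega> (\<lambda>x. f (t (Suc k)) x - f (t k) x) * (C * M)"
            using k p by (intro bound L2_diff f_L2) auto
          then show "- L2_inner \<Omega> (\<lambda>x. f (t (Suc k)) x - f (t k) x) (u k) \<le>
              L2_norm \<Omega> (\<lambda>x. f (t (Suc k)) x - f (t k) x) * (C * M)" by linarith
        qed
        also have "\<dots> = (\<Sum>i=1..p - 1. L2_norm \<Omega> (\<lambda>x. f (t (Suc i)) x - f (t (Suc (i - 1))) x)) * (C * M)"
          unfolding sum_distrib_right by (intro sum.cong) auto
        also have "\<dots> \<le> V * (C * M)"
        proof (rule mult_right_mono)
          show "(\<Sum>i=1..p - 1. L2_norm \<Omega> (\<lambda>x. f (t (Suc i)) x - f (t (Suc (i - 1))) x)) \<le> V"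
          proof (rule V[where s = "\<lambda>i. t (Suc i)"])
            show "strict_mono_on {0..p - 1} (\<lambda>i. t (Suc i))"
              by (intro strict_mono_onI strict_monoD[OF mono]) simp
            show "(\<lambda>i. t (Suc i)) ` {0..p - 1} \<subseteq> {0..T}"
            proof
              fix y assume "y \<in> (\<lambda>i. t (Suc i)) ` {0..p - 1}"
              then obtain i where "y = t (Suc i)" "Suc i \<le> N" using p p1 by auto
              then show "y \<in> {0..T}" using tk by blast
            qed
          qed
        qed (use C0 M0 in simp)
        finally show ?thesis .
      qed
      ultimately show ?thesis by (simp add: distrib_right)
    qed
    have "M \<le> L2_norm \<Omega> Du\<^sub>0 + 2 * (2 * B + V) * C"
    proof (cases "p = 0")
      case True
      then show ?thesis using BV C0 by (simp add: M_def G_def)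
    next
      case False
      define g0 where "g0 = L2_norm \<Omega> Du\<^sub>0"
      have g0: "0 \<le> g0" "g0 \<le> M" using p(2)[of 0] by (auto simp: g0_def M_def G_def)
      have "M\<^sup>2 \<le> g0\<^sup>2 + 2 * ((2 * B + V) * (C * M))"
        using energy[OF p(1)] source False by (simp add: M_def g0_def)
      also have "g0\<^sup>2 \<le> g0 * M" using g0 by (simp add: power2_eq_square mult_left_mono)
      finally have "M * M \<le> (g0 + 2 * (2 * B + V) * C) * M"
        by (simp add: power2_eq_square algebra_simps)
      then show ?thesis
        using M0 g0 BV C0 by (cases "M = 0") (auto simp: mult_le_cancel_right g0_def)
    qed
    moreover have "L2_norm \<Omega> (Du n) \<le> M" using p(2)[of n] n by (simp add: M_def G_def)
    ultimately show ?thesis by simp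
  qed
  then show "\<exists>C\<^sub>f\<ge>0. \<forall>C\<^sub>\<Omega> \<alpha> r (N::nat) u\<^sub>0 Du\<^sub>0 u Du.
      sobolev_constant \<Omega> C\<^sub>\<Omega> \<longrightarrow> \<alpha> \<in> {0<..<1} \<longrightarrow> 1 < r \<longrightarrow> r \<le> 3.2016538 \<longrightarrow> N \<ge> 1 \<longrightarrow>
      H01 \<Omega> u\<^sub>0 Du\<^sub>0 \<longrightarrow> u 0 = u\<^sub>0 \<longrightarrow>
      L2_scheme_solution \<Omega> \<alpha> (graded_mesh T N r) N f u Du \<longrightarrow>
      (\<forall>n\<in>{1..N}. L2_norm \<Omega> (Du n) \<le> L2_norm \<Omega> Du\<^sub>0 + 2 * C\<^sub>f * C\<^sub>\<Omega>)"
    using BV(3) by (intro exI[of _ "2 * B + V"]) blast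
qed

end
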